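(* Let $n\in\mathbb{N}$, $0<s<1$, $1<p<\infty$ satisfy $n/p<1+s$, and let $q=\frac{n(n+1)}{n+2}+\frac{p(n+1+s)}{n+2}$. For every measurable $f:\mathbb{R}^n\to\mathbb{R}$ we have $\mathcal{E}_{p,q}(f)<\infty$ if and only if $[f]_{W^{1+s,p}(\mathbb{R}^n)}<\infty$. Furthermore, there exists a constant $C=C(n,p,s)$ such that \[ C^{-1}[f]^p_{W^{1+s,p}(\mathbb{R}^n)}\le\mathcal{E}_{p,q}(f)\le C[f]^p_{W^{1+s,p}(\mathbb{R}^n)}. \]
   Context: For $f:\mathbb{R}^n\to\mathbb{R}$ measurable write $F(x)=(x,f(x))\in\mathbb{R}^{n+1}$. For $x_0,\dots,x_{n+1}\in\mathbb{R}^n$ let $\Delta(F(x_0),\dots,F(x_{n+1}))$ be the convex hull of the points $F(x_i)$, $\mathcal{H}^{n+1}$ the $(n+1)$-dimensional Hausdorff (=Lebesgue) measure, and $\mathrm{diam}(x_0,\dots,x_{n+1})=\max_{i,j}|x_i-x_j|$. Define \[ \mathcal{E}_{p,q}(f)=\int_{(\mathbb{R}^n)^{n+2}}\frac{\mathcal{H}^{n+1}(\Delta(F(x_0),\dots,F(x_{n+1})))^p}{\mathrm{diam}(x_0,\dots,x_{n+1})^{(n+2)q}}\,dx_0\cdots dx_{n+1}, \] and \[ [f]_{W^{1+s,p}(\mathbb{R}^n)}=\Big(\int_{\mathbb{R}^n}\int_{\mathbb{R}^n}\frac{|f(x+h)-2f(x)+f(x-h)|^p}{|h|^{n+(1+s)p}}\,dh\,dx\Big)^{1/p}.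 \] *)

theory Defs
  imports "HOL-Analysis.Analysis"
begin

definition graph_pt :: "('a::euclidean_space \<Rightarrow> real) \<Rightarrow> 'a \<Rightarrow> 'a \<times> real" where
  "graph_pt f x = (x, f x)"

definition diam_pts :: "nat \<Rightarrow> (nat \<Rightarrow> 'a::euclidean_space) \<Rightarrow> real" where
  "diam_pts m x = Max {dist (x i) (x j) | i j. i \<le> m \<and> j \<le> m}"

text \<open>The energy E_{p,q}(f), n = DIM('a); the n+2 points are indexed by {0..n+1}.
  The (n+1)-dimensional Hausdorff measure on R^(n+1) is Lebesgue measure.\<close>
definition energy :: "real \<Rightarrow> real \<Rightarrow> ('a::euclidean_space \<Rightarrow> real) \<Rightarrow> ennreal" where
  "energy p q f =
     (\<integral>\<^sup>+ x. ennreal (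
        measure lebesgue (convex hull {graph_pt f (x i) | i. i \<le> DIM('a) + 1}) powr p
        / diam_pts (DIM('a) + 1) x powr (real (DIM('a) + 2) * q))
      \<partial>(PiM {..DIM('a) + 1} (\<lambda>_. (lebesgue :: 'a measure))))"

definition sobolev_seminorm_pow :: "real \<Rightarrow> real \<Rightarrow> ('a::euclidean_space \<Rightarrow> real) \<Rightarrow> ennreal" where
  "sobolev_seminorm_pow s p f =
     (\<integral>\<^sup>+ x. (\<integral>\<^sup>+ h. ennreal (\<bar>f (x + h) - 2 * f x + f (x - h)\<bar> powr p
        / norm h powr (real DIM('a) + (1 + s) * p)) \<partial>lebesgue) \<partial>lebesgue)"

end

theory Submission
  imports Defs
begin

text \<open>
  Lower bound. Fix \<open>x\<close>, \<open>h\<close> and points \<open>z\<^sub>b\<close> near \<open>x + |h| b\<close> for the basis vectors \<open>b\<close>, and let \<open>\<ell>\<close> be the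
  affine function that agrees with \<open>f\<close> at \<open>x\<close> and all \<open>z\<^sub>b\<close>. The simplex over \<open>x\<close>, \<open>z\<^sub>b\<close> and \<open>y\<close> has volume comparable
  to \<open>|h|^n |f y - \<ell> y|\<close>, and the values of \<open>f - \<ell>\<close> at \<open>x + h\<close> and \<open>x - h\<close> add up to the second difference of \<open>f\<close>
  at \<open>x\<close>. Integrating over \<open>z\<close> gives the bound.

  Upper bound. If the points lie in a ball of radius \<open>r\<close>, the volume is at most a constant times \<open>r^n\<close> times the largest
  value of \<open>|f - \<ell>|\<close> at the points, for any affine \<open>\<ell>\<close>. Take for \<open>\<ell>\<close> the first Taylor polynomial at \<open>x\<^sub>0\<close> of the
  mollification \<open>f\<^sub>r\<close> of \<open>f\<close> with the even kernel \<open>max 0 (1 - |w|^2/r^2)^3\<close>. As the kernel is even and its second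
  derivatives are even with integral zero, both \<open>f - f\<^sub>r\<close> and the Taylor remainder are averages of second differences with
  increments of norm less than \<open>r\<close>. Writing \<open>diam^(-\<beta>)\<close> as an integral over \<open>r > diam\<close> decouples \<open>r\<close> from the points,
  and Fubini and translation invariance finish the proof.
\<close>

subsection \<open>Volume of simplices spanned by points of a graph\<close>

text \<open>The upper bound cannot start with the mollification, because \<open>f\<close> is only
  measurable: local integrability has to be extracted from the finiteness of the seminorm, and for
  an infinite seminorm there is nothing to prove. The exponent 3 of the kernel is the least integer
  power that gives continuous second derivatives; Taylor's formula is applied to the kernel, so
  nothing is differentiated under an integral. In the lower bound the order of choices is decisive:
  \<ell> is fixed before \<open>y\<close>, so the same \<ell> serves y = x + h and y = x - h.
  Jensen's inequality is replaced by an elementary inequality with a free parameter, optimised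
  afterwards. Volumes are estimated without determinants: a slab from above, balls inside horizontal
  slices from below. The exponents fit because (n+2)q = n(n+1) + p(n+1+s). From above, n+1 points in
  balls of radius r give r^(n(n+1)) and the simplex volume gives r^(np-n); from below, n points give
  r^(n^2) and the volume r^(np). With the diameter, both lead to the weight |h|^(-n-(1+s)p).\<close>

lemma emeasure_lborel_translate:
  fixes A :: "'a::euclidean_space set"
  assumes [measurable]: "A \<in> sets borel"
  shows "emeasure lborel ((\<lambda>t. a + t) -` A) = emeasure lborel A"
proof -
  have "emeasure lborel A = emeasure (distr lborel borel ((+) a)) A"
    by (simp add: lborel_distr_plus)
  also have "\<dots> = emeasure lborel ((\<lambda>t. a + t) -` A)"
    by (subst emeasure_distr) auto
  finally show ?thesis by simp
qed

lemma sets_lborel_pair: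
  "sets (lborel \<Otimes>\<^sub>M lborel) = sets (borel :: ('a::euclidean_space \<times> 'b::euclidean_space) measure)"
  by (subst lborel_prod) simp

text \<open>Cavalieri: a shear translates each vertical fibre and so keeps its length. It serves to
  subtract an affine function from a graph before measuring.\<close>

lemma emeasure_lborel_shear:
  fixes A :: "('a::euclidean_space \<times> real) set" and g :: "'a \<Rightarrow> real"
  assumes [measurable]: "A \<in> sets borel" "g \<in> borel_measurable borel"
  shows "emeasure lborel {z. (fst z, g (fst z) + snd z) \<in> A} = emeasure lborel A"
proof -
  have A: "A \<in> sets (lborel \<Otimes>\<^sub>M (lborel :: real measure))"
    unfolding sets_lborel_pair by simp
  let ?B = "{z. (fst z, g (fst z) + snd z) \<in> A}"
  have "(\<lambda>z. (fst z, g (fst z) + snd z)) \<in> borel_measurable (borel :: ('a \<times> real) measure)"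
    unfolding borel_prod[symmetric] by measurable
  from measurable_sets[OF this assms(1)] have B0: "?B \<in> sets borel"
    by (simp add: vimage_def)
  hence B: "?B \<in> sets (lborel \<Otimes>\<^sub>M (lborel :: real measure))"
    unfolding sets_lborel_pair by simp
  have "emeasure lborel ?B = (\<integral>\<^sup>+ y. emeasure lborel (Pair y -` ?B) \<partial>lborel)"
    using lborel.emeasure_pair_measure_alt[OF B] by (simp add: lborel_prod)
  also have "\<dots> = (\<integral>\<^sup>+ y. emeasure lborel (Pair y -` A) \<partial>lborel)"
  proof (rule nn_integral_cong)
    fix y :: 'a
    have "Pair y -` ?B = (\<lambda>t. g y + t) -` (Pair y -` A)" by auto
    moreover have "Pair y -` A \<in> sets borel"
      using sets_Pair1[OF A, of y] by simp
    ultimately show "emeasure lborel (Pair y -` ?B) = emeasure lborel (Pair y -` A)"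
      by (simp add: emeasure_lborel_translate)
  qed
  also have "\<dots> = emeasure lborel A"
    using lborel.emeasure_pair_measure_alt[OF A] by (simp add: lborel_prod)
  finally show ?thesis .
qed

lemma sets_borel_convex_hull_finite:
  fixes A :: "'a::euclidean_space set"
  assumes "finite A"
  shows "convex hull A \<in> sets borel"
  using finite_imp_compact_convex_hull[OF assms] by (auto intro: borel_compact)

lemma emeasure_convex_hull_finite:
  fixes A :: "'a::euclidean_space set"
  assumes "finite A"
  shows "emeasure lborel (convex hull A) = ennreal (measure lebesgue (convex hull A))"
proof -
  have "emeasure lborel (convex hull A) \<noteq> \<infinity>"
    using emeasure_compact_finite[OF finite_imp_compact_convex_hull[OF assms]] by simp
  thus ?thesis
    using sets_borel_convex_hull_finite[OF assms] by (simp add: emeasure_eq_ennreal_measure)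
qed

text \<open>The slab of points over the ball within vertical distance \<open>M\<close> of the affine
  graph is convex and contains the vertices, hence the hull; each of its vertical fibres has length
  \<open>2 * M\<close>.\<close>

lemma measure_graph_hull_le:
  fixes f :: "'a::euclidean_space \<Rightarrow> real"
  assumes "finite A" "A \<subseteq> cball x0 r" "0 \<le> r" "0 \<le> M"
    and approx: "\<And>y. y \<in> A \<Longrightarrow> \<bar>f y - (a + c \<bullet> y)\<bar> \<le> M"
  shows "measure lebesgue (convex hull (graph_pt f ` A)) \<le> 2 * M * (unit_ball_vol DIM('a) * r ^ DIM('a))"
proof -
  define V where "V = {z::'a \<times> real. fst z \<in> cball x0 r \<and> \<bar>snd z - (a + c \<bullet> fst z)\<bar> \<le> M}"
  have V_eq: "V = fst -` cball x0 r \<inter> (\<lambda>z. snd z - c \<bullet> fst z) -` {a - M..a + M}"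
    unfolding V_def by auto
  have lin1: "linear (\<lambda>z::'a \<times> real. snd z - c \<bullet> fst z)"
    by (rule linearI) (auto simp: algebra_simps inner_add_right)
  have "convex V"
    unfolding V_eq
    by (intro convex_Int convex_linear_vimage lin1 linear_fst) auto
  moreover have "graph_pt f ` A \<subseteq> V"
    using assms by (auto simp: V_def graph_pt_def)
  ultimately have sub: "convex hull (graph_pt f ` A) \<subseteq> V"
    by (simp add: hull_minimal)
  have "closed V"
    unfolding V_eq by (intro closed_Int closed_vimage continuous_intros) auto
  hence V: "V \<in> sets (lborel \<Otimes>\<^sub>M (lborel :: real measure))"
    unfolding sets_lborel_pair by simp
  have "emeasure lborel V = (\<integral>\<^sup>+ y. emeasure lborel (Pair y -` V) \<partial>lborel)"
    using lborel.emeasure_pair_measure_alt[OF V] by (simp add: lborel_prod)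
  also have "\<dots> = (\<integral>\<^sup>+ y. ennreal (2 * M) * indicator (cball x0 r) y \<partial>lborel)"
  proof (rule nn_integral_cong)
    fix y :: 'a
    have "Pair y -` V = (if y \<in> cball x0 r then {a + c \<bullet> y - M..a + c \<bullet> y + M} else {})"
      by (auto simp: V_def)
    thus "emeasure lborel (Pair y -` V) = ennreal (2 * M) * indicator (cball x0 r) y"
      using \<open>0 \<le> M\<close> by (simp add: indicator_def)
  qed
  also have "\<dots> = ennreal (2 * M) * ennreal (unit_ball_vol DIM('a) * r ^ DIM('a))"
    using \<open>0 \<le> r\<close> by (subst nn_integral_cmult_indicator) (auto simp: emeasure_cball)
  also have "\<dots> = ennreal (2 * M * (unit_ball_vol DIM('a) * r ^ DIM('a)))"
    using assms by (simp add: ennreal_mult)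
  finally have "emeasure lborel (convex hull (graph_pt f ` A)) \<le> \<dots>"
    using emeasure_mono[OF sub, of lborel] \<open>closed V\<close> by simp
  thus ?thesis
    using assms by (simp add: emeasure_convex_hull_finite ennreal_le_iff)
qed

text \<open>Each of the n perturbations is at most 1/(2n), so \<open>T a\<close> differs from
  \<open>a\<close> by at most half of the norm of \<open>a\<close>. This takes the place of a
  determinant estimate: the frame is invertible, with inverse of norm at most 2, uniformly in the
  admissible vectors.\<close>

lemma near_identity_frame:
  fixes v :: "'a::euclidean_space \<Rightarrow> 'a"
  assumes v: "\<And>b. b \<in> Basis \<Longrightarrow> norm (v b - b) \<le> 1 / (2 * real DIM('a))"
    and T_def: "T = (\<lambda>a. \<Sum>b\<in>Basis. (a \<bullet> b) *\<^sub>R v b)"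
  shows "linear T" "bij T" "norm a \<le> 2 * norm (T a)"
proof -
  show lin: "linear T"
    unfolding T_def by (rule linearI) (auto simp: inner_add_left scaleR_add_left sum.distrib scaleR_sum_right)
  show *: "norm a \<le> 2 * norm (T a)" for a
  proof -
    have "T a - a = (\<Sum>b\<in>Basis. (a \<bullet> b) *\<^sub>R (v b - b))"
      unfolding T_def by (simp add: scaleR_diff_right sum_subtractf euclidean_representation)
    also have "norm \<dots> \<le> (\<Sum>b\<in>(Basis::'a set). norm a * (1 / (2 * real DIM('a))))"
      by (intro sum_norm_le, unfold norm_scaleR, intro mult_mono) (auto intro: v Basis_le_norm)
    also have "\<dots> = norm a / 2" by simp
    finally have "norm (T a - a) \<le> norm a / 2" .
    moreover have "norm a \<le> norm (T a) + norm (T a - a)"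
      using norm_triangle_ineq4[of "T a" "T a - a"] by simp
    ultimately show ?thesis by linarith
  qed
  have "inj T"
    using lin * by (auto simp: linear_injective_0 dest: le_trans) (metis * mult_zero_right norm_le_zero_iff norm_zero)
  thus "bij T"
    using lin by (simp add: bij_def linear_injective_imp_surjective)
qed

text \<open>The volume of a ball of radius r/(8n) without the factor r^n, times 1/2 because slices
  up to half of the height are used in \<open>measure_graph_hull_ge\<close>.\<close>

definition graph_simplex_const :: "nat \<Rightarrow> real" where
  "graph_simplex_const n = unit_ball_vol n * (1 / (8 * real n)) ^ n / 2"

text \<open>After subtraction of the affine interpolant at \<open>x\<close> and the
  \<open>z b\<close>, the simplex is a cone over a flat base at height 0 with apex at height \<eta>
  over \<open>y\<close>. Its slice at height \<open>t * \<eta>\<close> is a copy of the base scaled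
  by 1 - t, and for t \<le> 1/2 it still contains a ball of radius r/(8n), wherever \<open>y\<close>
  lies. The vector \<open>c\<close> is obtained before \<open>y\<close> is chosen.\<close>

lemma measure_graph_hull_ge:
  fixes f :: "'a::euclidean_space \<Rightarrow> real" and z :: "'a \<Rightarrow> 'a"
  assumes r: "0 < r" and z: "\<And>b. b \<in> Basis \<Longrightarrow> norm (z b - (x + r *\<^sub>R b)) \<le> r / (2 * real DIM('a))"
  obtains c where "\<And>y. graph_simplex_const DIM('a) * r ^ DIM('a) * \<bar>f y - f x - c \<bullet> (y - x)\<bar>
      \<le> measure lebesgue (convex hull (graph_pt f ` (insert x (insert y (z ` Basis)))))"
proof -
  define v where "v b = (1 / r) *\<^sub>R (z b - x)" for b
  define T where "T = (\<lambda>a. \<Sum>b\<in>Basis. (a \<bullet> b) *\<^sub>R v b)"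
  let ?n = "real DIM('a)"
  have zv: "z b - x = r *\<^sub>R v b" for b
    using r by (simp add: v_def)
  have "norm (v b - b) \<le> 1 / (2 * ?n)" if "b \<in> Basis" for b
  proof -
    have "v b - b = (1 / r) *\<^sub>R (z b - (x + r *\<^sub>R b))"
      using r by (simp add: v_def algebra_simps)
    hence "norm (v b - b) = norm (z b - (x + r *\<^sub>R b)) / r"
      using r by simp
    also have "\<dots> \<le> (r / (2 * ?n)) / r"
      using r z[OF that] by (intro divide_right_mono) auto
    finally show ?thesis using r by simp
  qed
  note T = near_identity_frame[of v, OF this T_def]
  define g where "g b = (f (z b) - f x) / r" for b
  \<comment> \<open>The equations \<open>c \<bullet> v b = g b\<close> say that the adjoint of
    \<open>T\<close> maps \<open>c\<close> to the vector with coordinates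
    \<open>g b\<close>.\<close>
  define c where "c = adjoint (inv T) (\<Sum>b\<in>Basis. g b *\<^sub>R b)"
  have linv: "linear (inv T)"
    using T(1,2) by (simp add: bij_is_inj bij_is_surj inj_linear_imp_inv_linear)
  have Tb: "T b = v b" if "b \<in> Basis" for b
    using that by (simp add: T_def inner_Basis if_distrib[of "\<lambda>t. t *\<^sub>R _"] cong: if_cong)
  have cv: "c \<bullet> v b = g b" if b: "b \<in> Basis" for b
  proof -
    have "c \<bullet> v b = (\<Sum>b\<in>Basis. g b *\<^sub>R b) \<bullet> inv T (v b)"
      unfolding c_def using adjoint_works[OF linv] by (simp add: inner_commute)
    also have "inv T (v b) = b"
      using Tb[OF b] T(2) by (metis bij_is_inj inv_f_f)
    finally show ?thesis using b by (simp add: inner_sum_left inner_Basis if_distrib cong: if_cong)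
  qed
  have cz: "c \<bullet> (z b - x) = f (z b) - f x" if "b \<in> Basis" for b
    using cv[OF that] r by (simp add: zv g_def)
  \<comment> \<open>All coordinates of \<open>w\<close> are 1/(2n), so those of a point at distance
    at most 1/(2n) lie in [0, 1/n] and sum to at most 1: \<open>w\<close> is the centre of a ball
    inside the standard simplex.\<close>
  define w :: 'a where "w = (\<Sum>b\<in>Basis. (1 / (2 * ?n)) *\<^sub>R b)"
  have wb: "w \<bullet> b = 1 / (2 * ?n)" if "b \<in> Basis" for b
    using that by (simp add: w_def)
  have std: "(\<forall>b\<in>Basis. 0 \<le> a \<bullet> b) \<and> (\<Sum>b\<in>Basis. a \<bullet> b) \<le> 1" if a: "norm (a - w) \<le> 1 / (2 * ?n)" for a
  proof -
    have *: "\<bar>a \<bullet> b - 1 / (2 * ?n)\<bar> \<le> 1 / (2 * ?n)" if "b \<in> Basis" for b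
      using Basis_le_norm[OF that, of "a - w"] a wb[OF that] by (simp add: inner_diff_left)
    have "(\<Sum>b\<in>Basis. a \<bullet> b) \<le> (\<Sum>b\<in>(Basis::'a set). 1 / ?n)"
      using * by (intro sum_mono) (fastforce simp: abs_le_iff)
    moreover have "0 \<le> a \<bullet> b" if "b \<in> Basis" for b
      using *[OF that] by linarith
    ultimately show ?thesis by simp
  qed
  show ?thesis
  proof (rule that[of c])
    fix y :: 'a
    define \<eta> where "\<eta> = f y - f x - c \<bullet> (y - x)"
    define S where "S = convex hull (graph_pt f ` (insert x (insert y (z ` Basis))))"
    have fin: "finite (graph_pt f ` (insert x (insert y (z ` Basis))))" by simp
    have S: "S \<in> sets borel"
      unfolding S_def by (rule sets_borel_convex_hull_finite[OF fin])
    define S' where "S' = {q. (fst q, (f x + c \<bullet> (fst q - x)) + snd q) \<in> S}"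
    \<comment> \<open>Starting from r/(8n), one factor 2 is lost to \<open>1 - t \<ge> 1 / 2\<close>
      and another to the inverse of \<open>T\<close>; after division by r this leaves the radius
      1/(2n) around \<open>w\<close>.\<close>
    have mem: "(p, t * \<eta>) \<in> S'"
      if t: "0 \<le> t" "t \<le> 1 / 2" and p: "dist (x + t *\<^sub>R (y - x) + ((1 - t) * r) *\<^sub>R T w) p < r / (8 * ?n)" for p t
    proof -
      define u where "u = (1 / ((1 - t) * r)) *\<^sub>R (p - x - t *\<^sub>R (y - x))"
      have tr: "0 < (1 - t) * r" using t r by simp
      define a where "a = inv T u"
      have Ta: "T a = u" unfolding a_def using T(2) by (simp add: bij_is_surj surj_f_inv_f)
      have pu: "p = x + t *\<^sub>R (y - x) + ((1 - t) * r) *\<^sub>R u"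
        using t r by (simp add: u_def)
      have "dist (x + t *\<^sub>R (y - x) + ((1 - t) * r) *\<^sub>R T w) p = ((1 - t) * r) * norm (u - T w)"
      proof -
        have "p - (x + t *\<^sub>R (y - x) + ((1 - t) * r) *\<^sub>R T w) = ((1 - t) * r) *\<^sub>R (u - T w)"
          by (subst pu) (simp add: algebra_simps)
        thus ?thesis using tr by (simp add: dist_commute dist_norm)
      qed
      hence "(1 - t) * r * norm (u - T w) < r / (8 * ?n)" using p by simp
      moreover have "r / 2 * norm (u - T w) \<le> (1 - t) * r * norm (u - T w)"
        using t r by (intro mult_right_mono) auto
      ultimately have "r / 2 * norm (u - T w) < r / (8 * ?n)" by linarith
      hence "norm (u - T w) < 1 / (4 * ?n)"
        using r by (simp add: field_simps)
      moreover have "norm (a - w) \<le> 2 * norm (T (a - w))" by (rule T(3))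
      moreover have "T (a - w) = u - T w" using T(1) Ta by (simp add: linear_diff)
      ultimately have "norm (a - w) \<le> 1 / (2 * ?n)" by simp
      from std[OF this] have a0: "\<And>b. b \<in> Basis \<Longrightarrow> 0 \<le> a \<bullet> b" and a1: "(\<Sum>b\<in>Basis. a \<bullet> b) \<le> 1" by auto
      define h where "h = graph_pt f x + (\<Sum>b\<in>Basis. (a \<bullet> b) *\<^sub>R (graph_pt f (z b) - graph_pt f x))"
      have "convex S" by (simp add: S_def)
      have hull: "graph_pt f x \<in> S" "graph_pt f y \<in> S" "\<And>b. b \<in> Basis \<Longrightarrow> graph_pt f (z b) \<in> S"
        unfolding S_def by (auto intro!: hull_inc)
      have hS: "h \<in> S"
      proof -
        \<comment> \<open>\<open>None\<close> carries the weight of \<open>x\<close>. Weights sit on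
          indices rather than on points, so coincidences among the points do no harm.\<close>
        let ?I = "insert None (Some ` (Basis::'a set))"
        let ?u = "\<lambda>i. case i of None \<Rightarrow> 1 - (\<Sum>b\<in>Basis. a \<bullet> b) | Some b \<Rightarrow> a \<bullet> b"
        let ?q = "\<lambda>i. case i of None \<Rightarrow> graph_pt f x | Some b \<Rightarrow> graph_pt f (z b)"
        have "(\<Sum>i\<in>?I. ?u i *\<^sub>R ?q i) \<in> S"
          using a0 a1 hull by (intro convex_sum[OF _ \<open>convex S\<close>]) (auto simp: sum.reindex)
        also have "(\<Sum>i\<in>?I. ?u i *\<^sub>R ?q i) = h"
          by (simp add: sum.reindex h_def algebra_simps sum_subtractf scaleR_sum_left sum.distrib)
        finally show ?thesis .
      qed
      have "(1 - t) *\<^sub>R h + t *\<^sub>R graph_pt f y \<in> S"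
        using convexD_alt[OF \<open>convex S\<close> hS hull(2), of t] t by simp
      also have "(1 - t) *\<^sub>R h + t *\<^sub>R graph_pt f y = (p, (f x + c \<bullet> (p - x)) + t * \<eta>)"
      proof (rule prod_eqI)
        have u: "u = (\<Sum>b\<in>Basis. (a \<bullet> b) *\<^sub>R v b)" using Ta by (simp add: T_def)
        have ru: "r *\<^sub>R u = (\<Sum>b\<in>Basis. (a \<bullet> b) *\<^sub>R (z b - x))"
          unfolding u zv by (simp add: scaleR_sum_right algebra_simps)
        have cu: "r * (c \<bullet> u) = (\<Sum>b\<in>Basis. (a \<bullet> b) * (f (z b) - f x))"
        proof -
          have "r * (c \<bullet> u) = c \<bullet> (r *\<^sub>R u)" by simp
          also have "\<dots> = (\<Sum>b\<in>Basis. (a \<bullet> b) * (f (z b) - f x))"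
            unfolding ru inner_sum_right by (intro sum.cong refl) (simp add: cz)
          finally show ?thesis .
        qed
        have "fst ((1 - t) *\<^sub>R h + t *\<^sub>R graph_pt f y) = (1 - t) *\<^sub>R (x + r *\<^sub>R u) + t *\<^sub>R y"
          unfolding ru by (simp add: h_def graph_pt_def fst_sum)
        also have "\<dots> = p" by (subst pu) (simp add: algebra_simps)
        finally show "fst ((1 - t) *\<^sub>R h + t *\<^sub>R graph_pt f y) = fst (p, (f x + c \<bullet> (p - x)) + t * \<eta>)" by simp
        have "snd ((1 - t) *\<^sub>R h + t *\<^sub>R graph_pt f y) = (1 - t) * (f x + r * (c \<bullet> u)) + t * f y"
          unfolding cu by (simp add: h_def graph_pt_def snd_sum)
        also have "\<dots> = (f x + c \<bullet> (p - x)) + t * \<eta>"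
          by (subst pu) (simp add: \<eta>_def algebra_simps inner_add_right)
        finally show "snd ((1 - t) *\<^sub>R h + t *\<^sub>R graph_pt f y) = snd (p, (f x + c \<bullet> (p - x)) + t * \<eta>)" by simp
      qed
      finally show ?thesis by (simp add: S'_def)
    qed
    have eqS: "emeasure lborel S' = emeasure lborel S"
      unfolding S'_def by (rule emeasure_lborel_shear[OF S]) measurable
    have S'b: "S' \<in> sets borel"
    proof -
      have "(\<lambda>q. (fst q, (f x + c \<bullet> (fst q - x)) + snd q)) \<in> borel_measurable (borel :: ('a \<times> real) measure)"
        unfolding borel_prod[symmetric] by measurable
      from measurable_sets[OF this S] show ?thesis by (simp add: S'_def vimage_def)
    qed
    hence S'p: "S' \<in> sets (lborel \<Otimes>\<^sub>M (lborel :: real measure))" unfolding sets_lborel_pair by simp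
    define J where "J = (if 0 \<le> \<eta> then {0..\<eta> / 2} else {\<eta> / 2..0})"
    have J: "J \<in> sets borel" "emeasure lborel J = ennreal (\<bar>\<eta>\<bar> / 2)"
      by (auto simp: J_def)
    \<comment> \<open>For \<eta> = 0 the interval is a single point and the witness is 0 / 0 =
      0.\<close>
    have Jt: "\<exists>t. 0 \<le> t \<and> t \<le> 1 / 2 \<and> \<tau> = t * \<eta>" if "\<tau> \<in> J" for \<tau>
      using that
      by (intro exI[of _ "\<tau> / \<eta>"]) (auto simp: J_def divide_simps split: if_splits)
    let ?B = "unit_ball_vol ?n * (r / (8 * ?n)) ^ DIM('a)"
    have "ennreal (?B * (\<bar>\<eta>\<bar> / 2)) = ennreal ?B * emeasure lborel J"
      unfolding J(2) using r by (intro ennreal_mult) auto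
    also have "\<dots> = (\<integral>\<^sup>+ \<tau>. ennreal ?B * indicator J \<tau> \<partial>lborel)"
      using J by (subst nn_integral_cmult) auto
    also have "\<dots> \<le> (\<integral>\<^sup>+ \<tau>. emeasure lborel ((\<lambda>p. (p, \<tau>)) -` S') \<partial>lborel)"
    proof (rule nn_integral_mono)
      fix \<tau> :: real
      show "ennreal ?B * indicator J \<tau> \<le> emeasure lborel ((\<lambda>p. (p, \<tau>)) -` S')"
      proof (cases "\<tau> \<in> J")
        case True
        then obtain t where t: "0 \<le> t" "t \<le> 1 / 2" "\<tau> = t * \<eta>" using Jt by blast
        let ?b = "ball (x + t *\<^sub>R (y - x) + ((1 - t) * r) *\<^sub>R T w) (r / (8 * ?n))"
        have "ennreal ?B = emeasure lborel ?b"
          using r by (simp add: emeasure_ball)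
        also have "\<dots> \<le> emeasure lborel ((\<lambda>p. (p, \<tau>)) -` S')"
          using mem[OF t(1,2)] t(3) sets_Pair2[OF S'p, of \<tau>] by (intro emeasure_mono) auto
        finally show ?thesis using True by simp
      qed simp
    qed
    also have "\<dots> = emeasure lborel S'"
      using lborel_pair.emeasure_pair_measure_alt2[OF S'p] by (simp add: lborel_prod)
    also have "\<dots> = ennreal (measure lebesgue S)"
      unfolding eqS S_def by (rule emeasure_convex_hull_finite[OF fin])
    finally have "?B * (\<bar>\<eta>\<bar> / 2) \<le> measure lebesgue S"
      by (simp add: ennreal_le_iff)
    moreover have "(r / (8 * ?n)) ^ DIM('a) = r ^ DIM('a) * (1 / (8 * ?n)) ^ DIM('a)"
      by (simp add: power_divide)
    ultimately show "graph_simplex_const DIM('a) * r ^ DIM('a) * \<bar>f y - f x - c \<bullet> (y - x)\<bar>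
        \<le> measure lebesgue (convex hull (graph_pt f ` (insert x (insert y (z ` Basis)))))"
      by (simp add: graph_simplex_const_def \<eta>_def S_def mult_ac)
  qed
qed

subsection \<open>Affine approximation by mollification\<close>

lemma lborel_distr_uminus_euclidean:
  "distr lborel borel uminus = (lborel :: 'a::euclidean_space measure)"
  using lborel_affine[of "-1" "0::'a"] by (simp add: density_1)

lemma cball_borel [measurable]: "cball (a :: 'a::euclidean_space) R \<in> sets borel"
  by simp

lemma ball_borel [measurable]: "ball (a :: 'a::euclidean_space) R \<in> sets borel"
  by simp

lemma nn_integral_lborel_translate:
  fixes g :: "'a::euclidean_space \<Rightarrow> ennreal"
  assumes [measurable]: "g \<in> borel_measurable borel"
  shows "(\<integral>\<^sup>+w. g (a + w) \<partial>lborel) = (\<integral>\<^sup>+w. g w \<partial>lborel)"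
proof -
  have "(\<integral>\<^sup>+w. g w \<partial>lborel) = (\<integral>\<^sup>+w. g w \<partial>distr lborel borel ((+) a))"
    by (simp add: lborel_distr_plus)
  also have "\<dots> = (\<integral>\<^sup>+w. g (a + w) \<partial>lborel)"
    by (subst nn_integral_distr) auto
  finally show ?thesis by simp
qed

lemma nn_integral_lborel_uminus:
  fixes g :: "'a::euclidean_space \<Rightarrow> ennreal"
  assumes [measurable]: "g \<in> borel_measurable borel"
  shows "(\<integral>\<^sup>+w. g (- w) \<partial>lborel) = (\<integral>\<^sup>+w. g w \<partial>lborel)"
proof -
  have "(\<integral>\<^sup>+w. g w \<partial>lborel) = (\<integral>\<^sup>+w. g w \<partial>distr lborel borel uminus)"
    by (simp add: lborel_distr_uminus_euclidean)
  also have "\<dots> = (\<integral>\<^sup>+w. g (- w) \<partial>lborel)"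
    by (subst nn_integral_distr) auto
  finally show ?thesis by simp
qed

lemma integral_lborel_translate:
  fixes g :: "'a::euclidean_space \<Rightarrow> real"
  assumes [measurable]: "g \<in> borel_measurable borel"
  shows "integrable lborel (\<lambda>w. g (a + w)) \<longleftrightarrow> integrable lborel g"
    and "(\<integral>w. g (a + w) \<partial>lborel) = (\<integral>w. g w \<partial>lborel)"
proof -
  have "integrable lborel g \<longleftrightarrow> integrable (distr lborel borel ((+) a)) g"
    by (simp add: lborel_distr_plus)
  also have "\<dots> \<longleftrightarrow> integrable lborel (\<lambda>w. g (a + w))"
    by (subst integrable_distr_eq) auto
  finally show "integrable lborel (\<lambda>w. g (a + w)) \<longleftrightarrow> integrable lborel g" by simp
  have "(\<integral>w. g w \<partial>lborel) = (\<integral>w. g w \<partial>distr lborel borel ((+) a))"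
    by (simp add: lborel_distr_plus)
  also have "\<dots> = (\<integral>w. g (a + w) \<partial>lborel)"
    by (subst integral_distr) auto
  finally show "(\<integral>w. g (a + w) \<partial>lborel) = (\<integral>w. g w \<partial>lborel)" by simp
qed

lemma integral_lborel_uminus:
  fixes g :: "'a::euclidean_space \<Rightarrow> real"
  assumes [measurable]: "g \<in> borel_measurable borel"
  shows "(\<integral>w. g (- w) \<partial>lborel) = (\<integral>w. g w \<partial>lborel)"
proof -
  have "(\<integral>w. g w \<partial>lborel) = (\<integral>w. g w \<partial>distr lborel borel uminus)"
    by (simp add: lborel_distr_uminus_euclidean)
  also have "\<dots> = (\<integral>w. g (- w) \<partial>lborel)"
    by (subst integral_distr) auto
  finally show ?thesis by simp
qed

section \<open>A compactly supported, twice differentiable kernel\<close>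

lemma has_real_derivative_pos_part_power:
  fixes u :: real
  shows "((\<lambda>u. max 0 u ^ Suc (Suc k)) has_real_derivative real (Suc (Suc k)) * max 0 u ^ Suc k) (at u)"
proof (cases u "0::real" rule: linorder_cases)
  case less
  have "((\<lambda>u::real. 0) has_real_derivative 0) (at u)" by simp
  hence "((\<lambda>u. max 0 u ^ Suc (Suc k)) has_real_derivative 0) (at u)"
    by (rule has_field_derivative_transform_within_open[of _ _ _ "{..<0}"]) (use less in auto)
  thus ?thesis using less by simp
next
  case greater
  have "((\<lambda>u::real. u ^ Suc (Suc k)) has_real_derivative real (Suc (Suc k)) * u ^ Suc k) (at u)"
    by (rule derivative_eq_intros refl)+ simp
  hence "((\<lambda>u. max 0 u ^ Suc (Suc k)) has_real_derivative real (Suc (Suc k)) * u ^ Suc k) (at u)"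
    by (rule has_field_derivative_transform_within_open[of _ _ _ "{0<..}"]) (use greater in auto)
  thus ?thesis using greater by simp
next
  case equal
  \<comment> \<open>At the corner the difference quotient is at most |h|^(k+1), which tends to 0
    because the exponent of the positive part is at least 2.\<close>
  have "((\<lambda>h::real. max 0 h ^ Suc (Suc k) / h) \<longlongrightarrow> 0) (at 0)"
  proof (rule Lim_null_comparison)
    show "\<forall>\<^sub>F h::real in at 0. norm (max 0 h ^ Suc (Suc k) / h) \<le> \<bar>h\<bar> ^ Suc k"
    proof (rule always_eventually, rule allI)
      fix h :: real
      show "norm (max 0 h ^ Suc (Suc k) / h) \<le> \<bar>h\<bar> ^ Suc k"
        by (cases "h \<le> 0") (simp_all add: max_def mult_nonpos_nonneg)
    qed
    show "((\<lambda>h::real. \<bar>h\<bar> ^ Suc k) \<longlongrightarrow> 0) (at 0)"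
      by (rule tendsto_eq_intros refl | simp)+
  qed
  thus ?thesis using equal by (simp add: DERIV_def)
qed

definition bump :: "real \<Rightarrow> 'a::euclidean_space \<Rightarrow> real" where
  "bump r w = max 0 (1 - (w \<bullet> w) / r\<^sup>2) ^ 3"

text \<open>Minus the derivative of \<open>bump r\<close> at \<open>w\<close> in direction
  \<open>y\<close>. The sign fits the translates \<open>w - t *\<^sub>R y\<close>, along which it
  becomes the derivative in \<open>t\<close>.\<close>

definition bump_slope :: "real \<Rightarrow> 'a::euclidean_space \<Rightarrow> 'a \<Rightarrow> real" where
  "bump_slope r y w = 6 * max 0 (1 - (w \<bullet> w) / r\<^sup>2) ^ 2 * (w \<bullet> y) / r\<^sup>2"

text \<open>The second derivative of \<open>bump r\<close> at \<open>w\<close>, as a quadratic form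
  evaluated at \<open>y\<close>.\<close>

definition bump_hess :: "real \<Rightarrow> 'a::euclidean_space \<Rightarrow> 'a \<Rightarrow> real" where
  "bump_hess r y w = 24 * max 0 (1 - (w \<bullet> w) / r\<^sup>2) * ((w \<bullet> y) / r\<^sup>2)\<^sup>2
     - 6 * max 0 (1 - (w \<bullet> w) / r\<^sup>2) ^ 2 * (y \<bullet> y) / r\<^sup>2"

lemma bump_measurable [measurable]:
  "bump r \<in> borel_measurable borel"
  "bump_slope r y \<in> borel_measurable borel"
  "bump_hess r y \<in> borel_measurable borel"
  unfolding bump_def[abs_def] bump_slope_def[abs_def] bump_hess_def[abs_def] by measurable

lemma bump_even:
  "bump r (- w) = bump r w" "bump_slope r y (- w) = - bump_slope r y w"
  "bump_hess r y (- w) = bump_hess r y w"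
  by (simp_all add: bump_def bump_slope_def bump_hess_def)

lemma pos_part_outside:
  fixes w :: "'a::euclidean_space"
  assumes "0 < r" "r \<le> norm w"
  shows "max 0 (1 - (w \<bullet> w) / r\<^sup>2) = 0"
proof -
  have "r\<^sup>2 \<le> w \<bullet> w"
    using assms by (simp add: dot_square_norm)
  thus ?thesis using assms by (simp add: field_simps)
qed

lemma bump_outside:
  assumes "0 < r" "r \<le> norm w"
  shows "bump r w = 0" "bump_slope r y w = 0" "bump_hess r y w = 0"
  unfolding bump_def bump_slope_def bump_hess_def by (simp_all only: pos_part_outside[OF assms]) simp_all

lemma pos_part_bounds:
  fixes w :: "'a::euclidean_space"
  shows "0 \<le> max 0 (1 - (w \<bullet> w) / r\<^sup>2)" "max 0 (1 - (w \<bullet> w) / r\<^sup>2) \<le> 1"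
  by auto

lemma bump_bounds: "0 \<le> bump r w" "bump r w \<le> 1"
  unfolding bump_def using pos_part_bounds by (auto intro: power_le_one)

lemma abs_inner_over_sq_le:
  fixes w y :: "'a::euclidean_space"
  assumes "0 < r" "norm y \<le> r" "norm w \<le> r"
  shows "\<bar>(w \<bullet> y) / r\<^sup>2\<bar> \<le> 1"
proof -
  have "\<bar>w \<bullet> y\<bar> \<le> norm w * norm y" by (rule Cauchy_Schwarz_ineq2)
  also have "\<dots> \<le> r * r" using assms by (intro mult_mono) auto
  finally show ?thesis using assms by (simp add: field_simps power2_eq_square)
qed

lemma bump_slope_bound:
  fixes w y :: "'a::euclidean_space"
  assumes "0 < r" "norm y \<le> r"
  shows "\<bar>bump_slope r y w\<bar> \<le> 6"
proof (cases "r \<le> norm w")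
  case True thus ?thesis by (simp add: bump_outside[OF assms(1)])
next
  case False
  have "\<bar>bump_slope r y w\<bar> = 6 * max 0 (1 - (w \<bullet> w) / r\<^sup>2) ^ 2 * \<bar>(w \<bullet> y) / r\<^sup>2\<bar>"
    by (simp add: bump_slope_def abs_mult)
  also have "\<dots> \<le> 6 * 1 * 1"
    using False assms pos_part_bounds abs_inner_over_sq_le[of r y w]
    by (intro mult_mono) (auto intro: power_le_one)
  finally show ?thesis by simp
qed

text \<open>The two terms are bounded separately, by 24 and 6. As \<open>y\<close> is measured
  against \<open>r\<close>, the bound does not depend on the scale.\<close>

lemma bump_hess_bound:
  fixes w y :: "'a::euclidean_space"
  assumes "0 < r" "norm y \<le> r"
  shows "\<bar>bump_hess r y w\<bar> \<le> 30"
proof (cases "r \<le> norm w")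
  case True thus ?thesis by (simp add: bump_outside[OF assms(1)])
next
  case False
  let ?m = "max 0 (1 - (w \<bullet> w) / r\<^sup>2)"
  have "((w \<bullet> y) / r\<^sup>2)\<^sup>2 \<le> 1"
    using abs_inner_over_sq_le[of r y w] assms False by (simp add: abs_square_le_1)
  hence "24 * ?m * ((w \<bullet> y) / r\<^sup>2)\<^sup>2 \<le> 24 * 1 * 1"
    using pos_part_bounds by (intro mult_mono) auto
  moreover have "\<bar>(y \<bullet> y) / r\<^sup>2\<bar> \<le> 1"
    using abs_inner_over_sq_le[of r y y] assms by simp
  hence "6 * ?m ^ 2 * ((y \<bullet> y) / r\<^sup>2) \<le> 6 * 1 * 1"
    using pos_part_bounds by (intro mult_mono) (auto intro: power_le_one)
  moreover have "0 \<le> 24 * ?m * ((w \<bullet> y) / r\<^sup>2)\<^sup>2" "0 \<le> 6 * ?m ^ 2 * ((y \<bullet> y) / r\<^sup>2)"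
    by auto
  ultimately show ?thesis
    unfolding bump_hess_def by (simp only: times_divide_eq_right[symmetric])
qed

lemma bump_deriv:
  fixes w y :: "'a::euclidean_space"
  shows "((\<lambda>t. bump r (w - t *\<^sub>R y)) has_real_derivative bump_slope r y (w - t *\<^sub>R y)) (at t)"
    and "((\<lambda>t. bump_slope r y (w - t *\<^sub>R y)) has_real_derivative bump_hess r y (w - t *\<^sub>R y)) (at t)"
proof -
  define u where "u t = 1 - ((w - t *\<^sub>R y) \<bullet> (w - t *\<^sub>R y)) / r\<^sup>2" for t
  define v where "v t = ((w - t *\<^sub>R y) \<bullet> y) / r\<^sup>2" for t
  have u_eq: "u = (\<lambda>t. 1 - (w \<bullet> w - 2 * t * (w \<bullet> y) + t\<^sup>2 * (y \<bullet> y)) / r\<^sup>2)"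
    by (auto simp: u_def inner_diff_left inner_diff_right inner_commute algebra_simps power2_eq_square)
  have v_eq: "v = (\<lambda>t. (w \<bullet> y - t * (y \<bullet> y)) / r\<^sup>2)"
    by (auto simp: v_def inner_diff_left)
  have du: "(u has_real_derivative 2 * v t) (at t)" for t
    unfolding u_eq v_eq divide_inverse
    by (rule derivative_eq_intros refl)+ (simp add: algebra_simps)
  have dv: "(v has_real_derivative - (y \<bullet> y) / r\<^sup>2) (at t)" for t
    unfolding v_eq divide_inverse by (rule derivative_eq_intros refl)+ (simp add: algebra_simps)
  have b: "bump r (w - t *\<^sub>R y) = max 0 (u t) ^ 3" for t
    by (simp add: bump_def u_def)
  have s: "bump_slope r y (w - t *\<^sub>R y) = 6 * max 0 (u t) ^ 2 * v t" for t
    by (simp add: bump_slope_def u_def v_def)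
  have h: "bump_hess r y (w - t *\<^sub>R y) = 24 * max 0 (u t) * (v t)\<^sup>2 - 6 * max 0 (u t) ^ 2 * ((y \<bullet> y) / r\<^sup>2)" for t
    by (simp add: bump_hess_def u_def v_def)
  have d3: "((\<lambda>t. max 0 (u t) ^ 3) has_real_derivative (3 * max 0 (u t) ^ 2) * (2 * v t)) (at t)"
    using DERIV_chain2[OF has_real_derivative_pos_part_power[of 1] du] by (simp add: eval_nat_numeral)
  have d2: "((\<lambda>t. max 0 (u t) ^ 2) has_real_derivative (2 * max 0 (u t)) * (2 * v t)) (at t)"
    using DERIV_chain2[OF has_real_derivative_pos_part_power[of 0] du] by (simp add: eval_nat_numeral)
  show "((\<lambda>t. bump r (w - t *\<^sub>R y)) has_real_derivative bump_slope r y (w - t *\<^sub>R y)) (at t)"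
    unfolding b s using d3 by (simp add: mult_ac)
  show "((\<lambda>t. bump_slope r y (w - t *\<^sub>R y)) has_real_derivative bump_hess r y (w - t *\<^sub>R y)) (at t)"
    unfolding s h
    by (rule DERIV_cong[OF DERIV_mult[OF DERIV_cmult[OF d2, of 6] dv]])
      (simp add: algebra_simps power2_eq_square)
qed

text \<open>Taylor's formula with integral remainder along the segment from \<open>w\<close> to
  \<open>w - y\<close>. Stated for the kernel, it passes to the mollification by integration against
  \<open>f\<close>, which has no derivatives itself.\<close>

lemma bump_taylor:
  fixes w y :: "'a::euclidean_space"
  shows "(\<integral>t. (1 - t) * bump_hess r y (w - t *\<^sub>R y) * indicator {0..1} t \<partial>lborel)
    = bump r (w - y) - bump r w - bump_slope r y w"
proof -
  \<comment> \<open>The derivative of the factor 1 - t cancels that of \<open>bump\<close>, so only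
    the second-order term remains.\<close>
  let ?F = "\<lambda>t. (1 - t) * bump_slope r y (w - t *\<^sub>R y) + bump r (w - t *\<^sub>R y)"
  have "(\<integral>t. ((1 - t) * bump_hess r y (w - t *\<^sub>R y)) * indicator {0..1} t \<partial>lborel) = ?F 1 - ?F 0"
  proof (rule integral_FTC_Icc_real)
    fix t :: real
    have "((\<lambda>t. 1 - t :: real) has_real_derivative - 1) (at t)"
      by (auto intro!: derivative_eq_intros)
    from DERIV_add[OF DERIV_mult[OF this bump_deriv(2)] bump_deriv(1)]
    show "(?F has_real_derivative (1 - t) * bump_hess r y (w - t *\<^sub>R y)) (at t)"
      by (rule DERIV_cong) (simp add: algebra_simps)
    show "isCont (\<lambda>t. (1 - t) * bump_hess r y (w - t *\<^sub>R y)) t"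
      unfolding bump_hess_def by (cases "r = 0") (auto intro!: continuous_intros)
  qed simp
  thus ?thesis by simp
qed

section \<open>Integration of a locally integrable function against even kernels\<close>

definition loc_integrable :: "('a::euclidean_space \<Rightarrow> real) \<Rightarrow> bool" where
  "loc_integrable f \<longleftrightarrow> (\<forall>R. integrable lborel (\<lambda>w. indicator (cball 0 R) w * f w))"

lemma loc_integrable_const: "loc_integrable (\<lambda>_. c)"
  unfolding loc_integrable_def
  by (auto intro!: integrable_mult_left integrable_real_indicator emeasure_lborel_cball_finite)

lemma integrable_kernel_mult:
  fixes f k :: "'a::euclidean_space \<Rightarrow> real"
  assumes f: "loc_integrable f" and [measurable]: "f \<in> borel_measurable borel" "k \<in> borel_measurable borel"
    and K: "\<And>w. \<bar>k w\<bar> \<le> K" and supp: "\<And>w. R \<le> norm w \<Longrightarrow> k w = 0"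
  shows "integrable lborel (\<lambda>w. k w * f (a + w))"
proof (rule Bochner_Integration.integrable_bound)
  have "integrable lborel (\<lambda>w. indicator (cball 0 (R + norm a)) w * f w)"
    using f by (auto simp: loc_integrable_def)
  hence "integrable lborel (\<lambda>w. indicator (cball 0 (R + norm a)) (a + w) * f (a + w))"
    by (subst integral_lborel_translate(1)) auto
  thus "integrable lborel (\<lambda>w. K * (indicator (cball 0 (R + norm a)) (a + w) * f (a + w)))"
    by (rule integrable_mult_right)
  show "AE w in lborel. norm (k w * f (a + w)) \<le> norm (K * (indicator (cball 0 (R + norm a)) (a + w) * f (a + w)))"
  proof (rule AE_I2)
    fix w
    show "norm (k w * f (a + w)) \<le> norm (K * (indicator (cball 0 (R + norm a)) (a + w) * f (a + w)))"
    proof (cases "R \<le> norm w")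
      case False
      hence "a + w \<in> cball 0 (R + norm a)"
        using norm_triangle_ineq[of a w] by auto
      thus ?thesis using K[of w] by (auto simp: abs_mult intro!: mult_right_mono)
    qed (simp add: supp)
  qed
qed measurable

definition second_diff :: "('a::euclidean_space \<Rightarrow> real) \<Rightarrow> 'a \<Rightarrow> 'a \<Rightarrow> real" where
  "second_diff f w x = f (x + w) - 2 * f x + f (x - w)"

lemma second_diff_measurable [measurable]:
  assumes [measurable]: "f \<in> borel_measurable borel"
    and [measurable]: "g \<in> borel_measurable M" "h \<in> borel_measurable M"
  shows "(\<lambda>z. second_diff f (g z) (h z)) \<in> borel_measurable M"
  unfolding second_diff_def by measurable

text \<open>Averaging the integral with its image under \<open>w \<mapsto> - w\<close> replaces f(a
  + w) by f(a) plus half of the second difference. It is used for the kernel, and for its second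
  derivative, where the term with f(a) disappears.\<close>

lemma integral_even_kernel:
  fixes f k :: "'a::euclidean_space \<Rightarrow> real"
  assumes f: "loc_integrable f" and [measurable]: "f \<in> borel_measurable borel" "k \<in> borel_measurable borel"
    and K: "\<And>w. \<bar>k w\<bar> \<le> K" and supp: "\<And>w. R \<le> norm w \<Longrightarrow> k w = 0"
    and even: "\<And>w. k (- w) = k w"
  shows "integrable lborel (\<lambda>w. k w * second_diff f w a)"
    and "(\<integral>w. k w * f (a + w) \<partial>lborel) = (\<integral>w. k w \<partial>lborel) * f a + (\<integral>w. k w * second_diff f w a \<partial>lborel) / 2"
proof -
  note int = integrable_kernel_mult[OF _ _ assms(3) K supp]
  have i1: "integrable lborel (\<lambda>w. k w * f (a + w))" by (rule int[OF f]) auto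
  have "integrable lborel (\<lambda>w. k w * (\<lambda>v. f (- v)) (- a + w))"
  proof (rule int)
    have "integrable lborel (\<lambda>w. indicator (cball 0 R) w * f (- w))" for R
    proof -
      have "integrable (distr lborel borel uminus) (\<lambda>w. indicator (cball 0 R) w * f w)"
        using f by (simp add: loc_integrable_def lborel_distr_uminus_euclidean)
      hence "integrable lborel (\<lambda>w. indicator (cball 0 R) (- w) * f (- w))"
        by (subst (asm) integrable_distr_eq) (auto intro!: borel_measurable_times borel_measurable_indicator)
      moreover have "indicator (cball 0 R) (- w) = (indicator (cball 0 R) w :: real)" for w :: 'a
        by (auto simp: indicator_def)
      ultimately show ?thesis by simp
    qed
    thus "loc_integrable (\<lambda>v. f (- v))" by (simp add: loc_integrable_def)
  qed measurable
  hence i2: "integrable lborel (\<lambda>w. k w * f (a - w))" by simp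
  have "integrable lborel (\<lambda>w. k w * (\<lambda>_. 1) (0 + w))"
    by (rule int[OF loc_integrable_const]) auto
  hence i3: "integrable lborel k" by simp
  have eq: "k w * second_diff f w a = k w * f (a + w) + k w * f (a - w) - 2 * f a * k w" for w
    by (simp add: second_diff_def algebra_simps)
  show "integrable lborel (\<lambda>w. k w * second_diff f w a)"
    unfolding eq using i1 i2 i3 by auto
  have "(\<integral>w. k w * f (a - w) \<partial>lborel) = (\<integral>w. k w * f (a + w) \<partial>lborel)"
    using integral_lborel_uminus[of "\<lambda>w. k w * f (a + w)"] by (simp add: even)
  thus "(\<integral>w. k w * f (a + w) \<partial>lborel) = (\<integral>w. k w \<partial>lborel) * f a + (\<integral>w. k w * second_diff f w a \<partial>lborel) / 2"
    unfolding eq using i1 i2 i3 by (simp add: field_simps)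
qed

text \<open>The kernel identity is multiplied by f(x + w) and integrated in \<open>w\<close>;
  translations move the shifts from the kernel to \<open>f\<close>. The term with
  \<open>bump_slope\<close> is linear in \<open>y\<close> and will supply the gradient of the affine
  function.\<close>

lemma bump_taylor_integrated:
  fixes f :: "'a::euclidean_space \<Rightarrow> real"
  assumes f: "loc_integrable f" and fm [measurable]: "f \<in> borel_measurable borel"
    and r: "0 < r" and y: "norm y \<le> r"
  shows "integrable lborel (\<lambda>t. (1 - t) * indicator {0..1} t * (\<integral>w. bump_hess r y w * f (x + t *\<^sub>R y + w) \<partial>lborel))"
    and "(\<integral>w. bump r w * f (x + y + w) \<partial>lborel) = (\<integral>w. bump r w * f (x + w) \<partial>lborel)
       + (\<integral>w. bump_slope r y w * f (x + w) \<partial>lborel)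
       + (\<integral>t. (1 - t) * indicator {0..1} t * (\<integral>w. bump_hess r y w * f (x + t *\<^sub>R y + w) \<partial>lborel) \<partial>lborel)"
proof -
  define G where "G w t = (1 - t) * indicator {0..1} t * (bump_hess r y (w - t *\<^sub>R y) * f (x + w))" for w and t :: real
  have Gm: "(\<lambda>(w, t). G w t) \<in> borel_measurable (lborel \<Otimes>\<^sub>M lborel)"
    unfolding G_def bump_hess_def by measurable
  \<comment> \<open>Since \<open>norm y \<le> r\<close>, all the shifted kernels with t in [0,1] are
    supported in the ball of radius 2r, where \<open>f\<close> dominates the integrand for
    Fubini.\<close>
  have ball: "integrable lborel (\<lambda>w. indicator (cball 0 (2 * r)) w * f (x + w))"
  proof (rule integrable_kernel_mult[OF f fm, of _ 1 "2 * r + 1"])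
    show "indicator (cball 0 (2 * r)) w = (0::real)" if "2 * r + 1 \<le> norm w" for w :: 'a
      using that by (auto simp: indicator_def)
  qed (auto simp: indicator_def)
  have Gi: "integrable (lborel \<Otimes>\<^sub>M lborel) (\<lambda>(w, t). G w t)"
  proof (rule integrableI_bounded[OF Gm])
    have "(\<integral>\<^sup>+z. ennreal (norm (case z of (w, t) \<Rightarrow> G w t)) \<partial>(lborel \<Otimes>\<^sub>M lborel))
        \<le> (\<integral>\<^sup>+z. ennreal (30 * \<bar>indicator (cball 0 (2 * r)) (fst z) * f (x + fst z)\<bar>) * indicator {0..1::real} (snd z) \<partial>(lborel \<Otimes>\<^sub>M lborel))"
    proof (rule nn_integral_mono, unfold split_paired_all)
      fix w :: 'a and t :: real
      have "\<bar>G w t\<bar> \<le> 30 * \<bar>indicator (cball 0 (2 * r)) w * f (x + w)\<bar>" if t: "t \<in> {0..1}"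
      proof (cases "w \<in> cball 0 (2 * r)")
        case True
        have "\<bar>G w t\<bar> = (1 - t) * (\<bar>bump_hess r y (w - t *\<^sub>R y)\<bar> * \<bar>f (x + w)\<bar>)"
          using t by (simp add: G_def abs_mult)
        also have "\<dots> \<le> 1 * (30 * \<bar>f (x + w)\<bar>)"
          using t bump_hess_bound[OF r y] by (intro mult_mono) auto
        finally show ?thesis using True by simp
      next
        case False
        have "norm (t *\<^sub>R y) \<le> 1 * r"
          unfolding norm_scaleR using t y by (intro mult_mono) auto
        hence "r \<le> norm (w - t *\<^sub>R y)"
          using False norm_triangle_ineq2[of w "t *\<^sub>R y"] by auto
        thus ?thesis by (simp add: G_def bump_outside[OF r])
      qed
      thus "ennreal (norm (case (w, t) of (w, t) \<Rightarrow> G w t))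
          \<le> ennreal (30 * \<bar>indicator (cball 0 (2 * r)) (fst (w, t)) * f (x + fst (w, t))\<bar>) * indicator {0..1} (snd (w, t))"
        by (cases "t \<in> {0..1}") (auto simp: G_def intro!: ennreal_leI)
    qed
    also have "\<dots> = (\<integral>\<^sup>+w. (\<integral>\<^sup>+t. ennreal (30 * \<bar>indicator (cball 0 (2 * r)) w * f (x + w)\<bar>) * indicator {0..1::real} t \<partial>lborel) \<partial>lborel)"
      by (subst lborel.nn_integral_fst[symmetric]) auto
    also have "\<dots> = (\<integral>\<^sup>+w. ennreal (30 * \<bar>indicator (cball 0 (2 * r)) w * f (x + w)\<bar>) \<partial>lborel)"
      by (simp add: nn_integral_cmult)
    also have "\<dots> < \<infinity>"
    proof -
      have "30 * \<bar>g\<bar> = norm (30 * g)" for g :: real by (simp add: abs_mult)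
      thus ?thesis
        using integrable_mult_right[OF ball, of 30] unfolding integrable_iff_bounded by presburger
    qed
    finally show "(\<integral>\<^sup>+z. ennreal (norm (case z of (w, t) \<Rightarrow> G w t)) \<partial>(lborel \<Otimes>\<^sub>M lborel)) < \<infinity>" .
  qed
  have inner: "(\<integral>w. G w t \<partial>lborel) = (1 - t) * indicator {0..1} t * (\<integral>w. bump_hess r y w * f (x + t *\<^sub>R y + w) \<partial>lborel)" for t
  proof -
    have "(\<integral>w. G w t \<partial>lborel) = (1 - t) * indicator {0..1} t * (\<integral>w. bump_hess r y (w - t *\<^sub>R y) * f (x + w) \<partial>lborel)"
      unfolding G_def by simp
    also have "(\<integral>w. bump_hess r y (w - t *\<^sub>R y) * f (x + w) \<partial>lborel) = (\<integral>w. bump_hess r y w * f (x + t *\<^sub>R y + w) \<partial>lborel)"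
      using integral_lborel_translate(2)[of "\<lambda>w. bump_hess r y (w - t *\<^sub>R y) * f (x + w)" "t *\<^sub>R y"]
      by (simp add: add.assoc)
    finally show ?thesis .
  qed
  show "integrable lborel (\<lambda>t. (1 - t) * indicator {0..1} t * (\<integral>w. bump_hess r y w * f (x + t *\<^sub>R y + w) \<partial>lborel))"
    using lborel_pair.integrable_snd[OF Gi] unfolding inner .
  have outer: "(\<integral>t. G w t \<partial>lborel) = (bump r (w - y) - bump r w - bump_slope r y w) * f (x + w)" for w
  proof -
    have "(\<integral>t. G w t \<partial>lborel) = (\<integral>t. ((1 - t) * bump_hess r y (w - t *\<^sub>R y) * indicator {0..1} t) * f (x + w) \<partial>lborel)"
      by (intro Bochner_Integration.integral_cong refl) (simp add: G_def)
    also have "\<dots> = (bump r (w - y) - bump r w - bump_slope r y w) * f (x + w)"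
      by (subst integral_mult_left_zero) (simp add: bump_taylor)
    finally show ?thesis .
  qed
  have i1: "integrable lborel (\<lambda>w. bump r w * f (z + w))" for z
    by (rule integrable_kernel_mult[OF f fm _ _ bump_outside(1)[OF r], where K=1]) (auto simp: bump_bounds)
  have i2: "integrable lborel (\<lambda>w. bump_slope r y w * f (x + w))"
    by (rule integrable_kernel_mult[OF f fm _ _ bump_outside(2)[OF r], where K=6]) (auto simp: bump_slope_bound[OF r y])
  have tr: "integrable lborel (\<lambda>w. bump r (w - y) * f (x + w))"
    "(\<integral>w. bump r (w - y) * f (x + w) \<partial>lborel) = (\<integral>w. bump r w * f (x + y + w) \<partial>lborel)"
    using integral_lborel_translate[of "\<lambda>w. bump r (w - y) * f (x + w)" y] i1[of "x + y"]
    by (simp_all add: add.assoc)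
  have "(\<integral>t. (\<integral>w. G w t \<partial>lborel) \<partial>lborel) = (\<integral>w. (\<integral>t. G w t \<partial>lborel) \<partial>lborel)"
    using lborel_pair.Fubini_integral[OF Gi] .
  also have "\<dots> = (\<integral>w. bump r (w - y) * f (x + w) - bump r w * f (x + w) - bump_slope r y w * f (x + w) \<partial>lborel)"
    unfolding outer by (simp add: left_diff_distrib)
  also have "\<dots> = (\<integral>w. bump r w * f (x + y + w) \<partial>lborel) - (\<integral>w. bump r w * f (x + w) \<partial>lborel) - (\<integral>w. bump_slope r y w * f (x + w) \<partial>lborel)"
    using tr i1[of x] i2 by simp
  finally show "(\<integral>w. bump r w * f (x + y + w) \<partial>lborel) = (\<integral>w. bump r w * f (x + w) \<partial>lborel)
       + (\<integral>w. bump_slope r y w * f (x + w) \<partial>lborel)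
       + (\<integral>t. (1 - t) * indicator {0..1} t * (\<integral>w. bump_hess r y w * f (x + t *\<^sub>R y + w) \<partial>lborel) \<partial>lborel)"
    unfolding inner by simp
qed

text \<open>Taylor's formula for the constant function 1: the mollification is constant and the
  first-order term vanishes because \<open>bump_slope\<close> is odd. The remainder, which is half
  of this integral, must therefore vanish as well.\<close>

lemma integral_bump_hess:
  fixes y :: "'a::euclidean_space"
  assumes r: "0 < r" and y: "norm y \<le> r"
  shows "(\<integral>w. bump_hess r y w \<partial>lborel) = 0"
proof -
  have "(\<integral>w. bump_slope r y w \<partial>lborel) = - (\<integral>w. bump_slope r y w \<partial>lborel)"
    using integral_lborel_uminus[of "bump_slope r y"] by (simp add: bump_even)
  hence 1: "(\<integral>w. bump_slope r y w \<partial>lborel) = 0" by simp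
  have half: "(\<integral>t. (1 - t) * indicator {0..1} t \<partial>lborel) = (1 / 2 :: real)"
  proof -
    have "(\<integral>t. (1 - t) * indicator {0..1} t \<partial>lborel) = (1 - 1\<^sup>2 / 2) - (0 - 0\<^sup>2 / 2 :: real)"
      by (rule integral_FTC_Icc_real[where F="\<lambda>t. t - t\<^sup>2 / 2"]) (auto intro!: derivative_eq_intros)
    thus ?thesis by simp
  qed
  have "(\<integral>t. (1 - t) * indicator {0..1} t * (\<integral>w. bump_hess r y w \<partial>lborel) \<partial>lborel) = 0"
    using bump_taylor_integrated(2)[OF loc_integrable_const[of 1] _ r y] 1 by simp
  thus ?thesis by (subst (asm) integral_mult_left_zero) (simp add: half)
qed


section \<open>Affine approximation measured by second differences\<close>

definition second_diff_mean :: "('a::euclidean_space \<Rightarrow> real) \<Rightarrow> real \<Rightarrow> real \<Rightarrow> 'a \<Rightarrow> ennreal" where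
  "second_diff_mean f p r x = (\<integral>\<^sup>+w. ennreal (\<bar>second_diff f w x\<bar> powr p) * indicator (ball 0 r) w \<partial>lborel)"

lemma abs_integral_kernel_second_diff_le:
  fixes f k :: "'a::euclidean_space \<Rightarrow> real"
  assumes i: "integrable lborel (\<lambda>w. k w * second_diff f w a)"
    and fm [measurable]: "f \<in> borel_measurable borel"
    and K: "\<And>w. \<bar>k w\<bar> \<le> K" and supp: "\<And>w. r \<le> norm w \<Longrightarrow> k w = 0"
  shows "ennreal \<bar>\<integral>w. k w * second_diff f w a \<partial>lborel\<bar> \<le> ennreal K * second_diff_mean f 1 r a"
proof -
  have K0: "0 \<le> K" using K[of 0] by linarith
  have "ennreal \<bar>\<integral>w. k w * second_diff f w a \<partial>lborel\<bar> \<le> (\<integral>\<^sup>+w. ennreal (norm (k w * second_diff f w a)) \<partial>lborel)"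
    using integral_norm_bound_ennreal[OF i] by simp
  also have "\<dots> \<le> (\<integral>\<^sup>+w. ennreal K * (ennreal (\<bar>second_diff f w a\<bar> powr 1) * indicator (ball 0 r) w) \<partial>lborel)"
  proof (rule nn_integral_mono)
    fix w :: 'a
    show "ennreal (norm (k w * second_diff f w a)) \<le> ennreal K * (ennreal (\<bar>second_diff f w a\<bar> powr 1) * indicator (ball 0 r) w)"
      using K[of w] supp[of w] K0
      by (cases "r \<le> norm w")
        (auto simp: abs_mult ennreal_mult[symmetric] intro!: ennreal_leI mult_right_mono)
  qed
  also have "\<dots> = ennreal K * second_diff_mean f 1 r a"
    unfolding second_diff_mean_def by (rule nn_integral_cmult) measurable
  finally show ?thesis .
qed

text \<open>On the ball of half the radius the kernel is at least (3/4)^3 = 27/64. What matters is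
  the order r^n of the mass, by which the mollification is normalised.\<close>

lemma integral_bump_ge:
  assumes r: "0 < r"
  shows "(27 / 64) * (unit_ball_vol DIM('a) * (r / 2) ^ DIM('a)) \<le> (\<integral>w. bump r w \<partial>(lborel :: 'a::euclidean_space measure))"
proof -
  have i: "integrable lborel (bump r :: 'a \<Rightarrow> real)"
    using integrable_kernel_mult[OF loc_integrable_const[of 1], of "bump r :: 'a \<Rightarrow> real" 1 r]
    by (auto simp: bump_bounds bump_outside[OF r])
  have ib: "integrable lborel (\<lambda>w::'a. (27 / 64) * indicator (cball 0 (r / 2)) w :: real)"
    by (intro integrable_mult_right integrable_real_indicator emeasure_lborel_cball_finite) auto
  have "(27 / 64) * (unit_ball_vol DIM('a) * (r / 2) ^ DIM('a)) = (27 / 64) * measure lborel (cball (0::'a) (r / 2))"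
    using r by (simp add: content_cball)
  also have "\<dots> = (\<integral>w. (27 / 64) * indicator (cball 0 (r / 2)) w \<partial>(lborel :: 'a measure))"
    by simp
  also have "\<dots> \<le> (\<integral>w. bump r w \<partial>(lborel :: 'a measure))"
  proof (rule integral_mono[OF ib i])
    fix w :: 'a
    show "(27 / 64) * indicator (cball 0 (r / 2)) w \<le> bump r w"
    proof (cases "w \<in> cball 0 (r / 2)")
      case True
      hence "(norm w)\<^sup>2 \<le> (r / 2)\<^sup>2" by (intro power_mono) auto
      hence "(w \<bullet> w) / r\<^sup>2 \<le> 1 / 4"
        using r by (simp add: dot_square_norm field_simps)
      hence "3 / 4 \<le> max 0 (1 - (w \<bullet> w) / r\<^sup>2)" by linarith
      hence "(3 / 4) ^ 3 \<le> max 0 (1 - (w \<bullet> w) / r\<^sup>2) ^ 3"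
        by (rule power_mono) simp
      thus ?thesis using True by (simp add: bump_def power3_eq_cube)
    qed (simp add: bump_bounds)
  qed
  finally show ?thesis .
qed

text \<open>Let B be the mass of the kernel and F the mollification before division by B. Evenness
  gives \<open>F x = B * f x + S x / 2\<close> and Taylor's formula gives
  \<open>F x = F x0 + c \<bullet> y + Rem\<close>, so the error is
  \<open>(Rem - S x / 2) / B\<close>. The affine function depends on \<open>f\<close>,
  \<open>x0\<close> and \<open>r\<close> alone, hence one choice serves all vertices of a simplex.
  Note that \<open>second_diff_mean\<close> is not divided by the volume of the ball.\<close>

lemma affine_approximation:
  fixes f :: "'a::euclidean_space \<Rightarrow> real"
  assumes f: "loc_integrable f" and fm [measurable]: "f \<in> borel_measurable borel" and r: "0 < r"
  obtains a c where "\<And>x. norm (x - x0) \<le> r \<Longrightarrow> ennreal \<bar>f x - (a + c \<bullet> x)\<bar>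
     \<le> ennreal (15 / (\<integral>w. bump r w \<partial>(lborel :: 'a measure))) * (second_diff_mean f 1 r x
        + (\<integral>\<^sup>+t. indicator {0..1} t * second_diff_mean f 1 r (x0 + t *\<^sub>R (x - x0)) \<partial>lborel))"
proof -
  define B where "B = (\<integral>w. bump r w \<partial>(lborel :: 'a measure))"
  define F where "F z = (\<integral>w. bump r w * f (z + w) \<partial>lborel)" for z
  define \<Lambda> where "\<Lambda> y = (\<integral>w. bump_slope r y w * f (x0 + w) \<partial>lborel)" for y
  have "0 < (27 / 64) * (unit_ball_vol DIM('a) * (r / 2) ^ DIM('a))"
    using r by simp
  hence B: "0 < B"
    unfolding B_def using integral_bump_ge[OF r, where 'a='a] by linarith
  have islope: "integrable lborel (\<lambda>w. bump_slope r y w * f (x0 + w))" for y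
  proof (rule integrable_kernel_mult[OF f fm _ _ bump_outside(2)[OF r]])
    \<comment> \<open>\<open>bump_slope_bound\<close> covers \<open>norm y \<le> r\<close> only;
      homogeneity in \<open>y\<close> extends it to all \<open>y\<close>, as the linearity of
      \<open>\<Lambda>\<close> requires.\<close>
    show "\<bar>bump_slope r y w\<bar> \<le> 6 * (norm y / r)" for w
    proof (cases "y = 0")
      case False
      have "bump_slope r y w = (norm y / r) * bump_slope r ((r / norm y) *\<^sub>R y) w"
        using False r by (simp add: bump_slope_def)
      moreover have "\<bar>bump_slope r ((r / norm y) *\<^sub>R y) w\<bar> \<le> 6"
        using r by (intro bump_slope_bound) auto
      ultimately show ?thesis
        using r by (simp add: abs_mult divide_right_mono mult_left_mono mult.commute)
    qed (simp add: bump_slope_def)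
  qed measurable
  have "linear \<Lambda>"
  proof (rule linearI)
    show "\<Lambda> (y + z) = \<Lambda> y + \<Lambda> z" for y z
      unfolding \<Lambda>_def using islope[of y] islope[of z]
      by (subst Bochner_Integration.integral_add[symmetric])
        (auto intro!: Bochner_Integration.integral_cong simp: bump_slope_def inner_add_right add_divide_distrib algebra_simps)
    show "\<Lambda> (b *\<^sub>R y) = b *\<^sub>R \<Lambda> y" for b y
    proof -
      have "\<Lambda> (b *\<^sub>R y) = (\<integral>w. b * (bump_slope r y w * f (x0 + w)) \<partial>lborel)"
        unfolding \<Lambda>_def by (intro Bochner_Integration.integral_cong) (auto simp: bump_slope_def)
      thus ?thesis by (simp add: \<Lambda>_def)
    qed
  qed
  \<comment> \<open>Riesz representation of the linear form \<open>\<Lambda>\<close>.\<close>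
  define c where "c = adjoint \<Lambda> 1"
  have c: "\<Lambda> y = c \<bullet> y" for y
    using adjoint_works[OF \<open>linear \<Lambda>\<close>, of y 1] by (simp add: c_def inner_commute)
  show ?thesis
  proof (rule that[of "(F x0 - c \<bullet> x0) / B" "(1 / B) *\<^sub>R c"])
    fix x assume x: "norm (x - x0) \<le> r"
    define y where "y = x - x0"
    define S where "S z = (\<integral>w. bump r w * second_diff f w z \<partial>lborel)" for z
    define H where "H z = (\<integral>w. bump_hess r y w * second_diff f w z \<partial>lborel)" for z
    define Rem where "Rem = (\<integral>t. (1 - t) * indicator {0..1} t * (\<integral>w. bump_hess r y w * f (x0 + t *\<^sub>R y + w) \<partial>lborel) \<partial>lborel)"
    have y: "norm y \<le> r" using x by (simp add: y_def)
    have k1: "\<And>w::'a. \<bar>bump r w\<bar> \<le> 1" by (simp add: bump_bounds)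
    have evB: "integrable lborel (\<lambda>w. bump r w * second_diff f w z)"
      "(\<integral>w. bump r w * f (z + w) \<partial>lborel) = B * f z + S z / 2" for z
      unfolding B_def S_def
      by (intro integral_even_kernel[OF f fm, where K=1 and R=r]; simp add: k1 bump_outside[OF r] bump_even)+
    have evH: "integrable lborel (\<lambda>w. bump_hess r y w * second_diff f w z)"
      "(\<integral>w. bump_hess r y w * f (z + w) \<partial>lborel) = (\<integral>w. bump_hess r y w \<partial>lborel) * f z + H z / 2" for z
      unfolding H_def
      by (intro integral_even_kernel[OF f fm, where K=30 and R=r];
          simp add: bump_hess_bound[OF r y] bump_outside[OF r] bump_even)+
    have FS: "F x = B * f x + S x / 2"
      using evB(2)[of x] by (simp add: F_def)
    have HH: "(\<integral>w. bump_hess r y w * f (z + w) \<partial>lborel) = H z / 2" for z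
      using evH(2)[of z] by (simp add: integral_bump_hess[OF r y])
    have FT: "F x = F x0 + c \<bullet> y + Rem"
      using bump_taylor_integrated(2)[OF f fm r y, of x0]
      by (simp add: F_def Rem_def c[symmetric] \<Lambda>_def y_def)
    have Sb: "ennreal \<bar>S x\<bar> \<le> ennreal 1 * second_diff_mean f 1 r x"
      unfolding S_def by (rule abs_integral_kernel_second_diff_le[OF evB(1) fm k1 bump_outside(1)[OF r]])
    have Hb: "ennreal \<bar>H z\<bar> \<le> ennreal 30 * second_diff_mean f 1 r z" for z
      unfolding H_def by (rule abs_integral_kernel_second_diff_le[OF evH(1) fm bump_hess_bound[OF r y] bump_outside(3)[OF r]])
    have "ennreal \<bar>Rem\<bar> \<le> (\<integral>\<^sup>+t. ennreal (norm ((1 - t) * indicator {0..1} t * (\<integral>w. bump_hess r y w * f (x0 + t *\<^sub>R y + w) \<partial>lborel))) \<partial>lborel)"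
      unfolding Rem_def using integral_norm_bound_ennreal[OF bump_taylor_integrated(1)[OF f fm r y, of x0]] by simp
    \<comment> \<open>15 is half of the bound 30 on \<open>bump_hess\<close>; the factor 1 - t is
      estimated by 1.\<close>
    also have "\<dots> \<le> (\<integral>\<^sup>+t. ennreal 15 * (indicator {0..1} t * second_diff_mean f 1 r (x0 + t *\<^sub>R y)) \<partial>lborel)"
    proof (rule nn_integral_mono)
      fix t :: real
      show "ennreal (norm ((1 - t) * indicator {0..1} t * (\<integral>w. bump_hess r y w * f (x0 + t *\<^sub>R y + w) \<partial>lborel)))
        \<le> ennreal 15 * (indicator {0..1} t * second_diff_mean f 1 r (x0 + t *\<^sub>R y))"
      proof (cases "t \<in> {0..1}")
        case True
        have "\<bar>1 - t\<bar> * \<bar>H (x0 + t *\<^sub>R y)\<bar> \<le> 1 * \<bar>H (x0 + t *\<^sub>R y)\<bar>"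
          using True by (intro mult_right_mono) auto
        hence "ennreal (norm ((1 - t) * indicator {0..1} t * (\<integral>w. bump_hess r y w * f (x0 + t *\<^sub>R y + w) \<partial>lborel)))
          \<le> ennreal (1 / 2 * \<bar>H (x0 + t *\<^sub>R y)\<bar>)"
          unfolding HH using True by (intro ennreal_leI) (simp add: abs_mult)
        also have "\<dots> = ennreal (1 / 2) * ennreal \<bar>H (x0 + t *\<^sub>R y)\<bar>"
          by (intro ennreal_mult) auto
        also have "\<dots> \<le> ennreal (1 / 2) * (ennreal 30 * second_diff_mean f 1 r (x0 + t *\<^sub>R y))"
          by (intro mult_left_mono Hb) auto
        also have "\<dots> = ennreal (1 / 2 * 30) * second_diff_mean f 1 r (x0 + t *\<^sub>R y)"
          by (subst ennreal_mult) (auto simp: mult.assoc)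
        finally show ?thesis using True by simp
      qed simp
    qed
    also have "\<dots> = ennreal 15 * (\<integral>\<^sup>+t. indicator {0..1} t * second_diff_mean f 1 r (x0 + t *\<^sub>R y) \<partial>lborel)"
      unfolding second_diff_mean_def by (rule nn_integral_cmult) measurable
    finally have Rb: "ennreal \<bar>Rem\<bar> \<le> \<dots>" .
    have "f x - ((F x0 - c \<bullet> x0) / B + ((1 / B) *\<^sub>R c) \<bullet> x) = (Rem - S x / 2) / B"
    proof -
      have "B * f x = F x0 + (c \<bullet> x - c \<bullet> x0) + Rem - S x / 2"
        using FS FT by (simp add: y_def inner_diff_right)
      hence "(B * f x - (F x0 - c \<bullet> x0) - c \<bullet> x) / B = (Rem - S x / 2) / B"
        by simp
      thus ?thesis using B by (simp add: diff_divide_distrib)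
    qed
    hence "\<bar>f x - ((F x0 - c \<bullet> x0) / B + ((1 / B) *\<^sub>R c) \<bullet> x)\<bar> = 1 / B * \<bar>Rem - S x / 2\<bar>"
      using B by simp
    \<comment> \<open>The factor 1/2 of \<open>S x\<close> is enlarged to 15 so that both terms
      share one constant.\<close>
    also have "\<dots> \<le> 1 / B * (15 * \<bar>S x\<bar> + \<bar>Rem\<bar>)"
      using B by (intro mult_left_mono) auto
    finally have "ennreal \<bar>f x - ((F x0 - c \<bullet> x0) / B + ((1 / B) *\<^sub>R c) \<bullet> x)\<bar> \<le> ennreal (1 / B) * (ennreal 15 * ennreal \<bar>S x\<bar> + ennreal \<bar>Rem\<bar>)"
      using B by (subst ennreal_mult[symmetric] ennreal_plus[symmetric], simp, simp)+ (rule ennreal_leI)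
    also have "\<dots> \<le> ennreal (1 / B) * (ennreal 15 * second_diff_mean f 1 r x + ennreal 15 * (\<integral>\<^sup>+t. indicator {0..1} t * second_diff_mean f 1 r (x0 + t *\<^sub>R y) \<partial>lborel))"
      using Sb Rb by (intro mult_left_mono add_mono) auto
    also have "\<dots> = ennreal (15 / B) * (second_diff_mean f 1 r x + (\<integral>\<^sup>+t. indicator {0..1} t * second_diff_mean f 1 r (x0 + t *\<^sub>R y) \<partial>lborel))"
    proof -
      have "ennreal (15 / B) = ennreal (1 / B) * ennreal 15"
        using B by (subst ennreal_mult[symmetric]) auto
      thus ?thesis by (simp add: distrib_left mult.assoc)
    qed
    finally show "ennreal \<bar>f x - ((F x0 - c \<bullet> x0) / B + ((1 / B) *\<^sub>R c) \<bullet> x)\<bar>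
     \<le> ennreal (15 / (\<integral>w. bump r w \<partial>(lborel :: 'a measure))) * (second_diff_mean f 1 r x
        + (\<integral>\<^sup>+t. indicator {0..1} t * second_diff_mean f 1 r (x0 + t *\<^sub>R (x - x0)) \<partial>lborel))"
      by (simp add: B_def y_def)
  qed
qed

section \<open>From first powers to p-th powers\<close>

lemma young_scaled:
  fixes g A p :: real
  assumes "0 < A" "0 \<le> g" "1 < p"
  shows "g \<le> A powr (1 - p) * g powr p + A"
proof (cases "g \<le> A")
  case True
  thus ?thesis by (simp add: add_increasing)
next
  case False
  hence "g = g powr (1 - p) * g powr p"
    using assms by (simp add: powr_add[symmetric])
  also have "\<dots> \<le> A powr (1 - p) * g powr p"
    using False assms by (intro mult_right_mono powr_mono2') auto
  finally show ?thesis using assms by linarith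
qed

text \<open>This takes the place of Hoelder's inequality on a set of measure \<open>m\<close>: an
  estimate valid for every parameter \<open>A\<close> becomes a power bound once \<open>A\<close> is
  chosen well. The factor 3 counts three terms of size \<open>A * m\<close>.\<close>

lemma powr_le_of_young_family:
  fixes u K m p :: real and P :: ennreal
  assumes fam: "\<And>A. 0 < A \<Longrightarrow> ennreal u \<le> ennreal K * (ennreal (A powr (1 - p)) * P + ennreal (2 * A * m))"
    and "0 \<le> u" "0 \<le> K" "0 < m" "1 < p"
  shows "ennreal (u powr p) \<le> ennreal ((3 * K) powr p * m powr (p - 1)) * P"
proof (cases "K = 0")
  case True
  hence "u = 0" using fam[of 1] assms by simp
  thus ?thesis using assms by simp
next
  case False
  hence K: "0 < K" using assms by simp
  show ?thesis
  proof (cases P)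
    case top
    thus ?thesis using K assms by (simp add: ennreal_mult_top)
  next
    case (real P')
    have fam': "u \<le> K * (A powr (1 - p) * P' + 2 * A * m)" if "0 < A" for A
    proof -
      have "ennreal u \<le> ennreal (K * (A powr (1 - p) * P' + 2 * A * m))"
        using fam[OF that] real assms that by (simp add: ennreal_mult ennreal_plus)
      thus ?thesis using real assms that by (subst (asm) ennreal_le_iff) auto
    qed
    have "u powr p \<le> (3 * K) powr p * m powr (p - 1) * P'"
    proof (cases "P' = 0")
      case True
      \<comment> \<open>With \<open>P' = 0\<close> there is no best \<open>A\<close>; letting
        \<open>A\<close> tend to 0 forces \<open>u \<le> 0\<close>.\<close>
      have "u \<le> e" if "0 < e" for e
        using fam'[of "e / (2 * K * m)"] True K assms that by (simp add: field_simps)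
      hence "u \<le> 0" by (rule field_le_epsilon[of u 0, simplified])
      thus ?thesis using assms True by simp
    next
      case False
      hence P': "0 < P'" using real by simp
      \<comment> \<open>This value balances the two sides:
        \<open>A powr (1 - p) * P' = A * m\<close>.\<close>
      define A where "A = (P' / m) powr (1 / p)"
      have A: "0 < A" using P' assms by (simp add: A_def)
      have Ap: "A powr p = P' / m"
        using P' assms by (simp add: A_def powr_powr)
      have "A powr (1 - p) * P' = A * m"
      proof -
        have "A powr (1 - p) * P' = A powr (1 - p) * (A powr p * m)"
          using Ap assms by simp
        also have "\<dots> = A * m" using A by (simp add: powr_add[symmetric] mult.assoc[symmetric])
        finally show ?thesis .
      qed
      hence "u \<le> 3 * K * (A * m)" using fam'[OF A] by (simp add: algebra_simps)
      hence "u powr p \<le> (3 * K * (A * m)) powr p"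
        using assms by (intro powr_mono2) auto
      also have "\<dots> = (3 * K) powr p * (P' / m * m powr p)"
        using A K assms Ap by (simp add: powr_mult)
      also have "P' / m * m powr p = m powr (p - 1) * P'"
        using assms by (simp add: powr_diff)
      finally show ?thesis by (simp add: mult.assoc)
    qed
    thus ?thesis using real assms
      by (simp add: ennreal_mult'[symmetric] ennreal_leI)
  qed
qed

lemma second_diff_mean_measurable [measurable]:
  fixes f :: "'a::euclidean_space \<Rightarrow> real"
  assumes [measurable]: "f \<in> borel_measurable borel" "g \<in> borel_measurable M" "h \<in> borel_measurable M"
  shows "(\<lambda>z. second_diff_mean f p (g z) (h z)) \<in> borel_measurable M"
proof -
  have "(\<lambda>z. \<integral>\<^sup>+w. ennreal (\<bar>second_diff f w (h z)\<bar> powr p) * (if norm w < g z then 1 else 0) \<partial>lborel) \<in> borel_measurable M"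
    by measurable
  moreover have "indicator (ball 0 r) w = (if norm w < r then 1 else 0 :: ennreal)" for w :: 'a and r
    by (auto simp: indicator_def)
  ultimately show ?thesis by (simp add: second_diff_mean_def)
qed

lemma second_diff_mean_1_le:
  fixes f :: "'a::euclidean_space \<Rightarrow> real"
  assumes [measurable]: "f \<in> borel_measurable borel" and "0 < A" "1 < p" "0 < r"
  shows "second_diff_mean f 1 r x \<le> ennreal (A powr (1 - p)) * second_diff_mean f p r x
    + ennreal (A * (unit_ball_vol DIM('a) * r ^ DIM('a)))"
proof -
  have "second_diff_mean f 1 r x \<le> (\<integral>\<^sup>+w. ennreal (A powr (1 - p)) * (ennreal (\<bar>second_diff f w x\<bar> powr p) * indicator (ball 0 r) w)
      + ennreal A * indicator (ball 0 r) w \<partial>lborel)"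
    unfolding second_diff_mean_def
  proof (rule nn_integral_mono)
    fix w :: 'a
    have "ennreal (\<bar>second_diff f w x\<bar> powr 1) \<le> ennreal (A powr (1 - p) * \<bar>second_diff f w x\<bar> powr p + A)"
      using young_scaled[of A "\<bar>second_diff f w x\<bar>" p] assms by (intro ennreal_leI) auto
    also have "\<dots> = ennreal (A powr (1 - p)) * ennreal (\<bar>second_diff f w x\<bar> powr p) + ennreal A"
      using assms by (simp add: ennreal_mult ennreal_plus)
    finally show "ennreal (\<bar>second_diff f w x\<bar> powr 1) * indicator (ball 0 r) w
      \<le> ennreal (A powr (1 - p)) * (ennreal (\<bar>second_diff f w x\<bar> powr p) * indicator (ball 0 r) w)
        + ennreal A * indicator (ball 0 r) w"
      by (simp add: indicator_def)
  qed
  also have "\<dots> = ennreal (A powr (1 - p)) * second_diff_mean f p r x + ennreal A * emeasure lborel (ball (0::'a) r)"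
    unfolding second_diff_mean_def
    by (subst nn_integral_add, measurable, subst nn_integral_cmult, measurable, subst nn_integral_cmult_indicator) auto
  finally show ?thesis using assms by (simp add: emeasure_ball ennreal_mult)
qed

text \<open>The factor (3K)^p m^(p-1) from \<open>powr_le_of_young_family\<close>, where K bounds
  15/B through \<open>integral_bump_ge\<close> and m is the volume of the ball, both taken at r = 1.
  The powers of r combine to r^(-n), which stays visible in the statements.\<close>

definition approx_const :: "nat \<Rightarrow> real \<Rightarrow> real" where
  "approx_const n p = (3 * (15 * 64 / 27 * 2 ^ n / unit_ball_vol n)) powr p * unit_ball_vol n powr (p - 1)"

lemma affine_approximation_powr:
  fixes f :: "'a::euclidean_space \<Rightarrow> real"
  assumes f: "loc_integrable f" and fm [measurable]: "f \<in> borel_measurable borel"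
    and r: "0 < r" and p: "1 < p"
  obtains a c where "\<And>x. norm (x - x0) \<le> r \<Longrightarrow> ennreal (\<bar>f x - (a + c \<bullet> x)\<bar> powr p)
     \<le> ennreal (approx_const DIM('a) p / r ^ DIM('a)) * (second_diff_mean f p r x
        + (\<integral>\<^sup>+t. indicator {0..1} t * second_diff_mean f p r (x0 + t *\<^sub>R (x - x0)) \<partial>lborel))"
proof -
  let ?n = "DIM('a)"
  define v where "v = unit_ball_vol ?n"
  have v: "0 < v" by (simp add: v_def)
  define k where "k = 15 * 64 / 27 * 2 ^ ?n / v"
  have k: "0 < k" using v by (simp add: k_def)
  let ?B = "\<integral>w. bump r w \<partial>(lborel :: 'a measure)"
  have B: "15 / ?B \<le> k / r ^ ?n"
  proof -
    have "15 / ?B \<le> 15 / ((27 / 64) * (v * (r / 2) ^ ?n))"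
      using integral_bump_ge[OF r, where 'a='a] v r unfolding v_def[symmetric]
      by (intro divide_left_mono) (auto intro!: mult_pos_pos less_le_trans[OF _ integral_bump_ge[OF r, where 'a='a, folded v_def]])
    also have "\<dots> = k / r ^ ?n" by (simp add: k_def power_divide)
    finally show ?thesis .
  qed
  obtain a c where ac: "\<And>x. norm (x - x0) \<le> r \<Longrightarrow> ennreal \<bar>f x - (a + c \<bullet> x)\<bar>
     \<le> ennreal (15 / ?B) * (second_diff_mean f 1 r x
        + (\<integral>\<^sup>+t. indicator {0..1} t * second_diff_mean f 1 r (x0 + t *\<^sub>R (x - x0)) \<partial>lborel))"
    using affine_approximation[OF f fm r] by blast
  show ?thesis
  proof (rule that[of a c])
    fix x assume x: "norm (x - x0) \<le> r"
    let ?D = "second_diff_mean f p r" and ?D1 = "second_diff_mean f 1 r"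
    let ?P = "?D x + (\<integral>\<^sup>+t. indicator {0..1} t * ?D (x0 + t *\<^sub>R (x - x0)) \<partial>lborel)"
    have "ennreal (\<bar>f x - (a + c \<bullet> x)\<bar> powr p) \<le> ennreal ((3 * (k / r ^ ?n)) powr p * (v * r ^ ?n) powr (p - 1)) * ?P"
    proof (rule powr_le_of_young_family)
      fix A :: real assume A: "0 < A"
      let ?e = "ennreal (A * (v * r ^ ?n))"
      have "(\<integral>\<^sup>+t. indicator {0..1} t * ?D1 (x0 + t *\<^sub>R (x - x0)) \<partial>lborel)
          \<le> (\<integral>\<^sup>+t. ennreal (A powr (1 - p)) * (indicator {0..1} t * ?D (x0 + t *\<^sub>R (x - x0))) + ?e * indicator {0..1::real} t \<partial>lborel)"
        using second_diff_mean_1_le[OF fm A p r]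
        by (intro nn_integral_mono) (auto simp: indicator_def v_def)
      also have "\<dots> = ennreal (A powr (1 - p)) * (\<integral>\<^sup>+t. indicator {0..1} t * ?D (x0 + t *\<^sub>R (x - x0)) \<partial>lborel) + ?e"
        by (subst nn_integral_add, measurable, subst nn_integral_cmult, measurable, subst nn_integral_cmult_indicator) auto
      finally have 1: "(\<integral>\<^sup>+t. indicator {0..1} t * ?D1 (x0 + t *\<^sub>R (x - x0)) \<partial>lborel) \<le> \<dots>" .
      have 2: "?D1 x \<le> ennreal (A powr (1 - p)) * ?D x + ?e"
        using second_diff_mean_1_le[OF fm A p r] by (simp add: v_def)
      have "ennreal \<bar>f x - (a + c \<bullet> x)\<bar> \<le> ennreal (k / r ^ ?n) * (?D1 x
        + (\<integral>\<^sup>+t. indicator {0..1} t * ?D1 (x0 + t *\<^sub>R (x - x0)) \<partial>lborel))"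
        by (rule order_trans[OF ac[OF x]]) (intro mult_right_mono ennreal_leI B, simp)
      also have "\<dots> \<le> ennreal (k / r ^ ?n) * ((ennreal (A powr (1 - p)) * ?D x + ?e)
        + (ennreal (A powr (1 - p)) * (\<integral>\<^sup>+t. indicator {0..1} t * ?D (x0 + t *\<^sub>R (x - x0)) \<partial>lborel) + ?e))"
        by (intro mult_left_mono add_mono 1 2) auto
      also have "\<dots> = ennreal (k / r ^ ?n) * (ennreal (A powr (1 - p)) * ?P + (?e + ?e))"
        by (simp add: distrib_left add_ac)
      also have "?e + ?e = ennreal (2 * A * (v * r ^ ?n))"
        using A v r by (subst ennreal_plus[symmetric]) auto
      finally show "ennreal \<bar>f x - (a + c \<bullet> x)\<bar> \<le> ennreal (k / r ^ ?n) * (ennreal (A powr (1 - p)) * ?P + ennreal (2 * A * (v * r ^ ?n)))" .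
    qed (use k v r p in auto)
    also have "(3 * (k / r ^ ?n)) powr p * (v * r ^ ?n) powr (p - 1) = approx_const ?n p / r ^ ?n"
    proof -
      have "(3 * (k / r ^ ?n)) powr p * (v * r ^ ?n) powr (p - 1)
          = (3 * k) powr p * v powr (p - 1) * ((r ^ ?n) powr (p - 1) / (r ^ ?n) powr p)"
        using k v r by (simp add: powr_mult powr_divide)
      also have "(r ^ ?n) powr (p - 1) / (r ^ ?n) powr p = 1 / r ^ ?n"
        using r by (simp add: powr_diff)
      finally show ?thesis by (simp add: approx_const_def k_def v_def)
    qed
    finally show "ennreal (\<bar>f x - (a + c \<bullet> x)\<bar> powr p) \<le> ennreal (approx_const ?n p / r ^ ?n) * ?P" .
  qed
qed

text \<open>The half-thickness of the slab is the largest error at a vertex, and the p-th power of a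
  maximum is at most the sum of the p-th powers. The exponent np - n combines (r^n)^p from the
  volume with r^(-n) from the approximation.\<close>

lemma graph_simplex_volume_powr_le:
  fixes f :: "'a::euclidean_space \<Rightarrow> real" and X :: "nat \<Rightarrow> 'a"
  assumes f: "loc_integrable f" and fm [measurable]: "f \<in> borel_measurable borel"
    and r: "0 < r" and p: "1 < p" and X: "\<And>i. i \<le> m \<Longrightarrow> dist (X 0) (X i) < r"
  shows "ennreal (measure lebesgue (convex hull {graph_pt f (X i) | i. i \<le> m}) powr p)
    \<le> ennreal ((2 * unit_ball_vol DIM('a)) powr p * approx_const DIM('a) p * r powr (real DIM('a) * p - DIM('a)))
      * (\<Sum>i\<le>m. second_diff_mean f p r (X i)
         + (\<integral>\<^sup>+t. indicator {0..1} t * second_diff_mean f p r (X 0 + t *\<^sub>R (X i - X 0)) \<partial>lborel))"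
proof -
  let ?n = "DIM('a)"
  define v where "v = unit_ball_vol ?n"
  have v: "0 < v" by (simp add: v_def)
  let ?D = "second_diff_mean f p r"
  obtain a c where ac: "\<And>x. norm (x - X 0) \<le> r \<Longrightarrow> ennreal (\<bar>f x - (a + c \<bullet> x)\<bar> powr p)
     \<le> ennreal (approx_const ?n p / r ^ ?n) * (?D x
        + (\<integral>\<^sup>+t. indicator {0..1} t * ?D (X 0 + t *\<^sub>R (x - X 0)) \<partial>lborel))"
    using affine_approximation_powr[OF f fm r p] by blast
  let ?e = "\<lambda>i. \<bar>f (X i) - (a + c \<bullet> X i)\<bar>"
  define M where "M = Max (?e ` {..m})"
  have M: "?e i \<le> M" if "i \<le> m" for i
    unfolding M_def using that by (intro Max_ge) auto
  have "M \<in> ?e ` {..m}" unfolding M_def by (intro Max_in) auto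
  then obtain i0 where i0: "i0 \<le> m" "M = ?e i0" by auto
  have M0: "0 \<le> M" using i0 by simp
  have set_eq: "{graph_pt f (X i) | i. i \<le> m} = graph_pt f ` (X ` {..m})" by auto
  have sub: "X ` {..m} \<subseteq> cball (X 0) r" using X by (auto simp: less_imp_le)
  have "measure lebesgue (convex hull {graph_pt f (X i) | i. i \<le> m}) \<le> 2 * M * (v * r ^ ?n)"
    unfolding set_eq v_def
    using measure_graph_hull_le[OF _ sub _ M0, of f a c] M r by auto
  hence "measure lebesgue (convex hull {graph_pt f (X i) | i. i \<le> m}) powr p \<le> (2 * M * (v * r ^ ?n)) powr p"
    using p by (intro powr_mono2) auto
  also have "\<dots> = (2 * v) powr p * (r ^ ?n) powr p * M powr p"
    using M0 v r by (simp add: powr_mult mult_ac)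
  also have "\<dots> \<le> (2 * v) powr p * (r ^ ?n) powr p * (\<Sum>i\<le>m. ?e i powr p)"
    using i0 by (intro mult_left_mono member_le_sum[of i0 "{..m}" "\<lambda>i. ?e i powr p", THEN order_trans[rotated]]) auto
  finally have "ennreal (measure lebesgue (convex hull {graph_pt f (X i) | i. i \<le> m}) powr p)
      \<le> ennreal ((2 * v) powr p * (r ^ ?n) powr p) * (\<Sum>i\<le>m. ennreal (?e i powr p))"
    by (simp add: ennreal_mult[symmetric] sum_nonneg ennreal_leI)
  also have "\<dots> \<le> ennreal ((2 * v) powr p * (r ^ ?n) powr p) * (\<Sum>i\<le>m. ennreal (approx_const ?n p / r ^ ?n) * (?D (X i)
        + (\<integral>\<^sup>+t. indicator {0..1} t * ?D (X 0 + t *\<^sub>R (X i - X 0)) \<partial>lborel)))"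
    using X by (intro mult_left_mono sum_mono ac) (auto simp: dist_norm norm_minus_commute intro: less_imp_le)
  also have "\<dots> = (ennreal ((2 * v) powr p * (r ^ ?n) powr p) * ennreal (approx_const ?n p / r ^ ?n)) * (\<Sum>i\<le>m. ?D (X i)
        + (\<integral>\<^sup>+t. indicator {0..1} t * ?D (X 0 + t *\<^sub>R (X i - X 0)) \<partial>lborel))"
    unfolding sum_distrib_left[symmetric] by (simp add: mult.assoc)
  also have "ennreal ((2 * v) powr p * (r ^ ?n) powr p) * ennreal (approx_const ?n p / r ^ ?n)
      = ennreal ((2 * v) powr p * approx_const ?n p * r powr (real ?n * p - ?n))"
  proof -
    have "(r ^ ?n) powr p / r ^ ?n = r powr (real ?n * p - ?n)"
      using r by (simp add: powr_realpow[symmetric] powr_powr powr_diff)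
    moreover have "(2 * v) powr p * (r ^ ?n) powr p * (approx_const ?n p / r ^ ?n)
        = (2 * v) powr p * approx_const ?n p * ((r ^ ?n) powr p / r ^ ?n)"
      by simp
    moreover have "0 \<le> approx_const ?n p" by (simp add: approx_const_def)
    ultimately show ?thesis using r by (subst ennreal_mult[symmetric]) (auto simp del: times_divide_eq_right)
  qed
  finally show ?thesis unfolding v_def .
qed

subsection \<open>Upper bound for Borel functions\<close>

lemma product_sigma_finite_lborel:
  "product_sigma_finite (\<lambda>_::'i. lborel :: 'a::euclidean_space measure)"
  by standard

lemma indicator_ball_eq: "indicator (ball a r) b = (if dist a b < r then 1 else 0 :: ennreal)"
  by (auto simp: indicator_def)

lemma nn_integral_prod_ball:
  fixes a :: "'a::euclidean_space"
  assumes "finite J" "0 < r"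
  shows "(\<integral>\<^sup>+Y. (\<Prod>j\<in>J. indicator (ball a r) (Y j)) \<partial>PiM J (\<lambda>_. lborel))
    = ennreal (unit_ball_vol DIM('a) * r ^ DIM('a)) ^ card J"
proof -
  interpret product_sigma_finite "\<lambda>_. lborel :: 'a measure" by (rule product_sigma_finite_lborel)
  show ?thesis
    using assms by (subst product_nn_integral_prod) (auto simp: emeasure_ball)
qed

text \<open>For a fixed difference y = X i - X k the argument of \<open>G\<close> is a translate of
  \<open>X k\<close>, and \<open>X k\<close> ranges over the whole space; integrating in
  \<open>X k\<close> before y removes both \<open>t\<close> and y. A substitution in
  \<open>X i\<close> would instead produce a Jacobian that degenerates as t tends to 0.\<close>

lemma nn_integral_cluster:
  fixes G :: "'a::euclidean_space \<Rightarrow> ennreal" and i k :: 'i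
  assumes Gm [measurable]: "G \<in> borel_measurable borel" and J: "finite J" "k \<notin> J" "i \<in> insert k J" and r: "0 < r"
  shows "(\<integral>\<^sup>+X. (\<Prod>j\<in>J. indicator (ball (X k) r) (X j)) * G (X k + t *\<^sub>R (X i - X k)) \<partial>PiM (insert k J) (\<lambda>_. lborel))
    = ennreal (unit_ball_vol DIM('a) * r ^ DIM('a)) ^ card J * (\<integral>\<^sup>+x. G x \<partial>lborel)"
proof -
  interpret product_sigma_finite "\<lambda>_. lborel :: 'a measure" by (rule product_sigma_finite_lborel)
  let ?v = "ennreal (unit_ball_vol DIM('a) * r ^ DIM('a))"
  have [measurable]: "(\<lambda>X. X j) \<in> borel_measurable (PiM (insert k J) (\<lambda>_. lborel))" if "j \<in> insert k J" for j
    using that measurable_component_singleton[of j "insert k J" "\<lambda>_. lborel :: 'a measure"] by simp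
  have meas: "(\<lambda>X. (\<Prod>j\<in>J. indicator (ball (X k) r) (X j)) * G (X k + t *\<^sub>R (X i - X k))) \<in> borel_measurable (PiM (insert k J) (\<lambda>_. lborel))"
    unfolding indicator_ball_eq using J(3) by measurable
  have "(\<integral>\<^sup>+X. (\<Prod>j\<in>J. indicator (ball (X k) r) (X j)) * G (X k + t *\<^sub>R (X i - X k)) \<partial>PiM (insert k J) (\<lambda>_. lborel))
    = (\<integral>\<^sup>+x. (\<integral>\<^sup>+Y. (\<Prod>j\<in>J. indicator (ball x r) (Y j)) * G (x + t *\<^sub>R ((Y(k := x)) i - x)) \<partial>PiM J (\<lambda>_. lborel)) \<partial>lborel)"
    by (subst product_nn_integral_insert_rev[OF J(1,2) meas], intro nn_integral_cong)
      (use J in \<open>auto intro!: arg_cong2[where f="(*)"] prod.cong\<close>)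
  also have "\<dots> = ?v ^ card J * (\<integral>\<^sup>+x. G x \<partial>lborel)"
  proof (cases "i = k")
    case True
    have "(\<integral>\<^sup>+Y. (\<Prod>j\<in>J. indicator (ball x r) (Y j)) * G (x + t *\<^sub>R ((Y(k := x)) i - x)) \<partial>PiM J (\<lambda>_. lborel)) = ?v ^ card J * G x" for x
    proof -
      have [measurable]: "(\<lambda>X. X j) \<in> borel_measurable (PiM J (\<lambda>_. lborel :: 'a measure))" if "j \<in> J" for j
        using that measurable_component_singleton[of j J "\<lambda>_. lborel :: 'a measure"] by simp
      have "(\<lambda>Y. \<Prod>j\<in>J. indicator (ball x r) (Y j) :: ennreal) \<in> borel_measurable (PiM J (\<lambda>_. lborel))"
        unfolding indicator_ball_eq by measurable
      thus ?thesis
        using True J r by (simp add: nn_integral_multc nn_integral_prod_ball)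
    qed
    thus ?thesis by (simp add: nn_integral_cmult)
  next
    case False
    define J' where "J' = J - {i}"
    have J': "finite J'" "i \<notin> J'" "J = insert i J'" using J False by (auto simp: J'_def)
    have inner: "(\<integral>\<^sup>+Y. (\<Prod>j\<in>J. indicator (ball x r) (Y j)) * G (x + t *\<^sub>R ((Y(k := x)) i - x)) \<partial>PiM J (\<lambda>_. lborel))
        = (\<integral>\<^sup>+y. ?v ^ card J' * (indicator (ball 0 r) y * G (x + t *\<^sub>R y)) \<partial>lborel)" for x
    proof -
      have [measurable]: "(\<lambda>X. X j) \<in> borel_measurable (PiM J (\<lambda>_. lborel :: 'a measure))" if "j \<in> J" for j
        using that measurable_component_singleton[of j J "\<lambda>_. lborel :: 'a measure"] by simp
      have [measurable]: "(\<lambda>X. X j) \<in> borel_measurable (PiM J' (\<lambda>_. lborel :: 'a measure))" if "j \<in> J'" for j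
        using that measurable_component_singleton[of j J' "\<lambda>_. lborel :: 'a measure"] by simp
      have iJ: "i \<in> J" using J' by simp
      have m1: "(\<lambda>Y. (\<Prod>j\<in>J. indicator (ball x r) (Y j)) * G (x + t *\<^sub>R (Y i - x))) \<in> borel_measurable (PiM J (\<lambda>_. lborel))"
        unfolding indicator_ball_eq using iJ by measurable
      have m2: "(\<lambda>Y. \<Prod>j\<in>J'. indicator (ball x r) (Y j) :: ennreal) \<in> borel_measurable (PiM J' (\<lambda>_. lborel))"
        unfolding indicator_ball_eq by measurable
      have "(\<integral>\<^sup>+Y. (\<Prod>j\<in>J. indicator (ball x r) (Y j)) * G (x + t *\<^sub>R ((Y(k := x)) i - x)) \<partial>PiM J (\<lambda>_. lborel))
        = (\<integral>\<^sup>+Y. (\<Prod>j\<in>insert i J'. indicator (ball x r) (Y j)) * G (x + t *\<^sub>R (Y i - x)) \<partial>PiM (insert i J') (\<lambda>_. lborel))"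
        using False J'(3) by simp
      also have "\<dots> = (\<integral>\<^sup>+y. (\<integral>\<^sup>+Y. (\<Prod>j\<in>J'. indicator (ball x r) (Y j)) * (indicator (ball x r) y * G (x + t *\<^sub>R (y - x))) \<partial>PiM J' (\<lambda>_. lborel)) \<partial>lborel)"
      proof (subst product_nn_integral_insert_rev[OF J'(1,2) m1[unfolded J'(3)]], intro nn_integral_cong)
        fix y Y
        have "(\<Prod>j\<in>J'. indicator (ball x r) ((Y(i := y)) j)) = (\<Prod>j\<in>J'. indicator (ball x r) (Y j) :: ennreal)"
          using J' by (intro prod.cong) auto
        thus "(\<Prod>j\<in>insert i J'. indicator (ball x r) ((Y(i := y)) j)) * G (x + t *\<^sub>R ((Y(i := y)) i - x))
          = (\<Prod>j\<in>J'. indicator (ball x r) (Y j)) * (indicator (ball x r) y * G (x + t *\<^sub>R (y - x)))"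
          using J' by (simp add: mult_ac)
      qed
      also have "\<dots> = (\<integral>\<^sup>+y. ?v ^ card J' * (indicator (ball x r) y * G (x + t *\<^sub>R (y - x))) \<partial>lborel)"
        using nn_integral_prod_ball[OF J'(1) r, of x] by (simp add: nn_integral_multc[OF m2])
      also have "\<dots> = (\<integral>\<^sup>+y. ?v ^ card J' * (indicator (ball x r) (x + y) * G (x + t *\<^sub>R ((x + y) - x))) \<partial>lborel)"
        by (rule nn_integral_lborel_translate[symmetric]) measurable
      also have "\<dots> = (\<integral>\<^sup>+y. ?v ^ card J' * (indicator (ball 0 r) y * G (x + t *\<^sub>R y)) \<partial>lborel)"
        by (simp add: indicator_ball_eq dist_norm)
      finally show ?thesis .
    qed
    have "(\<integral>\<^sup>+x. (\<integral>\<^sup>+y. ?v ^ card J' * (indicator (ball 0 r) y * G (x + t *\<^sub>R y)) \<partial>lborel) \<partial>lborel)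
        = (\<integral>\<^sup>+y. (\<integral>\<^sup>+x. ?v ^ card J' * (indicator (ball 0 r) y * G (x + t *\<^sub>R y)) \<partial>lborel) \<partial>lborel)"
      by (rule lborel_pair.Fubini'[symmetric]) measurable
    also have "\<dots> = (\<integral>\<^sup>+y. (?v ^ card J' * (\<integral>\<^sup>+x. G x \<partial>lborel)) * indicator (ball 0 r) (y::'a) \<partial>lborel)"
    proof (intro nn_integral_cong)
      fix y :: 'a
      have "(\<integral>\<^sup>+x. G (x + t *\<^sub>R y) \<partial>lborel) = (\<integral>\<^sup>+x. G x \<partial>lborel)"
        using nn_integral_lborel_translate[OF Gm, of "t *\<^sub>R y"] by (simp add: add.commute)
      moreover have "(\<integral>\<^sup>+x. ?v ^ card J' * (indicator (ball 0 r) y * G (x + t *\<^sub>R y)) \<partial>lborel)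
          = ?v ^ card J' * (indicator (ball 0 r) y * (\<integral>\<^sup>+x. G (x + t *\<^sub>R y) \<partial>lborel))"
        by (simp add: nn_integral_cmult)
      ultimately show "(\<integral>\<^sup>+x. ?v ^ card J' * (indicator (ball 0 r) y * G (x + t *\<^sub>R y)) \<partial>lborel) = (?v ^ card J' * (\<integral>\<^sup>+x. G x \<partial>lborel)) * indicator (ball 0 r) y"
        by (simp only: mult_ac)
    qed
    also have "\<dots> = (?v ^ card J' * (\<integral>\<^sup>+x. G x \<partial>lborel)) * ?v"
      using r by (subst nn_integral_cmult_indicator) (auto simp: emeasure_ball)
    finally show ?thesis unfolding inner using J' by (simp add: mult_ac)
  qed
  finally show ?thesis .
qed

lemma nn_integral_powr_tail:
  fixes a b :: real
  assumes "0 < a" "0 < b"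
  shows "(\<integral>\<^sup>+r. ennreal (b * r powr (- b - 1)) * indicator {a<..} r \<partial>lborel) = ennreal (a powr (- b))"
proof -
  have "(\<integral>\<^sup>+r. ennreal (b * r powr (- b - 1)) * indicator {a<..} r \<partial>lborel)
      = (\<integral>\<^sup>+r. ennreal (b * r powr (- b - 1)) * indicator {a..} r \<partial>lborel)"
    by (rule nn_integral_cong_AE, rule AE_mp[OF AE_lborel_singleton[of a]]) (auto simp: indicator_def)
  also have "\<dots> = ennreal (0 - (- (a powr (- b))))"
  proof (rule nn_integral_FTC_atLeast)
    show "((\<lambda>r. - (r powr (- b))) has_real_derivative b * x powr (- b - 1)) (at x)" if "a \<le> x" for x
      using that assms by (auto intro!: derivative_eq_intros)
    show "((\<lambda>r. - (r powr (- b))) \<longlongrightarrow> 0) at_top"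
      using tendsto_minus[OF tendsto_neg_powr[of "-b" "\<lambda>x. x"]] assms by (simp add: filterlim_ident)
  qed (use assms in auto)
  finally show ?thesis by simp
qed

lemma finite_diam_set: "finite {dist (x i) (x j) | i j. i \<le> (m::nat) \<and> j \<le> m}"
proof -
  have "{dist (x i) (x j) | i j. i \<le> m \<and> j \<le> m} = (\<lambda>(i, j). dist (x i) (x j)) ` ({..m} \<times> {..m})"
    by auto
  thus ?thesis by simp
qed

lemma dist_le_diam_pts: "i \<le> m \<Longrightarrow> j \<le> m \<Longrightarrow> dist (x i) (x j) \<le> diam_pts m x"
  unfolding diam_pts_def by (rule Max_ge[OF finite_diam_set]) auto

lemma diam_pts_le:
  assumes "\<And>i j. i \<le> m \<Longrightarrow> j \<le> m \<Longrightarrow> dist (x i) (x j) \<le> d"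
  shows "diam_pts m x \<le> d"
  unfolding diam_pts_def using assms by (subst Max_le_iff[OF finite_diam_set]) auto

lemma diam_pts_nonneg: "0 \<le> diam_pts m x"
  using dist_le_diam_pts[of 0 m 0 x] by simp

text \<open>The auxiliary radius is used twice: it replaces the diameter at the start, and at the
  end the integral of \<gamma> r^(-\<gamma>-1) over r > |w| yields |w|^(-\<gamma>). In
  \<open>c\<close>, the factor \<beta> comes from the first use and 1/\<gamma> from the second; n +
  2 counts the vertices, 2 the terms per vertex, and the power n + 1 the points integrated over
  balls around \<open>X 0\<close>.\<close>

lemma energy_integral_le:
  fixes f :: "'a::euclidean_space \<Rightarrow> real" and p s \<beta> :: real
  assumes f: "loc_integrable f" and fm [measurable]: "f \<in> borel_measurable borel"
    and p: "1 < p" and s: "0 < s"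
  defines "n \<equiv> DIM('a)"
  defines "\<beta> \<equiv> real (n * (n + 1)) + p * (real n + 1 + s)"
  defines "\<gamma> \<equiv> real n + (1 + s) * p"
  defines "c \<equiv> \<beta> * ((2 * unit_ball_vol n) powr p * approx_const n p) * (2 * real (n + 2) * unit_ball_vol n ^ (n + 1)) / \<gamma>"
  shows "(\<integral>\<^sup>+X. ennreal (measure lebesgue (convex hull {graph_pt f (X i) | i. i \<le> n + 1}) powr p
        / diam_pts (n + 1) X powr \<beta>) \<partial>PiM {..n + 1} (\<lambda>_. lborel))
    \<le> ennreal c * (\<integral>\<^sup>+x. (\<integral>\<^sup>+h. ennreal (\<bar>second_diff f h x\<bar> powr p / norm h powr \<gamma>) \<partial>lborel) \<partial>lborel)"
proof -
  interpret product_sigma_finite "\<lambda>_. lborel :: 'a measure" by (rule product_sigma_finite_lborel)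
  interpret fin: finite_product_sigma_finite "\<lambda>_. lborel :: 'a measure" "{..n + 1}" by standard simp
  interpret PL: pair_sigma_finite "PiM {..n + 1} (\<lambda>_. lborel :: 'a measure)" "lborel :: real measure"
    by standard
  define m where "m = n + 1"
  define J where "J = {1..m}"
  define v where "v = unit_ball_vol n"
  define c1 where "c1 = (2 * v) powr p * approx_const n p"
  have v: "0 < v" by (simp add: v_def)
  have c1: "0 \<le> c1" by (simp add: c1_def approx_const_def)
  have \<beta>: "0 < \<beta>" using p s by (auto simp: \<beta>_def intro!: add_nonneg_pos mult_pos_pos)
  have \<gamma>: "0 < \<gamma>" using p s by (auto simp: \<gamma>_def intro!: add_nonneg_pos mult_pos_pos)
  have J: "finite J" "0 \<notin> J" "{..m} = insert 0 J" "card J = n + 1"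
    by (auto simp: J_def m_def)
  let ?P = "PiM {..m} (\<lambda>_. lborel :: 'a measure)"
  let ?vol = "\<lambda>X. measure lebesgue (convex hull {graph_pt f (X i) | i. i \<le> m})"
  let ?D = "second_diff_mean f p"
  define T where "T r X i = ?D r (X i) + (\<integral>\<^sup>+t. indicator {0..1} t * ?D r (X 0 + t *\<^sub>R (X i - X 0)) \<partial>lborel)" for r and X :: "nat \<Rightarrow> 'a" and i
  define K where "K r = ennreal (\<beta> * c1 * r powr (- \<beta> - 1 + (real n * p - n)))" for r
  \<comment> \<open>Of the condition diam < r only the distances to \<open>X 0\<close> are kept:
    this weaker condition factorises over the other points.\<close>
  define ind where "ind r X = (\<Prod>j\<in>J. indicator (ball (X 0) r) (X j) :: ennreal)" for r and X :: "nat \<Rightarrow> 'a"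
  have comp: "(\<lambda>X. X i) \<in> borel_measurable ?P" if "i \<le> m" for i
    using that measurable_component_singleton[of i "{..m}" "\<lambda>_. lborel :: 'a measure"] by simp
  have comp': "(\<lambda>z. fst z i) \<in> borel_measurable (?P \<Otimes>\<^sub>M (lborel :: real measure))" if "i \<le> m" for i
    using measurable_compose[OF measurable_fst comp[OF that]] .
  have m0: "0 \<le> m" and Jm: "\<And>j. j \<in> J \<Longrightarrow> j \<le> m" by (auto simp: J_def)
  have indm [measurable]: "(\<lambda>z. ind (snd z) (fst z)) \<in> borel_measurable (?P \<Otimes>\<^sub>M lborel)"
    unfolding ind_def indicator_ball_eq
  proof (rule borel_measurable_prod_ennreal)
    fix j assume "j \<in> J"
    note [measurable] = comp'[OF m0] comp'[OF Jm[OF this]]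
    show "(\<lambda>z. if dist (fst z 0) (fst z j) < snd z then 1 else 0 :: ennreal) \<in> borel_measurable (?P \<Otimes>\<^sub>M lborel)"
      by measurable
  qed
  have Tm: "(\<lambda>z. T (snd z) (fst z) i) \<in> borel_measurable (?P \<Otimes>\<^sub>M lborel)" if i: "i \<le> m" for i
  proof -
    note [measurable] = comp'[OF m0] comp'[OF i]
    show ?thesis unfolding T_def by measurable
  qed
  have pointwise: "ennreal (?vol X powr p / diam_pts m X powr \<beta>)
      \<le> (\<integral>\<^sup>+r. indicator {0<..} r * K r * (ind r X * (\<Sum>i\<le>m. T r X i)) \<partial>lborel)" for X :: "nat \<Rightarrow> 'a"
  \<comment> \<open>If all points coincide, the denominator is \<open>0 powr \<beta> = 0\<close> and
    the quotient is 0 by convention.\<close>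
  proof (cases "diam_pts m X = 0")
    case False
    let ?d = "diam_pts m X"
    have d: "0 < ?d" using False diam_pts_nonneg[of m X] by simp
    have "ennreal (?vol X powr p / ?d powr \<beta>) = ennreal (?d powr - \<beta>) * ennreal (?vol X powr p)"
      using d by (simp add: powr_minus divide_inverse ennreal_mult[symmetric] mult.commute)
    also have "\<dots> = (\<integral>\<^sup>+r. (ennreal (\<beta> * r powr (- \<beta> - 1)) * indicator {?d<..} r) * ennreal (?vol X powr p) \<partial>lborel)"
      by (subst nn_integral_multc) (auto simp: nn_integral_powr_tail[OF d \<beta>])
    also have "\<dots> \<le> (\<integral>\<^sup>+r. indicator {0<..} r * K r * (ind r X * (\<Sum>i\<le>m. T r X i)) \<partial>lborel)"
    proof (rule nn_integral_mono)
      fix r :: real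
      show "(ennreal (\<beta> * r powr (- \<beta> - 1)) * indicator {?d<..} r) * ennreal (?vol X powr p)
        \<le> indicator {0<..} r * K r * (ind r X * (\<Sum>i\<le>m. T r X i))"
      proof (cases "?d < r")
        case True
        have r: "0 < r" using True d by simp
        have near: "dist (X 0) (X i) < r" if "i \<le> m" for i
          using dist_le_diam_pts[of 0 m i X] that True by simp
        have "ind r X = 1"
          unfolding ind_def indicator_ball_eq using near by (intro prod.neutral) (auto simp: J_def)
        moreover have "ennreal (?vol X powr p) \<le> ennreal (c1 * r powr (real n * p - n)) * (\<Sum>i\<le>m. T r X i)"
          using graph_simplex_volume_powr_le[OF f fm r p, where X=X and m=m] near
          by (simp add: T_def c1_def v_def n_def)
        hence "ennreal (\<beta> * r powr (- \<beta> - 1)) * ennreal (?vol X powr p)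
          \<le> ennreal (\<beta> * r powr (- \<beta> - 1)) * (ennreal (c1 * r powr (real n * p - n)) * (\<Sum>i\<le>m. T r X i))"
          by (intro mult_left_mono) auto
        moreover have "ennreal (\<beta> * r powr (- \<beta> - 1)) * ennreal (c1 * r powr (real n * p - n)) = K r"
          unfolding K_def using \<beta> c1 r by (subst ennreal_mult[symmetric]) (auto simp: powr_add)
        ultimately show ?thesis using True r by (simp add: mult.assoc[symmetric])
      qed simp
    qed
    finally show ?thesis .
  qed simp
  have inner: "(\<integral>\<^sup>+X. ind r X * (\<Sum>i\<le>m. T r X i) \<partial>?P)
      = ennreal (2 * real (n + 2) * v ^ (n + 1) * r powr real (n * (n + 1))) * (\<integral>\<^sup>+x. ?D r x \<partial>lborel)" if r: "0 < r" for r
  proof -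
    have ir [measurable]: "ind r \<in> borel_measurable ?P"
      using measurable_compose[OF measurable_Pair[OF measurable_ident measurable_const[of r]] indm] by simp
    have [measurable]: "?D r \<in> borel_measurable borel" by measurable
    define V where "V = ennreal (v * r ^ n) ^ (n + 1) * (\<integral>\<^sup>+x. ?D r x \<partial>lborel)"
    have cl: "(\<integral>\<^sup>+X. ind r X * ?D r (X 0 + t *\<^sub>R (X i - X 0)) \<partial>?P) = V" if "i \<le> m" for i t
    proof -
      have "i \<in> insert 0 J" using that J(3) by auto
      from nn_integral_cluster[OF _ J(1,2) this r, of "?D r" t, folded J(3)]
      show ?thesis unfolding ind_def V_def v_def n_def J(4) by simp
    qed
    have Ti: "(\<integral>\<^sup>+X. ind r X * T r X i \<partial>?P) = 2 * V" if i: "i \<le> m" for i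
    proof -
      note [measurable] = comp[OF i] comp[OF m0] comp'[OF m0] comp'[OF i]
      have [measurable]: "(\<lambda>z. ind r (fst z)) \<in> borel_measurable (?P \<Otimes>\<^sub>M lborel)"
        by (rule measurable_compose[OF measurable_fst]) measurable
      have "(\<integral>\<^sup>+X. ind r X * T r X i \<partial>?P) = (\<integral>\<^sup>+X. ind r X * ?D r (X i) \<partial>?P)
          + (\<integral>\<^sup>+X. ind r X * (\<integral>\<^sup>+t. indicator {0..1} t * ?D r (X 0 + t *\<^sub>R (X i - X 0)) \<partial>lborel) \<partial>?P)"
        unfolding T_def distrib_left by (rule nn_integral_add) measurable
      also have "(\<integral>\<^sup>+X. ind r X * (\<integral>\<^sup>+t. indicator {0..1} t * ?D r (X 0 + t *\<^sub>R (X i - X 0)) \<partial>lborel) \<partial>?P)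
        = (\<integral>\<^sup>+X. (\<integral>\<^sup>+t. ind r X * (indicator {0..1} t * ?D r (X 0 + t *\<^sub>R (X i - X 0))) \<partial>lborel) \<partial>?P)"
        by (intro nn_integral_cong nn_integral_cmult[symmetric]) measurable
      also have "\<dots> = (\<integral>\<^sup>+t. (\<integral>\<^sup>+X. ind r X * (indicator {0..1} t * ?D r (X 0 + t *\<^sub>R (X i - X 0))) \<partial>?P) \<partial>lborel)"
        by (rule PL.Fubini'[folded m_def, symmetric]) measurable
      also have "\<dots> = (\<integral>\<^sup>+t. V * indicator {0..1::real} t \<partial>lborel)"
      proof (rule nn_integral_cong)
        fix t :: real
        have "(\<integral>\<^sup>+X. ind r X * (indicator {0..1} t * ?D r (X 0 + t *\<^sub>R (X i - X 0))) \<partial>?P)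
          = (\<integral>\<^sup>+X. indicator {0..1} t * (ind r X * ?D r (X 0 + t *\<^sub>R (X i - X 0))) \<partial>?P)"
          by (simp add: mult_ac)
        also have "\<dots> = indicator {0..1} t * V"
          by (subst nn_integral_cmult) (auto simp: cl[OF i])
        finally show "(\<integral>\<^sup>+X. ind r X * (indicator {0..1} t * ?D r (X 0 + t *\<^sub>R (X i - X 0))) \<partial>?P) = V * indicator {0..1} t"
          by (simp add: mult.commute)
      qed
      also have "\<dots> = V" by (subst nn_integral_cmult_indicator) auto
      \<comment> \<open>At t = 1 the point of the segment is \<open>X i\<close> itself.\<close>
      also have "(\<integral>\<^sup>+X. ind r X * ?D r (X i) \<partial>?P) = V"
        using cl[OF i, of 1] by simp
      finally show ?thesis by (simp add: mult_2)
    qed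
    have Tmr: "(\<lambda>X. T r X i) \<in> borel_measurable ?P" if "i \<le> m" for i
      using measurable_compose[OF measurable_Pair[OF measurable_ident measurable_const[of r]] Tm[OF that]] by simp
    have "(\<integral>\<^sup>+X. ind r X * (\<Sum>i\<le>m. T r X i) \<partial>?P) = (\<Sum>i\<le>m. (\<integral>\<^sup>+X. ind r X * T r X i \<partial>?P))"
      unfolding sum_distrib_left by (intro nn_integral_sum borel_measurable_times_ennreal ir Tmr) simp
    also have "\<dots> = of_nat (n + 2) * (2 * V)"
      using Ti by (simp add: m_def)
    also have "\<dots> = ennreal (2 * real (n + 2) * v ^ (n + 1) * r powr real (n * (n + 1))) * (\<integral>\<^sup>+x. ?D r x \<partial>lborel)"
    proof -
      have "of_nat (n + 2) * (2 * ennreal (v * r ^ n) ^ (n + 1)) = ennreal (real (n + 2)) * (ennreal 2 * ennreal ((v * r ^ n) ^ (n + 1)))"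
        using v r by (subst ennreal_power) (simp_all only: ennreal_of_nat_eq_real_of_nat ennreal_numeral, simp)
      also have "\<dots> = ennreal (real (n + 2) * (2 * (v * r ^ n) ^ (n + 1)))"
      proof -
        have w: "0 \<le> (v * r ^ n) ^ (n + 1)" using v r by simp
        show ?thesis
          using ennreal_mult[OF _ w, of 2] ennreal_mult[of "real (n + 2)" "2 * (v * r ^ n) ^ (n + 1)"] w by simp
      qed
      also have "real (n + 2) * (2 * (v * r ^ n) ^ (n + 1)) = 2 * real (n + 2) * v ^ (n + 1) * r powr real (n * (n + 1))"
        using r by (subst powr_realpow) (simp_all only: power_mult_distrib power_mult mult_ac)
      finally show ?thesis unfolding V_def by (simp only: mult.assoc[symmetric])
    qed
    finally show ?thesis .
  qed
  define c2 where "c2 = \<beta> * c1 * (2 * real (n + 2) * v ^ (n + 1))"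
  have c2: "0 \<le> c2" using \<beta> c1 v by (simp add: c2_def)
  have "(\<integral>\<^sup>+X. ennreal (?vol X powr p / diam_pts m X powr \<beta>) \<partial>?P)
    \<le> (\<integral>\<^sup>+X. (\<integral>\<^sup>+r. indicator {0<..} r * K r * (ind r X * (\<Sum>i\<le>m. T r X i)) \<partial>lborel) \<partial>?P)"
    by (intro nn_integral_mono pointwise)
  also have "\<dots> = (\<integral>\<^sup>+r. (\<integral>\<^sup>+X. indicator {0<..} r * K r * (ind r X * (\<Sum>i\<le>m. T r X i)) \<partial>?P) \<partial>lborel)"
  proof (rule PL.Fubini'[folded m_def, symmetric])
    have [measurable]: "(\<lambda>z. \<Sum>i\<le>m. T (snd z) (fst z) i) \<in> borel_measurable (?P \<Otimes>\<^sub>M lborel)"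
      by (rule borel_measurable_sum) (auto intro: Tm)
    have "(\<lambda>z. indicator {0<..} (snd z) * K (snd z) * (ind (snd z) (fst z) * (\<Sum>i\<le>m. T (snd z) (fst z) i))) \<in> borel_measurable (?P \<Otimes>\<^sub>M lborel)"
      unfolding K_def by measurable
    thus "(\<lambda>(X, r). indicator {0<..} r * K r * (ind r X * (\<Sum>i\<le>m. T r X i))) \<in> borel_measurable (?P \<Otimes>\<^sub>M lborel)"
      by (simp add: split_beta')
  qed
  also have "\<dots> = (\<integral>\<^sup>+r. ennreal (c2 * r powr (- \<gamma> - 1)) * indicator {0<..} r * (\<integral>\<^sup>+x. ?D r x \<partial>lborel) \<partial>lborel)"
  proof (rule nn_integral_cong)
    fix r :: real
    show "(\<integral>\<^sup>+X. indicator {0<..} r * K r * (ind r X * (\<Sum>i\<le>m. T r X i)) \<partial>?P)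
      = ennreal (c2 * r powr (- \<gamma> - 1)) * indicator {0<..} r * (\<integral>\<^sup>+x. ?D r x \<partial>lborel)"
    proof (cases "0 < r")
      case True
      have [measurable]: "(\<lambda>X. \<Sum>i\<le>m. T r X i) \<in> borel_measurable ?P"
      proof (rule borel_measurable_sum)
        fix i assume "i \<in> {..m}"
        hence "i \<le> m" by simp
        thus "(\<lambda>X. T r X i) \<in> borel_measurable ?P"
          using measurable_compose[OF measurable_Pair[OF measurable_ident measurable_const[of r]] Tm] by simp
      qed
      have [measurable]: "ind r \<in> borel_measurable ?P"
        using measurable_compose[OF measurable_Pair[OF measurable_ident measurable_const[of r]] indm] by simp
      have "(\<integral>\<^sup>+X. indicator {0<..} r * K r * (ind r X * (\<Sum>i\<le>m. T r X i)) \<partial>?P) = K r * (\<integral>\<^sup>+X. ind r X * (\<Sum>i\<le>m. T r X i) \<partial>?P)"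
        using True by (simp add: nn_integral_cmult)
      also have "\<dots> = (K r * ennreal (2 * real (n + 2) * v ^ (n + 1) * r powr real (n * (n + 1)))) * (\<integral>\<^sup>+x. ?D r x \<partial>lborel)"
        unfolding inner[OF True] by (simp only: mult.assoc)
      also have "K r * ennreal (2 * real (n + 2) * v ^ (n + 1) * r powr real (n * (n + 1))) = ennreal (c2 * r powr (- \<gamma> - 1))"
      proof -
        \<comment> \<open>The radial density contributes -\<beta> - 1, the simplex volume np - n,
          and the n + 1 balls n(n + 1); this balance is where the value of q enters.\<close>
        have "- \<gamma> - 1 = (- \<beta> - 1 + (real n * p - n)) + real (n * (n + 1))"
          by (simp add: \<gamma>_def \<beta>_def algebra_simps)
        hence "r powr (- \<gamma> - 1) = r powr (- \<beta> - 1 + (real n * p - n)) * r powr real (n * (n + 1))"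
          by (simp only: powr_add)
        thus ?thesis
          unfolding K_def c2_def using \<beta> c1 v
          by (subst ennreal_mult[symmetric]) (auto simp: mult_ac)
      qed
      finally show ?thesis using True by simp
    qed simp
  qed
  also have "\<dots> = (\<integral>\<^sup>+r. (\<integral>\<^sup>+x. (\<integral>\<^sup>+w. ennreal (c2 * r powr (- \<gamma> - 1)) * indicator {0<..} r
      * (ennreal (\<bar>second_diff f w x\<bar> powr p) * indicator (ball 0 r) w) \<partial>lborel) \<partial>lborel) \<partial>lborel)"
    unfolding second_diff_mean_def
    by (intro nn_integral_cong, subst nn_integral_cmult[symmetric], measurable,
        intro nn_integral_cong, subst nn_integral_cmult) auto
  also have "\<dots> = (\<integral>\<^sup>+x. (\<integral>\<^sup>+r. (\<integral>\<^sup>+w. ennreal (c2 * r powr (- \<gamma> - 1)) * indicator {0<..} r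
      * (ennreal (\<bar>second_diff f w x\<bar> powr p) * indicator (ball 0 r) w) \<partial>lborel) \<partial>lborel) \<partial>lborel)"
    unfolding indicator_ball_eq by (rule lborel_pair.Fubini') measurable
  also have "\<dots> = (\<integral>\<^sup>+x. (\<integral>\<^sup>+w. (\<integral>\<^sup>+r. ennreal (c2 * r powr (- \<gamma> - 1)) * indicator {0<..} r
      * (ennreal (\<bar>second_diff f w x\<bar> powr p) * indicator (ball 0 r) w) \<partial>lborel) \<partial>lborel) \<partial>lborel)"
    unfolding indicator_ball_eq by (rule nn_integral_cong, rule lborel_pair.Fubini') measurable
  also have "\<dots> = (\<integral>\<^sup>+x. (\<integral>\<^sup>+w. ennreal (c2 / \<gamma>) * ennreal (\<bar>second_diff f w x\<bar> powr p / norm w powr \<gamma>) \<partial>lborel) \<partial>lborel)"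
  proof (intro nn_integral_cong)
    fix x w :: 'a
    show "(\<integral>\<^sup>+r. ennreal (c2 * r powr (- \<gamma> - 1)) * indicator {0<..} r
      * (ennreal (\<bar>second_diff f w x\<bar> powr p) * indicator (ball 0 r) w) \<partial>lborel)
      = ennreal (c2 / \<gamma>) * ennreal (\<bar>second_diff f w x\<bar> powr p / norm w powr \<gamma>)"
    \<comment> \<open>At w = 0 the second difference is 0, so both sides vanish.\<close>
    proof (cases "w = 0")
      case True
      thus ?thesis by (simp add: second_diff_def)
    next
      case False
      let ?s = "ennreal (\<bar>second_diff f w x\<bar> powr p)"
      have "(\<integral>\<^sup>+r. ennreal (c2 * r powr (- \<gamma> - 1)) * indicator {0<..} r * (?s * indicator (ball 0 r) w) \<partial>lborel)
        = (\<integral>\<^sup>+r. (ennreal (c2 / \<gamma>) * ?s) * (ennreal (\<gamma> * r powr (- \<gamma> - 1)) * indicator {norm w<..} r) \<partial>lborel)"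
      proof (rule nn_integral_cong)
        fix r :: real
        have e1: "ennreal (c2 * r powr (- \<gamma> - 1)) = ennreal (c2 / \<gamma>) * ennreal (\<gamma> * r powr (- \<gamma> - 1))"
          using \<gamma> c2 by (subst ennreal_mult[symmetric]) auto
        have e2: "indicator {0<..} r * indicator (ball 0 r) w = (indicator {norm w<..} r :: ennreal)"
          using less_le_trans[OF le_less_trans[OF norm_ge_zero[of w]]] by (auto simp: indicator_def)
        have "ennreal (c2 * r powr (- \<gamma> - 1)) * indicator {0<..} r * (?s * indicator (ball 0 r) w)
          = ennreal (c2 * r powr (- \<gamma> - 1)) * ?s * (indicator {0<..} r * indicator (ball 0 r) w)"
          by (simp only: mult_ac)
        thus "ennreal (c2 * r powr (- \<gamma> - 1)) * indicator {0<..} r * (?s * indicator (ball 0 r) w)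
          = (ennreal (c2 / \<gamma>) * ?s) * (ennreal (\<gamma> * r powr (- \<gamma> - 1)) * indicator {norm w<..} r)"
          unfolding e1 e2 by (simp only: mult_ac)
      qed
      also have "\<dots> = (ennreal (c2 / \<gamma>) * ?s) * ennreal (norm w powr (- \<gamma>))"
        using False \<gamma> by (subst nn_integral_cmult) (auto simp: nn_integral_powr_tail)
      also have "\<dots> = ennreal (c2 / \<gamma>) * ennreal (\<bar>second_diff f w x\<bar> powr p / norm w powr \<gamma>)"
        by (simp add: mult.assoc ennreal_mult[symmetric] powr_minus divide_inverse)
      finally show ?thesis .
    qed
  qed
  also have "\<dots> = (\<integral>\<^sup>+x. ennreal (c2 / \<gamma>) * (\<integral>\<^sup>+h. ennreal (\<bar>second_diff f h x\<bar> powr p / norm h powr \<gamma>) \<partial>lborel) \<partial>lborel)"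
    by (rule nn_integral_cong, rule nn_integral_cmult) measurable
  also have "\<dots> = ennreal (c2 / \<gamma>) * (\<integral>\<^sup>+x. (\<integral>\<^sup>+h. ennreal (\<bar>second_diff f h x\<bar> powr p / norm h powr \<gamma>) \<partial>lborel) \<partial>lborel)"
    by (rule nn_integral_cmult) measurable
  also have "c2 / \<gamma> = c"
    by (simp add: c2_def c_def c1_def v_def)
  finally show ?thesis by (simp add: m_def)
qed

text \<open>|f| exceeds a large \<open>k\<close> only on a small part of the ball of radius 2\<rho>.
  Hence for each x in the ball of radius \<rho>, increments h filling at least half the volume of
  that ball have both x + h and x - h outside the exceptional set, and for them |f x| is at most k
  plus the absolute second difference. Integration over these h bounds |f x| by a constant plus a
  multiple of the inner integral of the seminorm, which has a finite integral in x.\<close>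

lemma loc_integrable_if_seminorm_finite:
  fixes f :: "'a::euclidean_space \<Rightarrow> real"
  assumes fm [measurable]: "f \<in> borel_measurable borel" and p: "1 < p" and \<gamma>: "0 < \<gamma>"
    and fin: "(\<integral>\<^sup>+x. (\<integral>\<^sup>+h. ennreal (\<bar>second_diff f h x\<bar> powr p / norm h powr \<gamma>) \<partial>lborel) \<partial>lborel) < \<infinity>"
  shows "loc_integrable f"
proof -
  have ball_fin: "(\<integral>\<^sup>+x. ennreal \<bar>f x\<bar> * indicator (ball 0 \<rho>) x \<partial>lborel) < \<infinity>" if \<rho>: "0 < \<rho>" for \<rho>
  proof -
    define V where "V = measure lborel (ball (0::'a) \<rho>)"
    have Vr: "V = unit_ball_vol DIM('a) * \<rho> ^ DIM('a)"
      using \<rho> by (simp add: V_def content_ball)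
    have V: "0 < V" using \<rho> by (simp add: Vr)
    have eV: "emeasure lborel (ball (0::'a) \<rho>) = ennreal V"
      using \<rho> by (simp add: emeasure_ball Vr)
    define A where "A k = {y \<in> ball (0::'a) (2 * \<rho>). real k < \<bar>f y\<bar>}" for k :: nat
    have Am [measurable]: "A k \<in> sets borel" for k
      unfolding A_def by measurable
    have "(\<lambda>k. emeasure lborel (A k)) \<longlonglongrightarrow> emeasure lborel (\<Inter>k. A k)"
    proof (rule Lim_emeasure_decseq)
      show "decseq A" by (auto simp: decseq_def A_def)
      show "emeasure lborel (A k) \<noteq> \<infinity>" for k
      proof -
        have "emeasure lborel (A k) \<le> emeasure lborel (ball (0::'a) (2 * \<rho>))"
          by (intro emeasure_mono) (auto simp: A_def)
        also have "\<dots> < \<infinity>" by (rule emeasure_lborel_ball_finite)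
        finally show ?thesis by simp
      qed
    qed auto
    moreover have "(\<Inter>k. A k) = {}"
    proof -
      have "y \<notin> A (nat \<lceil>\<bar>f y\<bar>\<rceil>)" for y
        unfolding A_def by (simp add: of_nat_ceiling leD)
      thus ?thesis by blast
    qed
    ultimately have "(\<lambda>k. emeasure lborel (A k)) \<longlonglongrightarrow> 0" by simp
    \<comment> \<open>A loss of V/4 for each of x + h and x - h leaves a set of measure at least
      V/2.\<close>
    hence "\<forall>\<^sub>F k in sequentially. emeasure lborel (A k) < ennreal (V / 4)"
      using V by (intro order_tendstoD) auto
    then obtain k where k: "emeasure lborel (A k) < ennreal (V / 4)"
      by (auto simp: eventually_sequentially)
    have main: "ennreal (V / 2) * (ennreal \<bar>f x\<bar> * indicator (ball 0 \<rho>) x)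
      \<le> ennreal ((real k + 1) * V) * indicator (ball 0 \<rho>) x + ennreal (\<rho> powr \<gamma>) * (\<integral>\<^sup>+h. ennreal (\<bar>second_diff f h x\<bar> powr p / norm h powr \<gamma>) \<partial>lborel)" for x
    proof (cases "x \<in> ball 0 \<rho>")
      case True
      let ?b1 = "(\<lambda>h. x + h) -` A k" and ?b2 = "(\<lambda>h. x - h) -` A k"
      have m [measurable]: "?b1 \<in> sets borel" "?b2 \<in> sets borel"
        using measurable_sets[of "\<lambda>h. x + h" borel borel "A k"] measurable_sets[of "\<lambda>h. x - h" borel borel "A k"] by auto
      have e1: "emeasure lborel ?b1 < ennreal (V / 4)"
        using k by (simp add: emeasure_lborel_translate)
      have "emeasure lborel ?b2 = emeasure (distr lborel borel uminus) ((\<lambda>h. x + h) -` A k)"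
        by (subst emeasure_distr) (auto simp: vimage_def intro!: arg_cong[where f="emeasure lborel"])
      hence e2: "emeasure lborel ?b2 < ennreal (V / 4)"
        using e1 by (simp add: lborel_distr_uminus_euclidean)
      define G where "G = ball 0 \<rho> - ?b1 - ?b2"
      have Gm [measurable]: "G \<in> sets borel" unfolding G_def by measurable
      have "ennreal V \<le> emeasure lborel (G \<union> (?b1 \<union> ?b2))"
        unfolding eV[symmetric]
      proof (rule emeasure_mono)
        show "ball 0 \<rho> \<subseteq> G \<union> (?b1 \<union> ?b2)" by (auto simp: G_def)
        show "G \<union> (?b1 \<union> ?b2) \<in> sets lborel" using Gm m by auto
      qed
      also have "\<dots> \<le> emeasure lborel G + (emeasure lborel ?b1 + emeasure lborel ?b2)"
        using m Gm by (intro order_trans[OF emeasure_subadditive] add_left_mono emeasure_subadditive) auto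
      also have "\<dots> \<le> emeasure lborel G + (ennreal (V / 4) + ennreal (V / 4))"
        using e1 e2 by (intro add_left_mono add_mono) auto
      also have "ennreal (V / 4) + ennreal (V / 4) = ennreal (V / 2)"
        using V by (subst ennreal_plus[symmetric]) auto
      finally have VG: "ennreal V \<le> emeasure lborel G + ennreal (V / 2)" .
      have "emeasure lborel G \<le> ennreal V"
        unfolding eV[symmetric] by (intro emeasure_mono) (auto simp: G_def)
      then obtain g where g: "emeasure lborel G = ennreal g" "0 \<le> g"
        by (cases "emeasure lborel G") (auto simp: top_unique)
      have G2: "ennreal (V / 2) \<le> emeasure lborel G"
        using VG V g by (simp add: ennreal_plus[symmetric] del: ennreal_plus)
      have bound: "ennreal \<bar>f x\<bar> * indicator G h
        \<le> ennreal (real k + 1) * indicator (ball 0 \<rho>) h + ennreal (\<rho> powr \<gamma>) * ennreal (\<bar>second_diff f h x\<bar> powr p / norm h powr \<gamma>)" for h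
      proof (cases "h \<in> G")
        case hG: True
        hence h: "norm h < \<rho>" by (auto simp: G_def)
        have "norm (x + h) < 2 * \<rho>" "norm (x - h) < 2 * \<rho>"
          using norm_triangle_ineq[of x h] norm_triangle_ineq4[of x h] h True by auto
        hence "\<bar>f (x + h)\<bar> \<le> k" "\<bar>f (x - h)\<bar> \<le> k"
          using hG by (auto simp: G_def A_def)
        hence 1: "\<bar>f x\<bar> \<le> real k + \<bar>second_diff f h x\<bar>"
          unfolding second_diff_def by linarith
        let ?s = "\<bar>second_diff f h x\<bar>"
        \<comment> \<open>The parameter 1 in \<open>young_scaled\<close>: the added constant is
          harmless on a ball.\<close>
        have "?s \<le> ?s powr p + 1"
          using young_scaled[of 1 ?s p] p by simp
        moreover have "?s powr p \<le> \<rho> powr \<gamma> * (?s powr p / norm h powr \<gamma>)"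
        proof (cases "h = 0")
          case True thus ?thesis by (simp add: second_diff_def)
        next
          case False
          have "norm h powr \<gamma> \<le> \<rho> powr \<gamma>" using h \<gamma> by (intro powr_mono2) auto
          hence "?s powr p * norm h powr \<gamma> \<le> ?s powr p * \<rho> powr \<gamma>" by (intro mult_left_mono) auto
          thus ?thesis using False by (simp add: field_simps)
        qed
        ultimately have "\<bar>f x\<bar> \<le> (real k + 1) + \<rho> powr \<gamma> * (?s powr p / norm h powr \<gamma>)"
          using 1 by linarith
        hence "ennreal \<bar>f x\<bar> \<le> ennreal ((real k + 1) + \<rho> powr \<gamma> * (?s powr p / norm h powr \<gamma>))"
          by (rule ennreal_leI)
        also have "\<dots> = ennreal (real k + 1) + ennreal (\<rho> powr \<gamma>) * ennreal (?s powr p / norm h powr \<gamma>)"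
          by (subst ennreal_plus) (auto simp: ennreal_mult[symmetric])
        finally show ?thesis using hG h by simp
      qed simp
      have "ennreal (V / 2) * ennreal \<bar>f x\<bar> \<le> ennreal \<bar>f x\<bar> * emeasure lborel G"
        using mult_left_mono[OF G2, of "ennreal \<bar>f x\<bar>"] by (simp add: mult.commute)
      also have "\<dots> = (\<integral>\<^sup>+h. ennreal \<bar>f x\<bar> * indicator G h \<partial>lborel)"
        by (rule nn_integral_cmult_indicator[symmetric]) simp
      also have "\<dots> \<le> (\<integral>\<^sup>+h. ennreal (real k + 1) * indicator (ball 0 \<rho>) h + ennreal (\<rho> powr \<gamma>) * ennreal (\<bar>second_diff f h x\<bar> powr p / norm h powr \<gamma>) \<partial>lborel)"
        by (intro nn_integral_mono bound)
      also have "\<dots> = (\<integral>\<^sup>+h. ennreal (real k + 1) * indicator (ball (0::'a) \<rho>) h \<partial>lborel)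
          + (\<integral>\<^sup>+h. ennreal (\<rho> powr \<gamma>) * ennreal (\<bar>second_diff f h x\<bar> powr p / norm h powr \<gamma>) \<partial>lborel)"
        by (rule nn_integral_add) measurable
      also have "(\<integral>\<^sup>+h. ennreal (real k + 1) * indicator (ball (0::'a) \<rho>) h \<partial>lborel) = ennreal (real k + 1) * ennreal V"
        by (subst nn_integral_cmult_indicator) (auto simp: eV)
      also have "\<dots> = ennreal ((real k + 1) * V)" using V by (subst ennreal_mult) auto
      also have "(\<integral>\<^sup>+h. ennreal (\<rho> powr \<gamma>) * ennreal (\<bar>second_diff f h x\<bar> powr p / norm h powr \<gamma>) \<partial>lborel)
         = ennreal (\<rho> powr \<gamma>) * (\<integral>\<^sup>+h. ennreal (\<bar>second_diff f h x\<bar> powr p / norm h powr \<gamma>) \<partial>lborel)"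
        by (rule nn_integral_cmult) measurable
      finally show ?thesis using True by simp
    qed simp
    have "ennreal (V / 2) * (\<integral>\<^sup>+x. ennreal \<bar>f x\<bar> * indicator (ball 0 \<rho>) x \<partial>lborel)
      = (\<integral>\<^sup>+x. ennreal (V / 2) * (ennreal \<bar>f x\<bar> * indicator (ball 0 \<rho>) x) \<partial>lborel)"
      by (rule nn_integral_cmult[symmetric]) measurable
    also have "\<dots> \<le> (\<integral>\<^sup>+x. ennreal ((real k + 1) * V) * indicator (ball 0 \<rho>) x + ennreal (\<rho> powr \<gamma>) * (\<integral>\<^sup>+h. ennreal (\<bar>second_diff f h x\<bar> powr p / norm h powr \<gamma>) \<partial>lborel) \<partial>lborel)"
      by (intro nn_integral_mono main)
    also have "\<dots> = (\<integral>\<^sup>+x. ennreal ((real k + 1) * V) * indicator (ball (0::'a) \<rho>) x \<partial>lborel)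
      + (\<integral>\<^sup>+x. ennreal (\<rho> powr \<gamma>) * (\<integral>\<^sup>+h. ennreal (\<bar>second_diff f h x\<bar> powr p / norm h powr \<gamma>) \<partial>lborel) \<partial>lborel)"
      by (rule nn_integral_add) measurable
    also have "(\<integral>\<^sup>+x. ennreal ((real k + 1) * V) * indicator (ball (0::'a) \<rho>) x \<partial>lborel) = ennreal ((real k + 1) * V) * ennreal V"
      by (subst nn_integral_cmult_indicator) (auto simp: eV)
    also have "(\<integral>\<^sup>+x. ennreal (\<rho> powr \<gamma>) * (\<integral>\<^sup>+h. ennreal (\<bar>second_diff f h x\<bar> powr p / norm h powr \<gamma>) \<partial>lborel) \<partial>lborel)
      = ennreal (\<rho> powr \<gamma>) * (\<integral>\<^sup>+x. (\<integral>\<^sup>+h. ennreal (\<bar>second_diff f h x\<bar> powr p / norm h powr \<gamma>) \<partial>lborel) \<partial>lborel)"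
      by (rule nn_integral_cmult) measurable
    also have "ennreal ((real k + 1) * V) * ennreal V + \<dots> < \<infinity>"
      using fin by (simp add: ennreal_mult_less_top)
    finally show ?thesis using V by (auto simp: ennreal_mult_less_top)
  qed
  show ?thesis
    unfolding loc_integrable_def
  proof
    fix R :: real
    let ?\<rho> = "\<bar>R\<bar> + 1"
    show "integrable lborel (\<lambda>w. indicator (cball 0 R) w * f w)"
    proof (rule integrableI_bounded)
      have "(\<integral>\<^sup>+w. ennreal (norm (indicator (cball 0 R) w * f w)) \<partial>lborel) \<le> (\<integral>\<^sup>+x. ennreal \<bar>f x\<bar> * indicator (ball 0 ?\<rho>) x \<partial>lborel)"
        by (intro nn_integral_mono) (auto simp: indicator_def)
      also have "\<dots> < \<infinity>" by (rule ball_fin) simp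
      finally show "(\<integral>\<^sup>+w. ennreal (norm (indicator (cball 0 R) w * f w)) \<partial>lborel) < \<infinity>" .
    qed measurable
  qed
qed

subsection \<open>Lower bound for Borel functions\<close>

lemma in_convex_hull_iff_dense:
  fixes P :: "'i \<Rightarrow> 'b::euclidean_space"
  assumes D: "\<And>U. open U \<Longrightarrow> U \<noteq> {} \<Longrightarrow> \<exists>d\<in>D. d \<in> U" and I: "finite I" "I \<noteq> {}"
  shows "y \<in> convex hull (P ` I) \<longleftrightarrow> (\<forall>c\<in>D. \<exists>i\<in>I. c \<bullet> y \<le> c \<bullet> P i)"
proof (intro iffI ballI)
  fix c assume y: "y \<in> convex hull (P ` I)"
  show "\<exists>i\<in>I. c \<bullet> y \<le> c \<bullet> P i"
  proof (rule ccontr)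
    assume "\<not> ?thesis"
    hence "P ` I \<subseteq> {z. c \<bullet> z < c \<bullet> y}" by auto
    hence "convex hull (P ` I) \<subseteq> {z. c \<bullet> z < c \<bullet> y}"
      by (intro hull_minimal convex_halfspace_lt)
    thus False using y by auto
  qed
next
  assume *: "\<forall>c\<in>D. \<exists>i\<in>I. c \<bullet> y \<le> c \<bullet> P i"
  show "y \<in> convex hull (P ` I)"
  proof (rule ccontr)
    assume y: "y \<notin> convex hull (P ` I)"
    have "closed (convex hull (P ` I))"
      using I by (intro compact_imp_closed finite_imp_compact_convex_hull) auto
    from separating_hyperplane_closed_point[OF convex_convex_hull this y]
    obtain a b where ab: "a \<bullet> y < b" "\<And>x. x \<in> convex hull (P ` I) \<Longrightarrow> b < a \<bullet> x" by auto
    \<comment> \<open>The normals that strictly separate \<open>y\<close> from finitely many points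
      form an open set, so the dense set \<open>D\<close> meets it.\<close>
    let ?U = "\<Inter>i\<in>I. {c. c \<bullet> (P i - y) < 0}"
    have "open ?U"
      using I by (intro open_INT ballI open_Collect_less continuous_intros) auto
    moreover have "- a \<in> ?U"
    proof
      fix i assume "i \<in> I"
      hence "b < a \<bullet> P i" by (intro ab(2) hull_inc) auto
      thus "- a \<in> {c. c \<bullet> (P i - y) < 0}" using ab(1) by (auto simp: inner_diff_right)
    qed
    ultimately obtain d where "d \<in> D" "d \<in> ?U" using D by blast
    thus False using * by (force simp: inner_diff_right)
  qed
qed

text \<open>The volume is the measure of a section of the set of pairs (X, y) with y in the hull.
  Countably many half-space conditions, one for each vector of a dense set, make this set
  measurable; continuity in X is not at hand, as \<open>f\<close> is only Borel.\<close>

lemma borel_measurable_hull_volume: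
  fixes f :: "'a::euclidean_space \<Rightarrow> real" and m :: nat
  assumes fm [measurable]: "f \<in> borel_measurable borel"
  shows "(\<lambda>X. measure lebesgue (convex hull {graph_pt f (X i) | i. i \<le> m})) \<in> borel_measurable (PiM {..m} (\<lambda>_. lborel))"
proof -
  let ?P = "PiM {..m} (\<lambda>_. lborel :: 'a measure)"
  obtain D :: "('a \<times> real) set" where D: "countable D" "\<And>U. open U \<Longrightarrow> U \<noteq> {} \<Longrightarrow> \<exists>d\<in>D. d \<in> U"
    by (erule countable_dense_setE)
  have comp: "(\<lambda>z. fst z i) \<in> borel_measurable (?P \<Otimes>\<^sub>M (lborel :: ('a \<times> real) measure))" if "i \<le> m" for i
    using that measurable_compose[OF measurable_fst measurable_component_singleton[of i "{..m}" "\<lambda>_. lborel :: 'a measure"]] by simp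
  have eq: "{graph_pt f (X i) | i. i \<le> m} = (\<lambda>i. graph_pt f (X i)) ` {..m}" for X by auto
  let ?Q = "{z \<in> space (?P \<Otimes>\<^sub>M (lborel :: ('a \<times> real) measure)). snd z \<in> convex hull {graph_pt f (fst z i) | i. i \<le> m}}"
  have "?Q = {z \<in> space (?P \<Otimes>\<^sub>M (lborel :: ('a \<times> real) measure)). \<forall>c\<in>D. \<exists>i\<in>{..m}. c \<bullet> snd z \<le> c \<bullet> graph_pt f (fst z i)}"
  proof -
    have iff: "y \<in> convex hull (P ` {..m}) \<longleftrightarrow> (\<forall>c\<in>D. \<exists>i\<in>{..m}. c \<bullet> y \<le> c \<bullet> P i)" for y P
      by (rule in_convex_hull_iff_dense[OF D(2)]) auto
    show ?thesis unfolding eq iff ..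
  qed
  also have "\<dots> \<in> sets (?P \<Otimes>\<^sub>M (lborel :: ('a \<times> real) measure))"
  proof (intro sets.sets_Collect_countable_All' D(1) sets.sets_Collect_finite_Ex)
    fix c :: "'a \<times> real" and i assume "i \<in> {..m}"
    hence i [measurable]: "(\<lambda>z. fst z i) \<in> borel_measurable (?P \<Otimes>\<^sub>M (lborel :: ('a \<times> real) measure))" using comp by simp
    have 1: "(\<lambda>z. c \<bullet> snd z) \<in> borel_measurable (?P \<Otimes>\<^sub>M (lborel :: ('a \<times> real) measure))" by measurable
    have 2: "(\<lambda>z. fst c \<bullet> fst z i + snd c * f (fst z i)) \<in> borel_measurable (?P \<Otimes>\<^sub>M (lborel :: ('a \<times> real) measure))" by measurable
    have "c \<bullet> graph_pt f y = fst c \<bullet> y + snd c * f y" for y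
      by (simp add: graph_pt_def inner_prod_def)
    thus "{z \<in> space (?P \<Otimes>\<^sub>M (lborel :: ('a \<times> real) measure)). c \<bullet> snd z \<le> c \<bullet> graph_pt f (fst z i)} \<in> sets (?P \<Otimes>\<^sub>M lborel)"
      using borel_measurable_le[OF 1 2] by presburger
  qed simp
  finally have "(\<lambda>X. emeasure lborel (Pair X -` ?Q)) \<in> borel_measurable ?P"
    by (rule lborel.measurable_emeasure_Pair)
  hence "(\<lambda>X. enn2real (emeasure lborel (Pair X -` ?Q))) \<in> borel_measurable ?P" by measurable
  moreover have "enn2real (emeasure lborel (Pair X -` ?Q)) = measure lebesgue (convex hull {graph_pt f (X i) | i. i \<le> m})"
    if "X \<in> space ?P" for X
  proof -
    have "Pair X -` ?Q = convex hull {graph_pt f (X i) | i. i \<le> m}"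
      using that by (auto simp: space_pair_measure)
    thus ?thesis unfolding eq by (simp add: emeasure_convex_hull_finite)
  qed
  ultimately show ?thesis by (rule measurable_cong[THEN iffD1, rotated])
qed

lemma borel_measurable_diam_pts:
  "diam_pts m \<in> borel_measurable (PiM {..m} (\<lambda>_. lborel :: 'a::euclidean_space measure))"
proof -
  let ?P = "PiM {..m} (\<lambda>_. lborel :: 'a measure)"
  have "diam_pts m = (\<lambda>X. Max ((\<lambda>q. dist (X (fst q)) (X (snd q))) ` ({..m} \<times> {..m}) :: real set))"
    unfolding diam_pts_def by (intro ext arg_cong[where f=Max]) force
  also have "\<dots> \<in> borel_measurable ?P"
  proof (rule borel_measurable_Max)
    fix q :: "nat \<times> nat" assume q: "q \<in> {..m} \<times> {..m}"
    have [measurable]: "(\<lambda>X. X (fst q)) \<in> borel_measurable ?P" "(\<lambda>X. X (snd q)) \<in> borel_measurable ?P"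
      using q measurable_component_singleton[of "fst q" "{..m}" "\<lambda>_. lborel :: 'a measure"]
        measurable_component_singleton[of "snd q" "{..m}" "\<lambda>_. lborel :: 'a measure"] by auto
    show "(\<lambda>X. dist (X (fst q)) (X (snd q))) \<in> borel_measurable ?P" by measurable
  qed auto
  finally show ?thesis .
qed

text \<open>Index 0 is x, index 1 is x + h or x - h, and \<open>J\<close> holds the remaining n
  points. In \<open>c\<close>, 2^p comes from splitting the second difference into two deviations,
  4^\<beta> from a diameter of at most 4|h|, and the last factor from the volumes of n balls of
  radius |h|/(2n). The energy is counted twice, once for each sign of h.\<close>

lemma energy_integral_ge:
  fixes f :: "'a::euclidean_space \<Rightarrow> real" and p s \<beta> :: real
  assumes fm [measurable]: "f \<in> borel_measurable borel" and p: "1 < p" and s: "0 < s"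
  defines "n \<equiv> DIM('a)"
  defines "\<beta> \<equiv> real (n * (n + 1)) + p * (real n + 1 + s)"
  defines "\<gamma> \<equiv> real n + (1 + s) * p"
  defines "c \<equiv> graph_simplex_const n powr p / (2 powr p * 4 powr \<beta>) * (unit_ball_vol n * (1 / (2 * real n)) ^ n) ^ n"
  shows "ennreal c * (\<integral>\<^sup>+x. (\<integral>\<^sup>+h. ennreal (\<bar>second_diff f h x\<bar> powr p / norm h powr \<gamma>) \<partial>lborel) \<partial>lborel)
    \<le> 2 * (\<integral>\<^sup>+X. ennreal (measure lebesgue (convex hull {graph_pt f (X i) | i. i \<le> n + 1}) powr p
        / diam_pts (n + 1) X powr \<beta>) \<partial>PiM {..n + 1} (\<lambda>_. lborel))"
proof -
  interpret product_sigma_finite "\<lambda>_. lborel :: 'a measure" by (rule product_sigma_finite_lborel)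
  define m where "m = n + 1"
  define J where "J = {2..m}"
  have n: "0 < n" by (simp add: n_def)
  have J: "finite J" "0 \<notin> insert 1 J" "1 \<notin> J" "{..m} = insert 0 (insert 1 J)" "card J = n"
    using n by (auto simp: J_def m_def)
  interpret fin: finite_product_sigma_finite "\<lambda>_. lborel :: 'a measure" J by standard (rule J)
  have \<beta>: "0 < \<beta>" using p s by (auto simp: \<beta>_def intro!: add_nonneg_pos mult_pos_pos)
  let ?vol = "\<lambda>X. measure lebesgue (convex hull {graph_pt f (X i) | i. i \<le> m})"
  define g where "g X = ennreal (?vol X powr p / diam_pts m X powr \<beta>)" for X
  have gm [measurable]: "g \<in> borel_measurable (PiM {..m} (\<lambda>_. lborel))"
  proof -
    note [measurable] = borel_measurable_hull_volume[OF fm, of m] borel_measurable_diam_pts[of m, where 'a='a]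
    show ?thesis unfolding g_def by measurable
  qed
  have upd: "(\<lambda>q. (snd (snd q))(1 := fst (snd q), 0 := fst q)) \<in> (lborel \<Otimes>\<^sub>M (lborel \<Otimes>\<^sub>M PiM J (\<lambda>_. lborel :: 'a measure))) \<rightarrow>\<^sub>M PiM {..m} (\<lambda>_. lborel :: 'a measure)"
  proof (rule measurable_fun_upd[where J="insert 1 J"])
    show "(\<lambda>q. (snd (snd q))(1 := fst (snd q))) \<in> (lborel \<Otimes>\<^sub>M (lborel \<Otimes>\<^sub>M PiM J (\<lambda>_. lborel :: 'a measure))) \<rightarrow>\<^sub>M PiM (insert 1 J) (\<lambda>_. lborel :: 'a measure)"
      by (rule measurable_fun_upd[where J=J]) auto
  qed (use J in auto)
  have g3 [measurable]: "(\<lambda>q. g ((snd (snd q))(1 := fst (snd q), 0 := fst q))) \<in> borel_measurable (lborel \<Otimes>\<^sub>M (lborel \<Otimes>\<^sub>M PiM J (\<lambda>_. lborel :: 'a measure)))"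
    by (rule measurable_compose[OF upd gm])
  have gxy [measurable]: "(\<lambda>Z. g (Z(1 := y, 0 := x))) \<in> borel_measurable (PiM J (\<lambda>_. lborel))" for x y
    using measurable_compose[OF measurable_Pair[OF measurable_const[of x] measurable_Pair[OF measurable_const[of y] measurable_ident]] g3] by simp
  \<comment> \<open>The energy with its first two points frozen, so that x + h and x - h can both be
    inserted for the second.\<close>
  define \<Phi> where "\<Phi> x y = (\<integral>\<^sup>+Z. g (Z(1 := y, 0 := x)) \<partial>PiM J (\<lambda>_. lborel))" for x y
  have \<Phi>2: "(\<lambda>q. \<Phi> (fst q) (snd q)) \<in> borel_measurable (lborel \<Otimes>\<^sub>M lborel)"
  proof -
    have "(\<lambda>r. g ((snd r)(1 := snd (fst r), 0 := fst (fst r)))) \<in> borel_measurable ((lborel \<Otimes>\<^sub>M lborel) \<Otimes>\<^sub>M PiM J (\<lambda>_. lborel :: 'a measure))"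
      using measurable_compose[OF _ g3, of "\<lambda>r. (fst (fst r), (snd (fst r), snd r))" "(lborel \<Otimes>\<^sub>M lborel) \<Otimes>\<^sub>M PiM J (\<lambda>_. lborel :: 'a measure)"]
      by simp
    from fin.borel_measurable_nn_integral_fst[OF this] show ?thesis by (simp add: \<Phi>_def)
  qed
  have \<Phi>m [measurable]: "(\<lambda>z. \<Phi> (a z) (b z)) \<in> borel_measurable lborel" if [measurable]: "a \<in> borel_measurable borel" "b \<in> borel_measurable borel" for a b :: "'a \<Rightarrow> 'a"
    using measurable_compose[OF measurable_Pair[of a lborel lborel b lborel] \<Phi>2] by simp
  have \<Phi>m2: "(\<lambda>z. \<Phi> (fst z) (fst z + snd z)) \<in> borel_measurable (lborel \<Otimes>\<^sub>M lborel)" "(\<lambda>z. \<Phi> (fst z) (fst z - snd z)) \<in> borel_measurable (lborel \<Otimes>\<^sub>M lborel)"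
    using measurable_compose[OF _ \<Phi>2, of "\<lambda>z. (fst z, fst z + snd z)" "lborel \<Otimes>\<^sub>M lborel"]
      measurable_compose[OF _ \<Phi>2, of "\<lambda>z. (fst z, fst z - snd z)" "lborel \<Otimes>\<^sub>M lborel"] by simp_all
  define E where "E = (\<integral>\<^sup>+X. g X \<partial>PiM {..m} (\<lambda>_. lborel))"
  have E1: "E = (\<integral>\<^sup>+x. (\<integral>\<^sup>+y. \<Phi> x y \<partial>lborel) \<partial>lborel)"
  proof -
    have "E = (\<integral>\<^sup>+x. (\<integral>\<^sup>+Y. g (Y(0 := x)) \<partial>PiM (insert 1 J) (\<lambda>_. lborel)) \<partial>lborel)"
      unfolding E_def J(4) using J gm by (intro product_nn_integral_insert_rev) auto
    also have "\<dots> = (\<integral>\<^sup>+x. (\<integral>\<^sup>+y. \<Phi> x y \<partial>lborel) \<partial>lborel)"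
    proof (rule nn_integral_cong)
      fix x :: 'a
      have "(\<lambda>Y. Y(0 := x)) \<in> PiM (insert 1 J) (\<lambda>_. lborel :: 'a measure) \<rightarrow>\<^sub>M PiM {..m} (\<lambda>_. lborel)"
        by (rule measurable_fun_upd[where J="insert 1 J"]) (use J in auto)
      from measurable_compose[OF this gm]
      show "(\<integral>\<^sup>+Y. g (Y(0 := x)) \<partial>PiM (insert 1 J) (\<lambda>_. lborel)) = (\<integral>\<^sup>+y. \<Phi> x y \<partial>lborel)"
        unfolding \<Phi>_def using J by (intro product_nn_integral_insert_rev) auto
    qed
    finally show ?thesis .
  qed
  have Ep: "E = (\<integral>\<^sup>+x. (\<integral>\<^sup>+h. \<Phi> x (x + h) \<partial>lborel) \<partial>lborel)"
    unfolding E1 by (intro nn_integral_cong nn_integral_lborel_translate[symmetric]) measurable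
  have Em: "E = (\<integral>\<^sup>+x. (\<integral>\<^sup>+h. \<Phi> x (x - h) \<partial>lborel) \<partial>lborel)"
    unfolding Ep
  proof (rule nn_integral_cong)
    fix x
    have "(\<lambda>h. \<Phi> x (x + h)) \<in> borel_measurable borel" using \<Phi>m[of "\<lambda>_. x" "\<lambda>h. x + h"] by simp
    from nn_integral_lborel_uminus[OF this]
    show "(\<integral>\<^sup>+h. \<Phi> x (x + h) \<partial>lborel) = (\<integral>\<^sup>+h. \<Phi> x (x - h) \<partial>lborel)" by simp
  qed
  \<comment> \<open>\<open>e\<close> assigns to each of the n remaining indices the basis vector
    next to which its point is placed.\<close>
  obtain e where e: "bij_betw e J (Basis :: 'a set)"
    using J finite_same_card_bij[of J "Basis :: 'a set"] by (auto simp: n_def)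
  define k where "k = graph_simplex_const n"
  define v where "v = unit_ball_vol n"
  have v: "0 < v" by (simp add: v_def)
  have k: "0 < k" using n by (simp add: k_def graph_simplex_const_def)
  have key: "ennreal c * ennreal (\<bar>second_diff f h x\<bar> powr p / norm h powr \<gamma>) \<le> \<Phi> x (x + h) + \<Phi> x (x - h)" for x h
  proof (cases "h = 0")
    case True thus ?thesis by (simp add: second_diff_def)
  next
    case False
    define r where "r = norm h"
    have r: "0 < r" using False by (simp add: r_def)
    define \<epsilon> where "\<epsilon> = r / (2 * real n)"
    have \<epsilon>: "0 < \<epsilon>" "\<epsilon> \<le> r" using r n by (auto simp: \<epsilon>_def field_simps)
    define L where "L = (k * r ^ n * \<bar>second_diff f h x\<bar>) powr p / (2 powr p * (4 * r) powr \<beta>)"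
    have L0: "0 \<le> L" by (simp add: L_def)
    have low: "ennreal L \<le> g (Z(1 := x + h, 0 := x)) + g (Z(1 := x - h, 0 := x))"
      if Z: "\<And>j. j \<in> J \<Longrightarrow> dist (x + r *\<^sub>R e j) (Z j) < \<epsilon>" for Z
    proof -
      define z where "z b = Z (inv_into J e b)" for b
      have ze: "z (e j) = Z j" if "j \<in> J" for j
        using e that by (simp add: z_def bij_betw_def inv_into_f_f)
      have zJ: "z ` Basis = Z ` J"
        using e ze by (force simp: bij_betw_def)
      have zb: "norm (z b - (x + r *\<^sub>R b)) \<le> r / (2 * real DIM('a))" if "b \<in> Basis" for b
      proof -
        from that e obtain j where j: "j \<in> J" "b = e j" by (auto simp: bij_betw_def)
        show ?thesis using Z[OF j(1)] ze[OF j(1)] j(2)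
          by (simp add: \<epsilon>_def n_def dist_norm norm_minus_commute)
      qed
      obtain a where a: "\<And>y. k * r ^ n * \<bar>f y - f x - a \<bullet> (y - x)\<bar>
          \<le> measure lebesgue (convex hull (graph_pt f ` (insert x (insert y (z ` Basis)))))"
        using measure_graph_hull_ge[OF r zb, where f=f] unfolding k_def n_def by blast
      have volZ: "k * r ^ n * \<bar>f y - f x - a \<bullet> (y - x)\<bar> \<le> ?vol (Z(1 := y, 0 := x))" for y
      proof -
        have "{graph_pt f ((Z(1 := y, 0 := x)) i) | i. i \<le> m} = graph_pt f ` ((Z(1 := y, 0 := x)) ` insert 0 (insert 1 J))"
          unfolding J(4)[symmetric] by auto
        also have "(Z(1 := y, 0 := x)) ` insert 0 (insert 1 J) = insert x (insert y (z ` Basis))"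
        proof -
          have "(Z(1 := y, 0 := x)) ` J = Z ` J" using J(2,3) by (intro image_cong) auto
          thus ?thesis unfolding zJ image_insert by simp
        qed
        finally have eq: "{graph_pt f ((Z(1 := y, 0 := x)) i) | i. i \<le> m} = graph_pt f ` (insert x (insert y (z ` Basis)))" .
        show ?thesis unfolding eq by (rule a)
      qed
      have glow: "ennreal (u powr p / (4 * r) powr \<beta>) \<le> g (Z(1 := y, 0 := x))"
        if u: "0 \<le> u" "u \<le> ?vol (Z(1 := y, 0 := x))" and y: "norm (y - x) = r" for u y
      proof -
        let ?X = "Z(1 := y, 0 := x)"
        \<comment> \<open>A point with index in \<open>J\<close> lies within \<epsilon> \<le> r of a
          centre at distance r from \<open>x\<close>.\<close>
        have near: "dist (?X i) x \<le> 2 * r" if "i \<le> m" for i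
        proof -
          have "i \<in> {..m}" using that by simp
          hence "i \<in> insert 0 (insert 1 J)" unfolding J(4) .
          then consider "i = 0" | "i = 1" | "i \<in> J" by auto
          thus ?thesis
          proof cases
            case 3
            have "e i \<in> Basis" using e 3 by (auto simp: bij_betw_def)
            hence "norm (r *\<^sub>R e i) = r" using r by simp
            hence "dist (x + r *\<^sub>R e i) x = r" by (simp add: dist_norm)
            moreover have "?X i = Z i" using 3 J(2,3) by auto
            ultimately show ?thesis
              using Z[OF 3] dist_triangle2[of "Z i" x "x + r *\<^sub>R e i"] \<epsilon>(2)
              by (simp add: dist_commute)
          qed (use y r in \<open>auto simp: dist_norm\<close>)
        qed
        have "diam_pts m ?X \<le> 4 * r"
        proof (rule diam_pts_le)
          fix i j assume "i \<le> m" "j \<le> m"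
          thus "dist (?X i) (?X j) \<le> 4 * r"
            using near[of i] near[of j] dist_triangle2[of "?X i" "?X j" x] by linarith
        qed
        \<comment> \<open>The lower bound keeps the denominator positive; at diameter 0 the
          integrand would be 0 by convention.\<close>
        moreover have "r \<le> diam_pts m ?X"
          using dist_le_diam_pts[of 1 m 0 ?X] y by (simp add: m_def dist_norm)
        ultimately have "diam_pts m ?X powr \<beta> \<le> (4 * r) powr \<beta>" "0 < diam_pts m ?X powr \<beta>"
          using r \<beta> by (auto intro!: powr_mono2)
        moreover have "u powr p \<le> ?vol ?X powr p" using u p by (intro powr_mono2) auto
        ultimately show ?thesis
          unfolding g_def by (intro ennreal_leI frac_le) auto
      qed
      define u1 where "u1 = k * r ^ n * \<bar>f (x + h) - f x - a \<bullet> h\<bar>"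
      define u2 where "u2 = k * r ^ n * \<bar>f (x - h) - f x + a \<bullet> h\<bar>"
      have u: "0 \<le> u1" "0 \<le> u2" using k r by (auto simp: u1_def u2_def)
      have g1: "ennreal (u1 powr p / (4 * r) powr \<beta>) \<le> g (Z(1 := x + h, 0 := x))"
        using volZ[of "x + h"] u by (intro glow) (auto simp: u1_def r_def)
      have g2: "ennreal (u2 powr p / (4 * r) powr \<beta>) \<le> g (Z(1 := x - h, 0 := x))"
        using volZ[of "x - h"] u by (intro glow) (auto simp: u2_def r_def)
      \<comment> \<open>The gradient \<open>a\<close> is the same for both choices of
        \<open>y\<close>, so the terms \<open>a \<bullet> h\<close> cancel in the sum of the two
        deviations.\<close>
      have "k * r ^ n * \<bar>second_diff f h x\<bar> \<le> k * r ^ n * (\<bar>f (x + h) - f x - a \<bullet> h\<bar> + \<bar>f (x - h) - f x + a \<bullet> h\<bar>)"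
        using k r by (intro mult_left_mono) (auto simp: second_diff_def)
      also have "\<dots> = u1 + u2" by (simp add: u1_def u2_def distrib_left)
      also have "\<dots> \<le> 2 * max u1 u2" by simp
      finally have "(k * r ^ n * \<bar>second_diff f h x\<bar>) powr p \<le> (2 * max u1 u2) powr p"
        using k r p by (intro powr_mono2) auto
      also have "\<dots> = 2 powr p * max u1 u2 powr p" using u by (simp add: powr_mult)
      also have "\<dots> \<le> 2 powr p * (u1 powr p + u2 powr p)"
        by (intro mult_left_mono) (auto simp: max_def)
      finally have "L \<le> u1 powr p / (4 * r) powr \<beta> + u2 powr p / (4 * r) powr \<beta>"
        unfolding L_def using r by (simp add: field_simps)
      hence "ennreal L \<le> ennreal (u1 powr p / (4 * r) powr \<beta>) + ennreal (u2 powr p / (4 * r) powr \<beta>)"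
        by (subst ennreal_plus[symmetric]) (simp_all add: ennreal_leI del: ennreal_plus)
      also have "\<dots> \<le> g (Z(1 := x + h, 0 := x)) + g (Z(1 := x - h, 0 := x))"
        by (intro add_mono g1 g2)
      finally show ?thesis .
    qed
    have "ennreal c * ennreal (\<bar>second_diff f h x\<bar> powr p / norm h powr \<gamma>) = ennreal L * ennreal (v * \<epsilon> ^ n) ^ n"
    proof -
      have c0: "0 \<le> c" using v by (simp add: c_def v_def)
      have "c * (\<bar>second_diff f h x\<bar> powr p / r powr \<gamma>) = L * (v * \<epsilon> ^ n) ^ n"
      proof -
        have Lr: "L = k powr p * r powr (real n * p) * \<bar>second_diff f h x\<bar> powr p / (2 powr p * (4 powr \<beta> * r powr \<beta>))"
          unfolding L_def using k r by (simp add: powr_mult powr_realpow[symmetric] powr_powr)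
        have Wr: "(v * \<epsilon> ^ n) ^ n = (v * (1 / (2 * real n)) ^ n) ^ n * r powr (real (n * n))"
        proof -
          have "(v * \<epsilon> ^ n) ^ n = (v * (1 / (2 * real n)) ^ n) ^ n * (r ^ n) ^ n"
          proof -
            have "v * \<epsilon> ^ n = (v * (1 / (2 * real n)) ^ n) * r ^ n"
              by (simp add: \<epsilon>_def power_divide)
            thus ?thesis by (simp only: power_mult_distrib)
          qed
          also have "(r ^ n) ^ n = r powr (real (n * n))" using r by (simp add: powr_realpow power_mult[symmetric] del: of_nat_mult)
          finally show ?thesis .
        qed
        have rr: "r powr (real n * p) * r powr (real (n * n)) / r powr \<beta> = 1 / r powr \<gamma>"
        proof -
          \<comment> \<open>The simplex volume contributes np, the n balls n^2, and the diameter
            -\<beta>.\<close>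
          have "real n * p + real (n * n) - \<beta> = - \<gamma>"
            by (simp add: \<beta>_def \<gamma>_def algebra_simps)
          hence "r powr (real n * p) * r powr (real (n * n)) / r powr \<beta> = r powr (- \<gamma>)"
            by (simp add: powr_add[symmetric] powr_diff[symmetric] del: of_nat_mult)
          thus ?thesis by (simp add: powr_minus divide_inverse)
        qed
        define W where "W = (v * (1 / (2 * real n)) ^ n) ^ n"
        have "L * (v * \<epsilon> ^ n) ^ n = k powr p / (2 powr p * 4 powr \<beta>) * W * \<bar>second_diff f h x\<bar> powr p
            * (r powr (real n * p) * r powr (real (n * n)) / r powr \<beta>)"
          unfolding Lr Wr W_def[symmetric] by (simp only: divide_inverse inverse_mult_distrib mult_ac)
        also have "\<dots> = c * (\<bar>second_diff f h x\<bar> powr p / r powr \<gamma>)"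
          unfolding rr c_def k_def[symmetric] v_def[symmetric] W_def[symmetric] by simp
        finally show ?thesis by simp
      qed
      thus ?thesis
        using c0 L0 v \<epsilon> unfolding r_def[symmetric]
        by (simp add: ennreal_power ennreal_mult[symmetric])
    qed
    also have "\<dots> = ennreal L * (\<integral>\<^sup>+Z. (\<Prod>j\<in>J. indicator (ball (x + r *\<^sub>R e j) \<epsilon>) (Z j)) \<partial>PiM J (\<lambda>_. lborel))"
      using J \<epsilon> by (subst product_nn_integral_prod) (auto simp: emeasure_ball v_def n_def)
    also have "\<dots> = (\<integral>\<^sup>+Z. ennreal L * (\<Prod>j\<in>J. indicator (ball (x + r *\<^sub>R e j) \<epsilon>) (Z j)) \<partial>PiM J (\<lambda>_. lborel))"
    proof (rule nn_integral_cmult[symmetric], rule borel_measurable_prod_ennreal)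
      fix j assume "j \<in> J"
      hence [measurable]: "(\<lambda>Z. Z j) \<in> borel_measurable (PiM J (\<lambda>_. lborel :: 'a measure))"
        using measurable_component_singleton[of j J "\<lambda>_. lborel :: 'a measure"] by simp
      show "(\<lambda>Z. indicator (ball (x + r *\<^sub>R e j) \<epsilon>) (Z j) :: ennreal) \<in> borel_measurable (PiM J (\<lambda>_. lborel))"
        by measurable
    qed
    also have "\<dots> \<le> (\<integral>\<^sup>+Z. g (Z(1 := x + h, 0 := x)) + g (Z(1 := x - h, 0 := x)) \<partial>PiM J (\<lambda>_. lborel))"
    proof (rule nn_integral_mono)
      fix Z :: "nat \<Rightarrow> 'a"
      show "ennreal L * (\<Prod>j\<in>J. indicator (ball (x + r *\<^sub>R e j) \<epsilon>) (Z j)) \<le> g (Z(1 := x + h, 0 := x)) + g (Z(1 := x - h, 0 := x))"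
      proof (cases "\<forall>j\<in>J. dist (x + r *\<^sub>R e j) (Z j) < \<epsilon>")
        case True
        hence "(\<Prod>j\<in>J. indicator (ball (x + r *\<^sub>R e j) \<epsilon>) (Z j)) = (1::ennreal)"
          by (intro prod.neutral) auto
        thus ?thesis using low[of Z] True by simp
      next
        case False
        then obtain j where "j \<in> J" "indicator (ball (x + r *\<^sub>R e j) \<epsilon>) (Z j) = (0::ennreal)"
          by (auto simp: indicator_def)
        hence "(\<Prod>j\<in>J. indicator (ball (x + r *\<^sub>R e j) \<epsilon>) (Z j)) = (0::ennreal)"
          using J(1) by (intro prod_zero) auto
        thus ?thesis by (simp only: mult_zero_right zero_le)
      qed
    qed
    also have "\<dots> = \<Phi> x (x + h) + \<Phi> x (x - h)"
      unfolding \<Phi>_def by (rule nn_integral_add) measurable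
    finally show ?thesis .
  qed
  have "ennreal c * (\<integral>\<^sup>+x. (\<integral>\<^sup>+h. ennreal (\<bar>second_diff f h x\<bar> powr p / norm h powr \<gamma>) \<partial>lborel) \<partial>lborel)
    = (\<integral>\<^sup>+x. ennreal c * (\<integral>\<^sup>+h. ennreal (\<bar>second_diff f h x\<bar> powr p / norm h powr \<gamma>) \<partial>lborel) \<partial>lborel)"
    by (rule nn_integral_cmult[symmetric]) measurable
  also have "\<dots> = (\<integral>\<^sup>+x. (\<integral>\<^sup>+h. ennreal c * ennreal (\<bar>second_diff f h x\<bar> powr p / norm h powr \<gamma>) \<partial>lborel) \<partial>lborel)"
    by (rule nn_integral_cong, rule nn_integral_cmult[symmetric]) measurable
  also have "\<dots> \<le> (\<integral>\<^sup>+x. (\<integral>\<^sup>+h. \<Phi> x (x + h) + \<Phi> x (x - h) \<partial>lborel) \<partial>lborel)"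
    by (intro nn_integral_mono key)
  also have "\<dots> = (\<integral>\<^sup>+x. (\<integral>\<^sup>+h. \<Phi> x (x + h) \<partial>lborel) + (\<integral>\<^sup>+h. \<Phi> x (x - h) \<partial>lborel) \<partial>lborel)"
    by (rule nn_integral_cong, rule nn_integral_add) measurable
  also have "\<dots> = E + E"
    unfolding Em[symmetric] Ep[symmetric]
    by (subst nn_integral_add)
      (use lborel.borel_measurable_nn_integral_fst[OF \<Phi>m2(1)] lborel.borel_measurable_nn_integral_fst[OF \<Phi>m2(2)] Em Ep in simp_all)
  finally show ?thesis by (simp add: E_def g_def m_def mult_2)
qed

subsection \<open>Passage to Lebesgue measurable functions\<close>

lemma sigma_finite_lebesgue: "sigma_finite_measure (lebesgue :: 'a::euclidean_space measure)"
proof (rule sigma_finite_measure.intro)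
  obtain A :: "'a set set" where A: "countable A \<and> A \<subseteq> sets lborel \<and>
    \<Union>A = space lborel \<and> (\<forall>a\<in>A. emeasure lborel a \<noteq> \<infinity>)"
    using lborel.sigma_finite_countable by (elim exE)
  show "\<exists>A :: 'a set set. countable A \<and> A \<subseteq> sets lebesgue \<and> \<Union>A = space lebesgue \<and> (\<forall>a\<in>A. emeasure lebesgue a \<noteq> \<infinity>)"
  proof (intro exI conjI ballI subsetI)
    show "countable A" using A by (elim conjE)
    show "\<Union>A = space lebesgue" using A by simp
  next
    fix a assume "a \<in> A"
    hence a: "a \<in> sets lborel" "emeasure lborel a \<noteq> \<infinity>" using A by blast+
    show "a \<in> sets lebesgue" using a by simp
    show "emeasure lebesgue a \<noteq> \<infinity>" using a by simp
  qed
qed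

lemma product_sigma_finite_lebesgue:
  "product_sigma_finite (\<lambda>_::'i. lebesgue :: 'a::euclidean_space measure)"
  by (rule product_sigma_finite.intro) (rule sigma_finite_lebesgue)

lemma measurable_ident_PiM_lebesgue:
  "(\<lambda>X. X) \<in> PiM I (\<lambda>_. lebesgue) \<rightarrow>\<^sub>M PiM I (\<lambda>_. lborel :: 'a::euclidean_space measure)"
proof (rule measurable_PiM_single')
  fix i assume "i \<in> I"
  hence "(\<lambda>X. X i) \<in> PiM I (\<lambda>_. lebesgue) \<rightarrow>\<^sub>M (lebesgue :: 'a measure)"
    by (rule measurable_component_singleton)
  moreover have "(\<lambda>x. x) \<in> lebesgue \<rightarrow>\<^sub>M (lborel :: 'a measure)"
    by (rule measurable_completion) simp
  ultimately show "(\<lambda>X. X i) \<in> PiM I (\<lambda>_. lebesgue) \<rightarrow>\<^sub>M (lborel :: 'a measure)"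
    by (rule measurable_compose)
qed (auto simp: space_PiM)

text \<open>The product of the completed measures lives on a larger sigma-algebra than the Borel
  product. The identity map pushes it forward to the Borel product measure, because the two agree on
  boxes.\<close>

lemma nn_integral_PiM_lebesgue:
  fixes G :: "('i \<Rightarrow> 'a::euclidean_space) \<Rightarrow> ennreal"
  assumes I: "finite I" and G: "G \<in> borel_measurable (PiM I (\<lambda>_. lborel))"
  shows "(\<integral>\<^sup>+X. G X \<partial>PiM I (\<lambda>_. lebesgue)) = (\<integral>\<^sup>+X. G X \<partial>PiM I (\<lambda>_. lborel))"
proof -
  interpret B: product_sigma_finite "\<lambda>_. lborel :: 'a measure" by (rule product_sigma_finite_lborel)
  interpret L: product_sigma_finite "\<lambda>_. lebesgue :: 'a measure" by (rule product_sigma_finite_lebesgue)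
  note id = measurable_ident_PiM_lebesgue[of I, where 'a='a]
  have "distr (PiM I (\<lambda>_. lebesgue)) (PiM I (\<lambda>_. lborel)) (\<lambda>X. X) = PiM I (\<lambda>_. lborel :: 'a measure)"
  proof (rule B.PiM_eqI[OF I])
    fix A :: "'i \<Rightarrow> 'a set" assume A: "\<And>i. i \<in> I \<Longrightarrow> A i \<in> sets lborel"
    hence PE: "Pi\<^sub>E I A \<in> sets (PiM I (\<lambda>_. lborel))"
      using I by (intro sets_PiM_I_finite) auto
    have "emeasure (distr (PiM I (\<lambda>_. lebesgue)) (PiM I (\<lambda>_. lborel)) (\<lambda>X. X)) (Pi\<^sub>E I A)
        = emeasure (PiM I (\<lambda>_. lebesgue)) (Pi\<^sub>E I A)"
    proof -
      have "(\<lambda>X. X) -` Pi\<^sub>E I A \<inter> space (PiM I (\<lambda>_. lebesgue)) = Pi\<^sub>E I A"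
        by (auto simp: space_PiM PiE_iff)
      thus ?thesis by (subst emeasure_distr[OF id PE]) simp
    qed
    also have "\<dots> = (\<Prod>i\<in>I. emeasure lborel (A i))"
      using A I by (subst L.emeasure_PiM) (auto intro!: prod.cong)
    finally show "emeasure (distr (PiM I (\<lambda>_. lebesgue)) (PiM I (\<lambda>_. lborel)) (\<lambda>X. X)) (Pi\<^sub>E I A) = (\<Prod>i\<in>I. emeasure lborel (A i))" .
  qed simp
  thus ?thesis using nn_integral_distr[OF id, of G] G by simp
qed

lemma AE_PiM_lebesgue_all:
  fixes P :: "'a::euclidean_space \<Rightarrow> bool"
  assumes I: "finite I" and P: "AE x in lborel. P x"
  shows "AE X in PiM I (\<lambda>_. lebesgue). \<forall>i\<in>I. P (X i)"
proof -
  interpret L: product_sigma_finite "\<lambda>_. lebesgue :: 'a measure" by (rule product_sigma_finite_lebesgue)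
  from P obtain N where N: "N \<in> null_sets lborel" "{x. \<not> P x} \<subseteq> N"
    by (auto elim!: AE_E3 simp: eventually_ae_filter)
  have "AE X in PiM I (\<lambda>_. lebesgue). P (X i)" if i: "i \<in> I" for i
  proof (rule AE_I')
    let ?A = "\<lambda>j. if j = i then N else (UNIV :: 'a set)"
    have "emeasure (PiM I (\<lambda>_. lebesgue)) (Pi\<^sub>E I ?A) = (\<Prod>j\<in>I. emeasure lebesgue (?A j))"
      using N I by (intro L.emeasure_PiM) auto
    \<comment> \<open>The other factors are infinite, and in \<open>ennreal\<close> 0 times
      \<infinity> is 0.\<close>
    also have "\<dots> = 0"
      using I i null_setsD1[OF N(1)] null_setsD2[OF N(1)] by (intro prod_zero) (auto intro!: bexI[of _ i])
    finally show "Pi\<^sub>E I ?A \<in> null_sets (PiM I (\<lambda>_. lebesgue))"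
      using I null_setsD2[OF N(1)] by (intro null_setsI sets_PiM_I_finite) auto
    show "{X \<in> space (PiM I (\<lambda>_. lebesgue)). \<not> P (X i)} \<subseteq> Pi\<^sub>E I ?A"
      using N(2) by (auto simp: space_PiM PiE_iff extensional_def)
  qed
  thus ?thesis using I by (simp add: AE_finite_all)
qed

text \<open>For almost every tuple all vertices avoid the null set where \<open>f\<close> and
  \<open>g\<close> differ, and then the two simplices coincide.\<close>

lemma energy_eq_lborel:
  fixes f g :: "'a::euclidean_space \<Rightarrow> real"
  assumes gm: "g \<in> borel_measurable borel" and fg: "AE x in lborel. f x = g x"
  shows "energy p q f = (\<integral>\<^sup>+X. ennreal (measure lebesgue (convex hull {graph_pt g (X i) | i. i \<le> DIM('a) + 1}) powr p
        / diam_pts (DIM('a) + 1) X powr (real (DIM('a) + 2) * q)) \<partial>PiM {..DIM('a) + 1} (\<lambda>_. lborel))"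
proof -
  let ?m = "DIM('a) + 1"
  have "energy p q f = (\<integral>\<^sup>+X. ennreal (measure lebesgue (convex hull {graph_pt g (X i) | i. i \<le> ?m}) powr p
        / diam_pts ?m X powr (real (DIM('a) + 2) * q)) \<partial>PiM {..?m} (\<lambda>_. lebesgue))"
    unfolding energy_def
  proof (rule nn_integral_cong_AE, rule AE_mp[OF AE_PiM_lebesgue_all[OF _ fg, of "{..?m}"]], simp, rule AE_I2, rule impI)
    fix X :: "nat \<Rightarrow> 'a" assume "\<forall>i\<in>{..?m}. f (X i) = g (X i)"
    hence "{graph_pt f (X i) | i. i \<le> ?m} = {graph_pt g (X i) | i. i \<le> ?m}"
      by (intro Collect_cong ex_cong1) (auto simp: graph_pt_def)
    thus "ennreal (measure lebesgue (convex hull {graph_pt f (X i) | i. i \<le> ?m}) powr p / diam_pts ?m X powr (real (DIM('a) + 2) * q))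
      = ennreal (measure lebesgue (convex hull {graph_pt g (X i) | i. i \<le> ?m}) powr p / diam_pts ?m X powr (real (DIM('a) + 2) * q))"
      by (simp only:)
  qed
  also have "\<dots> = (\<integral>\<^sup>+X. ennreal (measure lebesgue (convex hull {graph_pt g (X i) | i. i \<le> ?m}) powr p
        / diam_pts ?m X powr (real (DIM('a) + 2) * q)) \<partial>PiM {..?m} (\<lambda>_. lborel))"
  proof (rule nn_integral_PiM_lebesgue)
    note [measurable] = borel_measurable_hull_volume[OF gm, of ?m] borel_measurable_diam_pts[of ?m, where 'a='a]
    show "(\<lambda>X. ennreal (measure lebesgue (convex hull {graph_pt g (X i) | i. i \<le> ?m}) powr p
        / diam_pts ?m X powr (real (DIM('a) + 2) * q))) \<in> borel_measurable (PiM {..?m} (\<lambda>_. lborel))"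
      by measurable
  qed simp
  finally show ?thesis .
qed

lemma AE_lborel_translate:
  fixes P :: "'a::euclidean_space \<Rightarrow> bool"
  assumes "AE x in lborel. P x"
  shows "AE h in lborel. P (x + h)" "AE h in lborel. P (x - h)"
proof -
  have *: "AE h in lborel. P (T h)" if T: "T \<in> borel_measurable borel" "distr lborel borel T = lborel" for T :: "'a \<Rightarrow> 'a"
  proof -
    from assms obtain N where N: "N \<in> null_sets lborel" "{x. \<not> P x} \<subseteq> N"
      by (auto elim!: AE_E3 simp: eventually_ae_filter)
    have "emeasure lborel (T -` N) = emeasure (distr lborel borel T) N"
      using N T(1) by (subst emeasure_distr) auto
    also have "\<dots> = 0" using N T(2) by auto
    finally have "T -` N \<in> null_sets lborel"
      using measurable_sets[OF T(1), of N] null_setsD2[OF N(1)] by (intro null_setsI) auto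
    thus ?thesis using N(2) by (intro AE_I') auto
  qed
  show "AE h in lborel. P (x + h)" by (rule *) (auto simp: lborel_distr_plus)
  have "distr lborel borel (\<lambda>h. x - h) = distr (distr lborel borel uminus) borel ((+) x)"
    by (subst distr_distr) (auto simp: comp_def)
  thus "AE h in lborel. P (x - h)"
    by (intro *) (auto simp: lborel_distr_uminus_euclidean lborel_distr_plus)
qed

text \<open>The exceptional sets are nested: for almost every x the values at x agree, and for each
  such x the values at x + h and x - h agree for almost every h.\<close>

lemma sobolev_seminorm_pow_eq_lborel:
  fixes f g :: "'a::euclidean_space \<Rightarrow> real"
  assumes fg: "AE x in lborel. f x = g x"
  shows "sobolev_seminorm_pow s p f = (\<integral>\<^sup>+x. (\<integral>\<^sup>+h. ennreal (\<bar>second_diff g h x\<bar> powr p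
     / norm h powr (real DIM('a) + (1 + s) * p)) \<partial>lborel) \<partial>lborel)"
  unfolding sobolev_seminorm_pow_def nn_integral_completion
proof (rule nn_integral_cong_AE, rule AE_mp[OF fg], rule AE_I2, rule impI)
  fix x assume x: "f x = g x"
  show "(\<integral>\<^sup>+h. ennreal (\<bar>f (x + h) - 2 * f x + f (x - h)\<bar> powr p / norm h powr (real DIM('a) + (1 + s) * p)) \<partial>lborel)
    = (\<integral>\<^sup>+h. ennreal (\<bar>second_diff g h x\<bar> powr p / norm h powr (real DIM('a) + (1 + s) * p)) \<partial>lborel)"
    using AE_lborel_translate[OF fg, of x] x
    by (intro nn_integral_cong_AE) (auto simp: second_diff_def)
qed

section \<open>The two-sided estimate\<close>

theorem theorem1p2:
  fixes s p q :: real
  assumes "0 < s" "s < 1" "1 < p" "real DIM('a::euclidean_space) / p < 1 + s"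
    and "q = real (DIM('a) * (DIM('a) + 1)) / real (DIM('a) + 2)
             + p * (real DIM('a) + 1 + s) / real (DIM('a) + 2)"
  shows "(\<forall>f :: 'a \<Rightarrow> real. f \<in> borel_measurable lebesgue \<longrightarrow>
            (energy p q f < \<infinity> \<longleftrightarrow> sobolev_seminorm_pow s p f < \<infinity>))
       \<and> (\<exists>C>0. \<forall>f :: 'a \<Rightarrow> real. f \<in> borel_measurable lebesgue \<longrightarrow>
            ennreal (1 / C) * sobolev_seminorm_pow s p f \<le> energy p q f
            \<and> energy p q f \<le> ennreal C * sobolev_seminorm_pow s p f)"
proof -
  let ?n = "DIM('a)"
  define \<beta> where "\<beta> = real (?n * (?n + 1)) + p * (real ?n + 1 + s)"
  define \<gamma> where "\<gamma> = real ?n + (1 + s) * p"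
  have q: "real (?n + 2) * q = \<beta>"
    unfolding assms(5) \<beta>_def distrib_left by simp
  have \<gamma>: "0 < \<gamma>" using assms by (auto simp: \<gamma>_def intro!: add_nonneg_pos mult_pos_pos)
  define c1 where "c1 = \<beta> * ((2 * unit_ball_vol ?n) powr p * approx_const ?n p) * (2 * real (?n + 2) * unit_ball_vol ?n ^ (?n + 1)) / \<gamma>"
  define c2 where "c2 = graph_simplex_const ?n powr p / (2 powr p * 4 powr \<beta>) * (unit_ball_vol ?n * (1 / (2 * real ?n)) ^ ?n) ^ ?n"
  have "0 < graph_simplex_const ?n" "0 < unit_ball_vol ?n * (1 / (2 * real ?n)) ^ ?n"
    by (simp_all add: graph_simplex_const_def)
  hence c2: "0 < c2" unfolding c2_def by (intro mult_pos_pos divide_pos_pos zero_less_power) auto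
  \<comment> \<open>2 / c2 instead of 1 / c2, because the lower estimate counts the energy twice;
    the 1 makes C positive.\<close>
  define C where "C = max 1 (max c1 (2 / c2))"
  have C: "0 < C" "c1 \<le> C" "1 / C \<le> c2 / 2"
  proof -
    have "2 / c2 \<le> C" "0 < C" by (auto simp: C_def)
    thus "1 / C \<le> c2 / 2" using c2 by (simp add: field_simps)
  qed (auto simp: C_def)
  have bounds: "ennreal (1 / C) * sobolev_seminorm_pow s p f \<le> energy p q f
            \<and> energy p q f \<le> ennreal C * sobolev_seminorm_pow s p f" if f: "f \<in> borel_measurable lebesgue" for f :: "'a \<Rightarrow> real"
  proof -
    obtain g where g: "g \<in> borel_measurable borel" "AE x in lborel. f x = g x"
      using completion_ex_borel_measurable_real[OF f] by auto
    define S where "S = (\<integral>\<^sup>+x. (\<integral>\<^sup>+h. ennreal (\<bar>second_diff g h x\<bar> powr p / norm h powr \<gamma>) \<partial>lborel) \<partial>lborel)"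
    define E where "E = (\<integral>\<^sup>+X. ennreal (measure lebesgue (convex hull {graph_pt g (X i) | i. i \<le> ?n + 1}) powr p
        / diam_pts (?n + 1) X powr \<beta>) \<partial>PiM {..?n + 1} (\<lambda>_. lborel))"
    have eS: "sobolev_seminorm_pow s p f = S"
      unfolding S_def \<gamma>_def by (rule sobolev_seminorm_pow_eq_lborel[OF g(2)])
    have eE: "energy p q f = E"
      unfolding E_def energy_eq_lborel[OF g] q ..
    have low: "ennreal c2 * S \<le> 2 * E"
      unfolding S_def E_def c2_def \<beta>_def \<gamma>_def by (rule energy_integral_ge) (use g assms in auto)
    have "ennreal (1 / C) * S \<le> ennreal (1 / 2 * c2) * S"
      using C by (intro mult_right_mono ennreal_leI) auto
    also have "\<dots> = ennreal (1 / 2) * (ennreal c2 * S)"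
      using c2 by (subst ennreal_mult) (auto simp: mult.assoc)
    also have "\<dots> \<le> ennreal (1 / 2) * (2 * E)"
      by (intro mult_left_mono low) auto
    also have "\<dots> = (ennreal (1 / 2) * ennreal 2) * E" by (simp add: mult.assoc)
    also have "ennreal (1 / 2) * ennreal 2 = 1" by (subst ennreal_mult[symmetric]) auto
    finally have 1: "ennreal (1 / C) * S \<le> E" by simp
    have 2: "E \<le> ennreal C * S"
    \<comment> \<open>The mollification argument requires local integrability, which a finite
      seminorm provides; for S = \<infinity> the bound is trivial because C > 0.\<close>
    proof (cases "S < \<infinity>")
      case True
      have "loc_integrable g"
        using loc_integrable_if_seminorm_finite[OF g(1) assms(3) \<gamma>] True by (simp add: S_def)
      hence "E \<le> ennreal c1 * S"
        unfolding S_def E_def c1_def \<beta>_def \<gamma>_def by (rule energy_integral_le) (use g assms in auto)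
      also have "\<dots> \<le> ennreal C * S" using C by (intro mult_right_mono ennreal_leI) auto
      finally show ?thesis .
    next
      case False
      hence "S = \<infinity>" by (simp add: less_top[symmetric])
      thus ?thesis using C by (simp add: ennreal_mult_top)
    qed
    show ?thesis unfolding eS eE using 1 2 by simp
  qed
  have "energy p q f < \<infinity> \<longleftrightarrow> sobolev_seminorm_pow s p f < \<infinity>" if "f \<in> borel_measurable lebesgue" for f :: "'a \<Rightarrow> real"
  proof
    assume "energy p q f < \<infinity>"
    hence "ennreal (1 / C) * sobolev_seminorm_pow s p f < \<infinity>"
      using le_less_trans bounds[OF that] by blast
    thus "sobolev_seminorm_pow s p f < \<infinity>" using C by (auto simp: ennreal_mult_less_top)
  next
    assume "sobolev_seminorm_pow s p f < \<infinity>"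
    hence "ennreal C * sobolev_seminorm_pow s p f < \<infinity>" by (simp add: ennreal_mult_less_top)
    thus "energy p q f < \<infinity>" using le_less_trans bounds[OF that] by blast
  qed
  thus ?thesis using bounds C(1) by blast
qed

end
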